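(* Suppose $\mathbf X$ and $Y$ are independent, and that the following three conditions hold, where $\mathbf X_1,\mathbf X_2,\mathbf X_3,\mathbf X_4$ are i.i.d. copies of $\mathbf X$ and $d$ is the double centered distance: (1) $\mathbb E\|\mathbf X\|^4<\infty$; (2) $\dfrac{\mathbb E\, d^4(\mathbf X_1,\mathbf X_2)}{n\,(\mathbb E\, d^2(\mathbf X_1,\mathbf X_2))^2}\to 0$; (3) $\dfrac{\mathbb E[d(\mathbf X_1,\mathbf X_3)d(\mathbf X_2,\mathbf X_3)d(\mathbf X_1,\mathbf X_4)d(\mathbf X_2,\mathbf X_4)]}{(\mathbb E\, d^2(\mathbf X_1,\mathbf X_2))^2}\to 0$. Then, as $\min\{n_1,\dots,n_K\}\to\infty$ and $p\to\infty$, $$\frac{\mathrm{gCov}_n(\mathbf X,Y)}{\sigma_0}\stackrel{d}{\longrightarrow}\mathcal N(0,1),$$ where $\sigma_0^2=\Big(\sum_{k=1}^K \hat p_k^2\binom{n_k}{2}^{-1}-\binom n2^{-1}\Big)\mathbb E\, d^2(\mathbf X_1,\mathbf X_2)$ is the variance of $\mathrm{gCov}_n(\mathbf X,Y)$ (class sizes being regarded as given).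
   Context: $\|\cdot\|$ is the Euclidean norm. $\mathbf X$ is an $\mathbb R^p$-valued random vector with distribution $F$; $Y$ is a categorical variable with values $L_1,\dots,L_K$ ($K$ fixed) and $P(Y=L_k)=p_k>0$; the conditional distribution of $\mathbf X$ given $Y=L_k$ is $F_k$ (under independence $F_1=\dots=F_K=F$). One observes an i.i.d. sample $(\mathbf X_1,Y_1),\dots,(\mathbf X_n,Y_n)$ from the joint distribution of $(\mathbf X,Y)$; $n_k$ is the number of observations with $Y_i=L_k$, these observations are denoted $\mathbf X^{(k)}_1,\dots,\mathbf X^{(k)}_{n_k}$, and $\hat p_k=n_k/n$. The asymptotics are along a sequence in which the sample size $n$ and the dimension $p=p(n)$ both diverge in an arbitrary fashion (the distribution of $\mathbf X$ may change with $p$); all limits are along this sequence. The sample Gini covariance is $\mathrm{gCov}_n(\mathbf X,Y)=U_n-\sum_{k=1}^K\hat p_kU_{n_k}$, where $U_n=\binom n2^{-1}\sum_{1\le i<j\le n}\|\mathbf X_i-\mathbf X_j\|$ and $U_{n_k}=\binom{n_k}2^{-1}\sum_{1\le i<j\le n_k}\|\mathbf X^{(k)}_i-\mathbf X^{(k)}_j\|$. The double centered distance is, for $\mathbf X_1,\mathbf X_2$ i.i.d. from $F$, $d(\mathbf X_1,\mathbf X_2)=\|\mathbf X_1-\mathbf X_2\|-\mathbb E(\|\mathbf X_1-\mathbf X_2\|\mid\mathbf X_1)-\mathbb E(\|\mathbf X_1-\mathbf X_2\|\mid\mathbf X_2)+\mathbb E\|\mathbf X_1-\mathbf X_2\|$.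 *)

theory Defs
  imports "HOL-Probability.Probability"
begin

text \<open>
  The dimension varies along the sequence, so a vector of dimension p is a function on
  the index set {..<p}: a point of the space of the product measurable space below, which is
  Euclidean p-space with its Borel sets.
\<close>

definition Rvec :: "nat \<Rightarrow> (nat \<Rightarrow> real) measure" where
  "Rvec p = PiM {..<p} (\<lambda>_. borel)"

definition enorm :: "nat \<Rightarrow> (nat \<Rightarrow> real) \<Rightarrow> real" where
  "enorm p x = L2_set x {..<p}"

definition edist :: "nat \<Rightarrow> (nat \<Rightarrow> real) \<Rightarrow> (nat \<Rightarrow> real) \<Rightarrow> real" where
  "edist p x y = enorm p (\<lambda>i. x i - y i)"

text \<open>
  Independence of two random variables with values in different types: the library's
  \<^const>\<open>prob_space.indep_var\<close> needs a common value type, so this is stated with the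
  generated set families.
\<close>

definition indep_rvs ::
  "'a measure \<Rightarrow> 'b measure \<Rightarrow> ('a \<Rightarrow> 'b) \<Rightarrow> 'c measure \<Rightarrow> ('a \<Rightarrow> 'c) \<Rightarrow> bool" where
  "indep_rvs M S X T Y \<longleftrightarrow>
     X \<in> measurable M S \<and> Y \<in> measurable M T \<and>
     prob_space.indep_set M
       {X -` A \<inter> space M |A. A \<in> sets S} {Y -` B \<inter> space M |B. B \<in> sets T}"

definition iid_sample :: "'a measure \<Rightarrow> 'b measure \<Rightarrow> nat \<Rightarrow> (nat \<Rightarrow> 'a \<Rightarrow> 'b) \<Rightarrow> bool" where
  "iid_sample M J n Z \<longleftrightarrow>
     prob_space.indep_vars M (\<lambda>_. J) Z {1..n} \<and> (\<forall>i\<in>{1..n}. distr M J (Z i) = J)"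

text \<open>
  The joint law of r i.i.d. copies of a variable with law F; the copies are the coordinates
  w 1, ..., w r.
\<close>

definition iid_copies :: "'b measure \<Rightarrow> nat \<Rightarrow> (nat \<Rightarrow> 'b) measure" where
  "iid_copies F r = PiM {1..r} (\<lambda>_. F)"

text \<open>
  The double centered distance as a function of the values of the two copies. Since the copies
  are independent, the conditional expectation of the distance given that one of them equals a
  point is the integral of the distance to that point with respect to F.
\<close>

definition dcd :: "nat \<Rightarrow> (nat \<Rightarrow> real) measure \<Rightarrow> (nat \<Rightarrow> real) \<Rightarrow> (nat \<Rightarrow> real) \<Rightarrow> real" where
  "dcd p F x y =
     edist p x y - (\<integral>v. edist p x v \<partial>F) - (\<integral>u. edist p u y \<partial>F)
       + (\<integral>w. edist p (w 1) (w 2) \<partial>iid_copies F 2)"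

definition dcd_moment :: "nat \<Rightarrow> (nat \<Rightarrow> real) measure \<Rightarrow> nat \<Rightarrow> real" where
  "dcd_moment p F r = (\<integral>w. dcd p F (w 1) (w 2) ^ r \<partial>iid_copies F 2)"

definition dcd_cycle :: "nat \<Rightarrow> (nat \<Rightarrow> real) measure \<Rightarrow> real" where
  "dcd_cycle p F =
     (\<integral>w. dcd p F (w 1) (w 3) * dcd p F (w 2) (w 3) * dcd p F (w 1) (w 4) * dcd p F (w 2) (w 4)
        \<partial>iid_copies F 4)"

text \<open>
  The U-statistic of the observations with index in I. For the observations of one class, I is
  the set of their positions in the whole sample, so no renumbering is needed. If I has fewer
  than two elements, the value is 0.
\<close>

definition U_stat :: "nat \<Rightarrow> (nat \<Rightarrow> nat \<Rightarrow> real) \<Rightarrow> nat set \<Rightarrow> real" where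
  "U_stat p x I =
     (\<Sum>(i, j)\<in>{(i, j). i \<in> I \<and> j \<in> I \<and> i < j}. edist p (x i) (x j)) / real (card I choose 2)"

definition class_set :: "nat \<Rightarrow> (nat \<Rightarrow> 'c) \<Rightarrow> 'c \<Rightarrow> nat set" where
  "class_set n y l = {i \<in> {1..n}. y i = l}"

definition class_size :: "nat \<Rightarrow> (nat \<Rightarrow> 'c) \<Rightarrow> 'c \<Rightarrow> nat" where
  "class_size n y l = card (class_set n y l)"

definition gCov ::
  "nat \<Rightarrow> (nat \<Rightarrow> 'c) \<Rightarrow> nat \<Rightarrow> nat \<Rightarrow> (nat \<Rightarrow> nat \<Rightarrow> real) \<Rightarrow> (nat \<Rightarrow> 'c) \<Rightarrow> real" where
  "gCov K L p n x y =
     U_stat p x {1..n}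
       - (\<Sum>k=1..K. real (class_size n y (L k)) / real n * U_stat p x (class_set n y (L k)))"

text \<open>The argument c gives the class sizes, D the second moment of the double centered distance.\<close>

definition sigma0_sq :: "nat \<Rightarrow> nat \<Rightarrow> (nat \<Rightarrow> nat) \<Rightarrow> real \<Rightarrow> real" where
  "sigma0_sq K n c D =
     ((\<Sum>k=1..K. (real (c k) / real n)\<^sup>2 * inverse (real (c k choose 2)))
        - inverse (real (n choose 2))) * D"

end

theory Submission
  imports Defs
begin

text \<open>
  Given the labels, the observations are still independent with law F, and gCov is a weighted sum
  of the distances over all pairs i < j. Once every class has two members, the weights of the
  pairs containing a fixed index add up to 0, so functions of one variable may be subtracted from the
  distance and gCov equals the sum of w i j * d (X i) (X j) with the double centered distance d
  (\<open>gCov_eq_dcd_sum\<close>). Different pairs are now uncorrelated; this gives conditional mean 0 and the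
  conditional variance, the sum of (w i j)^2 times E d^2, which is sigma0^2.

  For normality, order the summands by their larger index. After standardization the sum is a
  martingale with differences \<xi> j, the sum over i < j of v i j * d (X i) (X j), because d integrates to
  0 in each variable. A martingale with total variance 1 is nearly normal if the sum of the
  E \<xi>_j^4 is small and the sum V of the conditional variances is close to 1 in mean square. If every
  class has at least \<delta> n members, then v i j = O(1/n), and
  the sum of the fourth moments is of order E d^4 / (n (E d^2)^2), the quantity of the second condition.
  In terms of G u v = E d(u, Z) d(v, Z), the difference V - 1 consists of a diagonal part,
  whose mean square has that order too, and of an off-diagonal part with mean square of
  order E G^2 / (E d^2)^2; here E G^2 is the four-cycle moment of the third condition.

  All of this is done with explicit error bounds for characteristic functions
  (\<open>martingale_char_bound\<close>, \<open>quadratic_form_char_bound\<close>, \<open>gCov_char_bound_given_labels\<close>) that do not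
  depend on the labels as long as no class is smaller than \<delta> n. Hence they survive averaging over the
  labels, at the cost of the exponentially small probability of a class that is too small
  (\<open>standardized_char_bound\<close>). Levy's continuity theorem turns convergence of the
  characteristic functions into convergence in distribution.

  Conditional expectations never appear as such. On a product space, conditioning on all coordinates
  but one is integration over an independent copy of that coordinate
  (\<open>integral_resample\<close>), and all orthogonality and martingale arguments use this identity.
\<close>

section \<open>Products of one law and a martingale central limit bound\<close>

(* Index sets are intervals {1..n}; the simplifier must not turn them into {Suc 0..n}. *)
declare One_nat_def [simp del]

lemma abs_power_le_fourth_power:
  fixes y :: real
  assumes "k \<le> 4"
  shows "\<bar>y\<bar> ^ k \<le> 1 + y ^ 4"
proof -
  have *: "\<bar>y\<bar> ^ 4 = y ^ 4" by simp
  show ?thesis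
  proof (cases "\<bar>y\<bar> \<le> 1")
    case True
    then have "\<bar>y\<bar> ^ k \<le> 1" by (intro power_le_one) auto
    moreover have "0 \<le> y ^ 4" by simp
    ultimately show ?thesis by linarith
  next
    case False
    then have "\<bar>y\<bar> ^ k \<le> \<bar>y\<bar> ^ 4" by (intro power_increasing assms) auto
    then show ?thesis unfolding * by linarith
  qed
qed

lemma (in prob_space) integrable_lower_powers:
  fixes f :: "'a \<Rightarrow> real"
  assumes [measurable]: "f \<in> borel_measurable M" and f: "integrable M (\<lambda>x. f x ^ 4)" and k: "k \<le> 4"
  shows "integrable M (\<lambda>x. \<bar>f x\<bar> ^ k)" "integrable M (\<lambda>x. f x ^ k)"
proof -
  have 1: "integrable M (\<lambda>x. 1 + f x ^ 4)" using f by auto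
  have 2: "norm (\<bar>f x\<bar> ^ k) \<le> norm (1 + f x ^ 4)" "norm (f x ^ k) \<le> norm (1 + f x ^ 4)" for x
  proof -
    have "0 \<le> 1 + f x ^ 4" by (simp add: add_nonneg_nonneg)
    then show "norm (\<bar>f x\<bar> ^ k) \<le> norm (1 + f x ^ 4)" "norm (f x ^ k) \<le> norm (1 + f x ^ 4)"
      using abs_power_le_fourth_power[OF k, of "f x"] unfolding real_norm_def power_abs abs_abs by linarith+
  qed
  show "integrable M (\<lambda>x. \<bar>f x\<bar> ^ k)" "integrable M (\<lambda>x. f x ^ k)"
    by (rule Bochner_Integration.integrable_bound[OF 1]; use 2 in auto)+
qed

lemma exp_minus_approx:
  fixes y :: real
  assumes "0 \<le> y"
  shows "\<bar>exp (- y) - (1 - y)\<bar> \<le> y\<^sup>2 / 2"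
proof -
  have "1 \<le> (1 + y + y\<^sup>2 / 2) * (1 - y + y\<^sup>2 / 2)"
  proof -
    have "(1 + y + y\<^sup>2 / 2) * (1 - y + y\<^sup>2 / 2) = 1 + (y\<^sup>2)\<^sup>2 / 4"
      by (simp add: field_simps power2_eq_square)
    then show ?thesis by simp
  qed
  moreover have "0 < 1 - y + y\<^sup>2 / 2"
  proof -
    have "1 - y + y\<^sup>2 / 2 = ((1 - y)\<^sup>2 + 1) / 2" by (simp add: field_simps power2_eq_square)
    also have "\<dots> > 0" by (simp add: add_nonneg_pos)
    finally show ?thesis .
  qed
  ultimately have "1 \<le> exp y * (1 - y + y\<^sup>2 / 2)"
    using exp_lower_Taylor_quadratic[OF assms]
    by (meson less_imp_le mult_right_mono order_trans)
  then have "exp (- y) \<le> 1 - y + y\<^sup>2 / 2"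
    by (simp add: exp_minus field_simps)
  moreover have "1 - y \<le> exp (- y)" using exp_ge_add_one_self[of "- y"] by simp
  ultimately show ?thesis by simp
qed

lemma (in prob_space) square_expectation_le:
  fixes Z :: "'a \<Rightarrow> real"
  assumes "integrable M Z" "integrable M (\<lambda>x. (Z x)\<^sup>2)"
  shows "(expectation Z)\<^sup>2 \<le> expectation (\<lambda>x. (Z x)\<^sup>2)"
  using variance_eq[OF assms] variance_positive[of Z] by simp

text \<open>
  Both terms on the left agree with 1 - t^2 E Z^2 / 2, the first up to the third moment and the
  second up to (E Z^2)^2, which is at most E Z^4.
\<close>

lemma (in prob_space) iexp_centered_approx:
  fixes Z :: "'a \<Rightarrow> real"
  assumes Z[measurable]: "Z \<in> borel_measurable M" and Z4: "integrable M (\<lambda>x. Z x ^ 4)"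
    and zero: "expectation Z = 0"
  shows "cmod (expectation (\<lambda>x. iexp (t * Z x)) - exp (- (t\<^sup>2 * expectation (\<lambda>x. (Z x)\<^sup>2) / 2)))
    \<le> \<bar>t\<bar> ^ 3 / 6 * expectation (\<lambda>x. \<bar>Z x\<bar> ^ 3) + t ^ 4 / 8 * expectation (\<lambda>x. Z x ^ 4)"
proof -
  define v where "v = expectation (\<lambda>x. (Z x)\<^sup>2)"
  have 1: "integrable M Z" using integrable_lower_powers(2)[OF Z Z4, of 1] by simp
  have 2: "integrable M (\<lambda>x. (Z x)\<^sup>2)" using integrable_lower_powers(2)[OF Z Z4, of 2] by simp
  have 3: "integrable M (\<lambda>x. \<bar>Z x\<bar> ^ 3)" using integrable_lower_powers(1)[OF Z Z4, of 3] by simp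
  have v0: "0 \<le> v" unfolding v_def by (rule Bochner_Integration.integral_nonneg) simp
  have vv: "v\<^sup>2 \<le> expectation (\<lambda>x. Z x ^ 4)"
    using square_expectation_le[OF 2] Z4 unfolding v_def by (simp flip: power_mult)
  have ch: "char (distr M borel Z) t = expectation (\<lambda>x. iexp (t * Z x))"
    unfolding char_def by (subst integral_distr) auto
  have "cmod (expectation (\<lambda>x. iexp (t * Z x)) - (1 - t\<^sup>2 * v / 2))
      \<le> t\<^sup>2 / 6 * expectation (\<lambda>x. min (6 * (Z x)\<^sup>2) (\<bar>t\<bar> * \<bar>Z x\<bar> ^ 3))"
    unfolding ch[symmetric]
    by (rule order_trans[OF eq_refl char_approx3'[OF Z 1 2 zero _ refl, of v]])
       (auto simp: zero v_def)
  also have "\<dots> \<le> t\<^sup>2 / 6 * expectation (\<lambda>x. \<bar>t\<bar> * \<bar>Z x\<bar> ^ 3)"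
  proof (intro mult_left_mono integral_mono)
    show "integrable M (\<lambda>x. min (6 * (Z x)\<^sup>2) (\<bar>t\<bar> * \<bar>Z x\<bar> ^ 3))"
      using 2 3 by (intro integrable_min) auto
  qed (use 3 in auto)
  also have "\<dots> = \<bar>t\<bar> ^ 3 / 6 * expectation (\<lambda>x. \<bar>Z x\<bar> ^ 3)"
  proof -
    have "t\<^sup>2 * \<bar>t\<bar> = \<bar>t\<bar> ^ 3" by (simp add: power3_eq_cube power2_eq_square)
    then show ?thesis by (simp add: mult.assoc[symmetric])
  qed
  finally have A: "cmod (expectation (\<lambda>x. iexp (t * Z x)) - (1 - t\<^sup>2 * v / 2))
      \<le> \<bar>t\<bar> ^ 3 / 6 * expectation (\<lambda>x. \<bar>Z x\<bar> ^ 3)" by simp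
  have "\<bar>exp (- (t\<^sup>2 * v / 2)) - (1 - t\<^sup>2 * v / 2)\<bar> \<le> (t\<^sup>2 * v / 2)\<^sup>2 / 2"
    using v0 by (intro exp_minus_approx) auto
  also have "\<dots> = t ^ 4 / 8 * v\<^sup>2" by (simp add: power_mult_distrib power_divide flip: power_mult)
  also have "\<dots> \<le> t ^ 4 / 8 * expectation (\<lambda>x. Z x ^ 4)"
    using vv by (intro mult_left_mono) auto
  finally have B: "cmod (complex_of_real (1 - t\<^sup>2 * v / 2) - exp (- (t\<^sup>2 * v / 2)))
      \<le> t ^ 4 / 8 * expectation (\<lambda>x. Z x ^ 4)"
    unfolding of_real_diff[symmetric] norm_of_real by (simp add: abs_minus_commute)
  show ?thesis
    using norm_triangle_mono[OF A B] unfolding v_def by simp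
qed

text \<open>
  The distance of the characteristic function at t from that of the normal law, for a
  martingale whose differences have fourth moments of sum at most q^2 and whose conditional
  variances have a sum at mean square distance at most r^2 from 1.
\<close>

definition clt_error :: "real \<Rightarrow> real \<Rightarrow> real \<Rightarrow> real" where
  "clt_error t q r = exp (t\<^sup>2) * (\<bar>t\<bar> ^ 3 * q / 6 + t ^ 4 * q\<^sup>2 / 8 + 2 * r\<^sup>2 + t\<^sup>2 * r / 2)"

locale iid_coordinates = F: prob_space F for F :: "'b measure" +
  fixes N :: nat
begin

abbreviation P :: "(nat \<Rightarrow> 'b) measure" where
  "P \<equiv> PiM {1..N} (\<lambda>_. F)"

sublocale PF: product_prob_space "\<lambda>_. F" "{1..N}"
  by unfold_locales

lemma fun_upd_in_space:
  assumes "x \<in> space P" "u \<in> space F" "j \<in> {1..N}"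
  shows "x(j := u) \<in> space P"
  using assms by (auto simp: space_PiM PiE_iff extensional_def)

lemma measurable_upd[measurable]:
  assumes [measurable]: "f \<in> measurable M P" "g \<in> measurable M F" and j: "j \<in> {1..N}"
  shows "(\<lambda>z. (f z)(j := g z)) \<in> measurable M P"
proof (rule measurable_PiM_single')
  fix i assume i: "i \<in> {1..N}"
  show "(\<lambda>z. ((f z)(j := g z)) i) \<in> measurable M F"
    using i by (cases "i = j") (auto simp: fun_upd_def)
next
  show "(\<lambda>z. (f z)(j := g z)) \<in> space M \<rightarrow> (\<Pi>\<^sub>E i\<in>{1..N}. space F)"
    using fun_upd_in_space[OF measurable_space[OF assms(1)] measurable_space[OF assms(2)] j]
    by (auto simp: space_PiM)
qed

lemma measurable_upd_const[measurable (raw)]: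
  assumes x: "x \<in> space P" and j: "j \<in> {1..N}"
  shows "(\<lambda>u. x(j := u)) \<in> measurable F P"
  using x by (intro measurable_upd j) auto

lemma borel_measurable_resample:
  fixes f :: "(nat \<Rightarrow> 'b) \<Rightarrow> 'e::{banach, second_countable_topology}"
  assumes j: "j \<in> {1..N}" and [measurable]: "f \<in> borel_measurable P"
  shows "(\<lambda>x. \<integral>u. f (x(j := u)) \<partial>F) \<in> borel_measurable P"
  by (rule F.borel_measurable_lebesgue_integral) (use j in measurable)

text \<open>
  The inner integral is the conditional expectation given the coordinates other than j. It does
  not depend on the value of x at j, so Fubini's theorem for the remaining coordinates can be
  read as an integral over all of them again.
\<close>

lemma
  fixes f :: "(nat \<Rightarrow> 'b) \<Rightarrow> 'e::{banach, second_countable_topology}"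
  assumes j: "j \<in> {1..N}" and f: "integrable P f"
  shows integral_resample: "integral\<^sup>L P f = (\<integral>x. (\<integral>u. f (x(j := u)) \<partial>F) \<partial>P)"
    and integrable_resample: "integrable P (\<lambda>x. \<integral>u. f (x(j := u)) \<partial>F)"
proof -
  let ?J = "{1..N} - {j}" let ?Q = "PiM ?J (\<lambda>_. F)"
  define g where "g = (\<lambda>x. \<integral>u. f (x(j := u)) \<partial>F)"
  have [measurable]: "f \<in> borel_measurable P" using f by auto
  have ins: "{1..N} = insert j ?J" using j by auto
  have upd[measurable]: "(\<lambda>(x, u). x(j := u)) \<in> measurable (?Q \<Otimes>\<^sub>M F) P"
    unfolding case_prod_beta by (rule measurable_fun_upd[where J="?J"]) (use j in auto)
  have gm: "g \<in> borel_measurable ?Q"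
    unfolding g_def by (rule F.borel_measurable_lebesgue_integral) (use upd in measurable)
  have f': "integrable (PiM (insert j ?J) (\<lambda>_. F)) f" using f ins by simp
  have Q: "?Q = distr P ?Q (\<lambda>x. restrict x ?J)"
    by (rule PF.distr_restrict) auto
  have rm: "(\<lambda>x. restrict x ?J) \<in> measurable P ?Q"
    by (rule measurable_restrict_subset) auto
  have eq: "g (restrict x ?J) = g x" if "x \<in> space P" for x
  proof -
    have "(restrict x ?J)(j := u) = x(j := u)" for u
      using that by (auto simp: fun_eq_iff space_PiM PiE_iff extensional_def restrict_def)
    then show ?thesis by (simp add: g_def)
  qed
  have "integral\<^sup>L P f = integral\<^sup>L ?Q g"
    using PF.product_integral_insert[OF _ _ f'] ins by (auto simp: g_def)
  also have "\<dots> = (\<integral>x. g (restrict x ?J) \<partial>P)"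
    by (subst Q, rule integral_distr[OF rm gm])
  also have "\<dots> = integral\<^sup>L P g"
    by (rule Bochner_Integration.integral_cong) (simp_all add: eq del: One_nat_def)
  finally show "integral\<^sup>L P f = (\<integral>x. (\<integral>u. f (x(j := u)) \<partial>F) \<partial>P)" by (simp add: g_def)
  have iQ: "integrable ?Q g"
  proof -
    have "distr (F \<Otimes>\<^sub>M ?Q) P (\<lambda>(u, x). x(j := u)) = P"
      using distr_pair_PiM_eq_PiM[of ?J "\<lambda>_. F" j] ins F.prob_space_axioms by auto
    moreover have "(\<lambda>(u, x). x(j := u)) \<in> measurable (F \<Otimes>\<^sub>M ?Q) P"
      unfolding case_prod_beta by (rule measurable_fun_upd[where J="?J"]) (use j in auto)
    ultimately have "integrable (F \<Otimes>\<^sub>M ?Q) (\<lambda>(u, x). f (x(j := u)))"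
      using f integrable_distr_eq[of "\<lambda>(u, x). x(j := u)" "F \<Otimes>\<^sub>M ?Q" P f]
      by (simp add: split_beta')
    then show ?thesis
      unfolding g_def
      by (rule pair_sigma_finite.integrable_snd[rotated])
         (intro pair_sigma_finite.intro F.sigma_finite_measure_axioms
            prob_space_imp_sigma_finite prob_space_PiM F.prob_space_axioms)
  qed
  have "integrable P (\<lambda>x. g (restrict x ?J))"
    using integrable_distr_eq[OF rm gm] iQ Q by simp
  then have "integrable P g"
    by (rule iffD1[OF Bochner_Integration.integrable_cong, rotated -1]) (simp_all add: eq del: One_nat_def)
  then show "integrable P (\<lambda>x. \<integral>u. f (x(j := u)) \<partial>F)" by (simp add: g_def)
qed


lemma integral_coord:
  fixes f :: "'b \<Rightarrow> real"
  assumes i: "i \<in> {1..N}" and [measurable]: "f \<in> borel_measurable F"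
  shows "(\<integral>x. f (x i) \<partial>P) = integral\<^sup>L F f"
  using integral_distr[of "\<lambda>x. x i" P F f] PF.PiM_component[OF i] i by simp

lemma integrable_coord:
  fixes f :: "'b \<Rightarrow> real"
  assumes i: "i \<in> {1..N}" and [measurable]: "f \<in> borel_measurable F"
  shows "integrable P (\<lambda>x. f (x i)) \<longleftrightarrow> integrable F f"
  using integrable_distr_eq[of "\<lambda>x. x i" P F f] PF.PiM_component[OF i] i by simp

lemma integral_two_coords:
  fixes f :: "'b \<Rightarrow> 'b \<Rightarrow> real"
  assumes ij: "i \<in> {1..N}" "j \<in> {1..N}" "i \<noteq> j"
    and f: "(\<lambda>(u, v). f u v) \<in> borel_measurable (F \<Otimes>\<^sub>M F)"
    and int: "integrable P (\<lambda>x. f (x i) (x j))"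
  shows "(\<integral>x. f (x i) (x j) \<partial>P) = (\<integral>u. (\<integral>v. f u v \<partial>F) \<partial>F)"
proof -
  have "(\<integral>x. f (x i) (x j) \<partial>P) = (\<integral>x. (\<integral>v. f (x i) v \<partial>F) \<partial>P)"
    using integral_resample[OF ij(2) int] ij(3) by simp
  also have "\<dots> = (\<integral>u. (\<integral>v. f u v \<partial>F) \<partial>F)"
    using f by (intro integral_coord[OF ij(1)]) (rule F.borel_measurable_lebesgue_integral)
  finally show ?thesis .
qed

text \<open>
  The factor \<Phi> does not involve coordinate j, so resampling that coordinate replaces the
  bracket by its conditional expectation, to which the Taylor estimate applies.
\<close>

lemma martingale_step:
  fixes \<xi> :: "(nat \<Rightarrow> 'b) \<Rightarrow> real" and \<Phi> :: "(nat \<Rightarrow> 'b) \<Rightarrow> complex"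
  assumes j: "j \<in> {1..N}"
    and \<Phi>[measurable]: "\<Phi> \<in> borel_measurable P"
    and \<Phi>_bound: "\<And>x. x \<in> space P \<Longrightarrow> norm (\<Phi> x) \<le> B"
    and \<Phi>_free: "\<And>x u. x \<in> space P \<Longrightarrow> u \<in> space F \<Longrightarrow> \<Phi> (x(j := u)) = \<Phi> x"
    and \<xi>[measurable]: "\<xi> \<in> borel_measurable P"
    and \<xi>4: "integrable P (\<lambda>x. \<xi> x ^ 4)"
    and \<xi>4': "\<And>x. x \<in> space P \<Longrightarrow> integrable F (\<lambda>u. \<xi> (x(j := u)) ^ 4)"
    and zero: "\<And>x. x \<in> space P \<Longrightarrow> (\<integral>u. \<xi> (x(j := u)) \<partial>F) = 0"
    and s: "\<And>x. x \<in> space P \<Longrightarrow> (\<integral>u. (\<xi> (x(j := u)))\<^sup>2 \<partial>F) = s x"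
    and s_free: "\<And>x u. x \<in> space P \<Longrightarrow> u \<in> space F \<Longrightarrow> s (x(j := u)) = s x"
    and s_meas[measurable]: "s \<in> borel_measurable P"
  shows "norm (\<integral>x. \<Phi> x * (iexp (t * \<xi> x) - exp (- (t\<^sup>2 * s x / 2))) \<partial>P)
    \<le> B * (\<bar>t\<bar> ^ 3 / 6 * (\<integral>x. \<bar>\<xi> x\<bar> ^ 3 \<partial>P) + t ^ 4 / 8 * (\<integral>x. \<xi> x ^ 4 \<partial>P))"
    (is "norm (\<integral>x. ?f x \<partial>P) \<le> _")
proof -
  have s0: "0 \<le> s x" if "x \<in> space P" for x
    unfolding s[OF that, symmetric] by (rule Bochner_Integration.integral_nonneg) simp
  have "space P \<noteq> {}" by (rule PF.P.not_empty)
  then have B: "0 \<le> B" using \<Phi>_bound by (meson all_not_in_conv norm_ge_zero order_trans)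
  have \<xi>3: "integrable P (\<lambda>x. \<bar>\<xi> x\<bar> ^ 3)"
    using PF.P.integrable_lower_powers(1)[OF \<xi> \<xi>4, of 3] by simp
  have int: "integrable P ?f"
  proof (rule PF.P.integrable_const_bound[where B="B * 2"])
    show "AE x in P. norm (?f x) \<le> B * 2"
    proof (rule AE_I2)
      fix x assume x: "x \<in> space P"
      have "norm (iexp (t * \<xi> x) - exp (- (t\<^sup>2 * s x / 2))) \<le> 1 + 1"
        using s0[OF x] by (intro norm_triangle_le_diff add_mono) (auto simp: norm_of_real)
      then show "norm (?f x) \<le> B * 2"
        unfolding norm_mult using \<Phi>_bound[OF x] B by (intro mult_mono) auto
    qed
  qed measurable
  define g where "g = (\<lambda>x. \<bar>t\<bar> ^ 3 / 6 * (\<integral>u. \<bar>\<xi> (x(j := u))\<bar> ^ 3 \<partial>F) + t ^ 4 / 8 * (\<integral>u. \<xi> (x(j := u)) ^ 4 \<partial>F))"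
  have g: "integrable P g"
    unfolding g_def
    by (intro Bochner_Integration.integrable_add integrable_mult_right integrable_resample[OF j] \<xi>3 \<xi>4)
  have bd: "norm (\<integral>u. ?f (x(j := u)) \<partial>F) \<le> B * g x" if x: "x \<in> space P" for x
  proof -
    have [measurable]: "(\<lambda>u. \<xi> (x(j := u))) \<in> borel_measurable F"
      using x j by measurable
    have ie: "integrable F (\<lambda>u. iexp (t * \<xi> (x(j := u))))"
      by (rule F.integrable_const_bound[where B=1]) auto
    have "(\<integral>u. ?f (x(j := u)) \<partial>F)
        = (\<integral>u. \<Phi> x * (iexp (t * \<xi> (x(j := u))) - exp (- (t\<^sup>2 * s x / 2))) \<partial>F)"
      using x by (intro Bochner_Integration.integral_cong) (auto simp: \<Phi>_free s_free)
    also have "\<dots> = \<Phi> x * ((\<integral>u. iexp (t * \<xi> (x(j := u))) \<partial>F) - exp (- (t\<^sup>2 * s x / 2)))"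
      using ie by (simp add: F.prob_space)
    finally have "norm (\<integral>u. ?f (x(j := u)) \<partial>F)
        = norm (\<Phi> x) * norm ((\<integral>u. iexp (t * \<xi> (x(j := u))) \<partial>F) - exp (- (t\<^sup>2 * s x / 2)))"
      by (simp add: norm_mult)
    also have "\<dots> \<le> B * g x"
      using F.iexp_centered_approx[of "\<lambda>u. \<xi> (x(j := u))" t] x \<xi>4' zero s \<Phi>_bound B
      unfolding g_def by (intro mult_mono) auto
    finally show ?thesis .
  qed
  have "norm (\<integral>x. ?f x \<partial>P) = norm (\<integral>x. (\<integral>u. ?f (x(j := u)) \<partial>F) \<partial>P)"
    using integral_resample[OF j int] by simp
  also have "\<dots> \<le> (\<integral>x. norm (\<integral>u. ?f (x(j := u)) \<partial>F) \<partial>P)"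
    by (rule integral_norm_bound)
  also have "\<dots> \<le> (\<integral>x. B * g x \<partial>P)"
    using g bd integrable_resample[OF j int] by (intro integral_mono) auto
  also have "\<dots> = B * (\<bar>t\<bar> ^ 3 / 6 * (\<integral>x. \<bar>\<xi> x\<bar> ^ 3 \<partial>P) + t ^ 4 / 8 * (\<integral>x. \<xi> x ^ 4 \<partial>P))"
    unfolding g_def
    using integrable_resample[OF j \<xi>3] integrable_resample[OF j \<xi>4]
    by (simp add: integral_resample[OF j \<xi>3, symmetric] integral_resample[OF j \<xi>4, symmetric])
  finally show ?thesis .
qed


text \<open>
  The quantity that is carried through the martingale is E exp(i t S_m + t^2 V_m / 2), where S_m and
  V_m are the partial sums of the differences and of their conditional variances: if \<xi> (m+1) were
  conditionally normal, it would not change from m to m + 1. To keep the weight exp(t^2 V_m / 2) bounded it is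
  replaced by 0 once V_m exceeds 2. Since V_{m+1} depends only on the first m
  coordinates, this switch is made before \<xi> (m+1) is revealed and does not spoil the
  one-step comparison. The total loss is at most exp(t^2) P(V_N > 2), and in the end the weight is close to
  exp(t^2 / 2) because V_N is close to 1.
\<close>

theorem martingale_char_bound:
  fixes \<xi> s :: "nat \<Rightarrow> (nat \<Rightarrow> 'b) \<Rightarrow> real" and t q r :: real
  assumes \<xi>[measurable]: "\<And>j. j \<in> {1..N} \<Longrightarrow> \<xi> j \<in> borel_measurable P"
    and adapted: "\<And>j l x u. x \<in> space P \<Longrightarrow> u \<in> space F \<Longrightarrow> j \<in> {1..N} \<Longrightarrow> l \<in> {1..N} \<Longrightarrow> j < l
      \<Longrightarrow> \<xi> j (x(l := u)) = \<xi> j x"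
    and int4: "\<And>j. j \<in> {1..N} \<Longrightarrow> integrable P (\<lambda>x. \<xi> j x ^ 4)"
    and int4': "\<And>j x. j \<in> {1..N} \<Longrightarrow> x \<in> space P \<Longrightarrow> integrable F (\<lambda>u. \<xi> j (x(j := u)) ^ 4)"
    and zero: "\<And>j x. j \<in> {1..N} \<Longrightarrow> x \<in> space P \<Longrightarrow> (\<integral>u. \<xi> j (x(j := u)) \<partial>F) = 0"
    and s: "\<And>j x. j \<in> {1..N} \<Longrightarrow> x \<in> space P \<Longrightarrow> (\<integral>u. (\<xi> j (x(j := u)))\<^sup>2 \<partial>F) = s j x"
    and total: "(\<Sum>j=1..N. \<integral>x. (\<xi> j x)\<^sup>2 \<partial>P) = 1"
    and q: "0 < q" "(\<Sum>j=1..N. \<integral>x. \<xi> j x ^ 4 \<partial>P) \<le> q\<^sup>2"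
    and r: "0 < r" "integrable P (\<lambda>x. ((\<Sum>j=1..N. s j x) - 1)\<^sup>2)"
      "(\<integral>x. ((\<Sum>j=1..N. s j x) - 1)\<^sup>2 \<partial>P) \<le> r\<^sup>2"
  shows "cmod ((\<integral>x. iexp (t * (\<Sum>j=1..N. \<xi> j x)) \<partial>P) - exp (- (t\<^sup>2 / 2)))
    \<le> clt_error t q r"
proof -
  have s0: "0 \<le> s j x" if "j \<in> {1..N}" "x \<in> space P" for j x
    unfolding s[OF that, symmetric] by (rule Bochner_Integration.integral_nonneg) simp
  have [measurable]: "s j \<in> borel_measurable P" if j: "j \<in> {1..N}" for j
  proof -
    have "(\<lambda>x. \<integral>u. (\<xi> j (x(j := u)))\<^sup>2 \<partial>F) \<in> borel_measurable P"
      by (rule borel_measurable_resample[OF j]) (use j in measurable)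
    then show ?thesis
      by (rule iffD1[OF measurable_cong, rotated -1]) (use s j in auto)
  qed
  have s_free: "s j (x(l := u)) = s j x"
    if x: "x \<in> space P" and u: "u \<in> space F" and j: "j \<in> {1..N}" and l: "l \<in> {1..N}" "j \<le> l" for j l x u
  proof -
    have xl: "x(l := u) \<in> space P" by (rule fun_upd_in_space[OF x u l(1)])
    have "\<xi> j (x(l := u, j := v)) = \<xi> j (x(j := v))" if v: "v \<in> space F" for v
    proof (cases "l = j")
      case False
      then have "x(l := u, j := v) = (x(j := v))(l := u)" by (rule fun_upd_twist)
      then show ?thesis
        using adapted[OF fun_upd_in_space[OF x v j] u j l(1)] False l(2) by simp
    qed simp
    then show ?thesis
      unfolding s[OF j x, symmetric] s[OF j xl, symmetric]
      by (intro Bochner_Integration.integral_cong) auto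
  qed
  define S where "S m x = (\<Sum>j=1..m. \<xi> j x)" for m x
  define V where "V m x = (\<Sum>j=1..m. s j x)" for m x
  define g where "g m x = (if V m x \<le> 2 then exp (t\<^sup>2 / 2 * V m x) else 0)" for m x
  define D where "D j = \<bar>t\<bar> ^ 3 / 6 * (\<integral>x. \<bar>\<xi> j x\<bar> ^ 3 \<partial>P) + t ^ 4 / 8 * (\<integral>x. \<xi> j x ^ 4 \<partial>P)" for j
  define A where "A m = (\<integral>x. iexp (t * S m x) * complex_of_real (g m x) \<partial>P)" for m
  define pr where "pr m = measure P {x \<in> space P. V m x > 2}" for m
  have S[measurable]: "S m \<in> borel_measurable P" if "m \<le> N" for m
    unfolding S_def[abs_def] using that by (intro borel_measurable_sum) auto
  have V[measurable]: "V m \<in> borel_measurable P" if "m \<le> N" for m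
    unfolding V_def[abs_def] using that by (intro borel_measurable_sum) auto
  have g[measurable]: "g m \<in> borel_measurable P" if "m \<le> N" for m
    unfolding g_def[abs_def] using that by measurable
  have V0: "0 \<le> V m x" if "m \<le> N" "x \<in> space P" for m x
    unfolding V_def using that by (intro sum_nonneg s0) auto
  have g_bound: "\<bar>g m x\<bar> \<le> exp (t\<^sup>2)" for m x
    by (auto simp: g_def intro!: mult_left_mono[of _ 2 "t\<^sup>2 / 2", simplified])
  have g_nonneg: "0 \<le> g m x" for m x by (simp add: g_def)
  have int_A: "integrable P (\<lambda>x. iexp (t * S m x) * complex_of_real (g m x))" if m: "m \<le> N" for m
    by (rule PF.P.integrable_const_bound[where B="exp (t\<^sup>2)"])
       (use m g_bound in \<open>auto simp: norm_mult\<close>)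
  have main: "norm (A m - 1) \<le> exp (t\<^sup>2) * ((\<Sum>j=1..m. D j) + pr m)" if "m \<le> N" for m
    using that
  proof (induction m)
    case 0
    then show ?case by (simp add: A_def S_def g_def V_def pr_def PF.P.prob_space)
  next
    case (Suc m)
    define j where "j = Suc m"
    have j: "j \<in> {1..N}" and m: "m \<le> N" and jN: "j \<le> N" using Suc.prems by (auto simp: j_def)
    have Sj: "S j x = S m x + \<xi> j x" and Vj: "V j x = V m x + s j x" for x
      by (simp_all add: S_def V_def j_def)
    define \<Phi> where "\<Phi> x = iexp (t * S m x) * complex_of_real (g j x)" for x
    define R where "R x = iexp (t * S m x) * complex_of_real (if V j x > 2 then g m x else 0)" for x
    have \<Phi>m[measurable]: "\<Phi> \<in> borel_measurable P"
      unfolding \<Phi>_def using m jN by measurable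
    have Rm[measurable]: "R \<in> borel_measurable P"
      unfolding R_def using m jN by measurable
    have R_int: "integrable P R"
      by (rule PF.P.integrable_const_bound[where B="exp (t\<^sup>2)"])
         (use m g_bound in \<open>auto simp: norm_mult R_def\<close>)
    \<comment> \<open>The increment is a one-step Taylor error plus the loss R on the event that V passes 2 now.\<close>
    have eq: "iexp (t * S j x) * complex_of_real (g j x) - iexp (t * S m x) * complex_of_real (g m x)
        = \<Phi> x * (iexp (t * \<xi> j x) - exp (- (t\<^sup>2 * s j x / 2))) - R x" if x: "x \<in> space P" for x
    proof -
      have "iexp (t * S j x) * complex_of_real (g j x) = \<Phi> x * iexp (t * \<xi> j x)"
        by (simp add: \<Phi>_def Sj distrib_left exp_add)
      moreover have "complex_of_real (g m x)
          = complex_of_real (g j x) * exp (- (t\<^sup>2 * s j x / 2)) + complex_of_real (if V j x > 2 then g m x else 0)"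
      proof (cases "V j x \<le> 2")
        case True
        then have "V m x \<le> 2" using s0[OF j x] by (simp add: Vj)
        then have "g m x = g j x * exp (- (t\<^sup>2 * s j x / 2))"
          using True by (simp add: g_def Vj mult_exp_exp algebra_simps add_divide_distrib)
        then show ?thesis using True by (simp flip: exp_of_real)
      qed (simp add: g_def)
      ultimately show ?thesis unfolding \<Phi>_def R_def by (simp add: algebra_simps)
    qed
    have int_diff: "integrable P (\<lambda>x. \<Phi> x * (iexp (t * \<xi> j x) - exp (- (t\<^sup>2 * s j x / 2))))"
    proof -
      have "integrable P (\<lambda>x. (iexp (t * S j x) * complex_of_real (g j x)
          - iexp (t * S m x) * complex_of_real (g m x)) + R x)"
        using int_A[OF jN] int_A[OF m] R_int by (intro Bochner_Integration.integrable_add Bochner_Integration.integrable_diff)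
      then show ?thesis
        by (rule iffD1[OF Bochner_Integration.integrable_cong, rotated -1]) (simp_all only: eq diff_add_cancel)
    qed
    have "A j - A m = (\<integral>x. iexp (t * S j x) * complex_of_real (g j x)
        - iexp (t * S m x) * complex_of_real (g m x) \<partial>P)"
      unfolding A_def by (rule Bochner_Integration.integral_diff[symmetric, OF int_A[OF jN] int_A[OF m]])
    also have "\<dots> = (\<integral>x. \<Phi> x * (iexp (t * \<xi> j x) - exp (- (t\<^sup>2 * s j x / 2))) - R x \<partial>P)"
      by (rule Bochner_Integration.integral_cong) (simp_all only: eq)
    also have "\<dots> = (\<integral>x. \<Phi> x * (iexp (t * \<xi> j x) - exp (- (t\<^sup>2 * s j x / 2))) \<partial>P) - integral\<^sup>L P R"
      by (rule Bochner_Integration.integral_diff[OF int_diff R_int])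
    finally have AA: "A j - A m = \<dots>" .
    have 1: "norm (\<integral>x. \<Phi> x * (iexp (t * \<xi> j x) - exp (- (t\<^sup>2 * s j x / 2))) \<partial>P) \<le> exp (t\<^sup>2) * D j"
      unfolding D_def
    proof (rule martingale_step[OF j \<Phi>m])
      show "norm (\<Phi> x) \<le> exp (t\<^sup>2)" for x
        using g_bound by (simp add: \<Phi>_def norm_mult)
      fix x u assume x: "x \<in> space P" and u: "u \<in> space F"
      have "S m (x(j := u)) = S m x" unfolding S_def
        by (intro sum.cong refl adapted[OF x u _ j]) (use m in \<open>auto simp: j_def\<close>)
      moreover have "V j (x(j := u)) = V j x" unfolding V_def
        by (intro sum.cong refl s_free[OF x u _ j]) (use jN in \<open>auto\<close>)
      ultimately show "\<Phi> (x(j := u)) = \<Phi> x" by (simp add: \<Phi>_def g_def)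
    qed (use j \<xi> int4 int4' zero s s_free in auto)
    \<comment> \<open>The events V > 2 increase, so these losses telescope to a single probability.\<close>
    have 2: "norm (integral\<^sup>L P R) \<le> exp (t\<^sup>2) * (pr j - pr m)"
    proof -
      have "norm (R x) \<le> exp (t\<^sup>2) * (indicator {x \<in> space P. V j x > 2} x - indicator {x \<in> space P. V m x > 2} x)"
        if x: "x \<in> space P" for x
        using x s0[OF j x] g_bound[of m x] by (auto simp: R_def norm_mult Vj g_def split: split_indicator)
      then have "norm (integral\<^sup>L P R) \<le> (\<integral>x. exp (t\<^sup>2) * (indicator {x \<in> space P. V j x > 2} x - indicator {x \<in> space P. V m x > 2} x) \<partial>P)"
        using m jN by (intro order_trans[OF integral_norm_bound] integral_mono integrable_norm R_int
             integrable_mult_right Bochner_Integration.integrable_diff integrable_real_indicator)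
            (auto simp: PF.P.emeasure_eq_measure)
      also have "\<dots> = exp (t\<^sup>2) * (pr j - pr m)"
        using m jN unfolding pr_def
        by (subst integral_mult_right_zero, subst Bochner_Integration.integral_diff)
           (auto simp: PF.P.emeasure_eq_measure intro!: integrable_real_indicator)
      finally show ?thesis .
    qed
    have "norm (A j - 1) \<le> norm (A m - 1) + norm (A j - A m)"
      using norm_triangle_ineq[of "A m - 1" "A j - A m"] by simp
    also have "\<dots> \<le> exp (t\<^sup>2) * ((\<Sum>j=1..m. D j) + pr m) + (exp (t\<^sup>2) * D j + exp (t\<^sup>2) * (pr j - pr m))"
      unfolding AA by (rule add_mono[OF Suc.IH[OF m] order_trans[OF norm_triangle_ineq4 add_mono[OF 1 2]]])
    also have "\<dots> = exp (t\<^sup>2) * ((\<Sum>j=1..j. D j) + pr j)"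
      by (simp add: j_def algebra_simps)
    finally show ?case by (simp add: j_def)
  qed
  have \<xi>2: "integrable P (\<lambda>x. (\<xi> j x)\<^sup>2)" and \<xi>3: "integrable P (\<lambda>x. \<bar>\<xi> j x\<bar> ^ 3)" if j: "j \<in> {1..N}" for j
    using PF.P.integrable_lower_powers[OF \<xi>[OF j] int4[OF j]] by simp_all
  \<comment> \<open>The factor q balances the two terms: summed over j, each is at most q / 2.\<close>
  have third: "(\<integral>x. \<bar>\<xi> j x\<bar> ^ 3 \<partial>P) \<le> q / 2 * (\<integral>x. (\<xi> j x)\<^sup>2 \<partial>P) + (\<integral>x. \<xi> j x ^ 4 \<partial>P) / (2 * q)"
    if j: "j \<in> {1..N}" for j
  proof -
    have pw: "\<bar>y\<bar> ^ 3 \<le> q / 2 * y\<^sup>2 + y ^ 4 / (2 * q)" for y :: real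
    proof -
      have "0 \<le> y\<^sup>2 * (q - \<bar>y\<bar>)\<^sup>2" by simp
      also have "\<dots> = q\<^sup>2 * y\<^sup>2 - 2 * q * \<bar>y\<bar> ^ 3 + y ^ 4"
      proof -
        have "y\<^sup>2 = \<bar>y\<bar>\<^sup>2" "y ^ 4 = \<bar>y\<bar> ^ 4" by simp_all
        then show ?thesis by (simp only:) (simp add: algebra_simps power2_eq_square power3_eq_cube power4_eq_xxxx del: abs_mult_self_eq)
      qed
      finally show ?thesis using q(1) by (simp add: field_simps power2_eq_square)
    qed
    have "(\<integral>x. \<bar>\<xi> j x\<bar> ^ 3 \<partial>P) \<le> (\<integral>x. q / 2 * (\<xi> j x)\<^sup>2 + \<xi> j x ^ 4 / (2 * q) \<partial>P)"
      using pw \<xi>2[OF j] \<xi>3[OF j] int4[OF j] by (intro integral_mono) auto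
    then show ?thesis using \<xi>2[OF j] int4[OF j] by simp
  qed
  have "(\<Sum>j=1..N. \<integral>x. \<bar>\<xi> j x\<bar> ^ 3 \<partial>P)
      \<le> (\<Sum>j=1..N. q / 2 * (\<integral>x. (\<xi> j x)\<^sup>2 \<partial>P) + (\<integral>x. \<xi> j x ^ 4 \<partial>P) / (2 * q))"
    by (intro sum_mono third)
  also have "\<dots> = q / 2 + (\<Sum>j=1..N. \<integral>x. \<xi> j x ^ 4 \<partial>P) / (2 * q)"
    by (simp add: sum.distrib total flip: sum_distrib_left sum_divide_distrib)
  also have "\<dots> \<le> q / 2 + q\<^sup>2 / (2 * q)"
    using q by (intro add_left_mono divide_right_mono) auto
  also have "\<dots> = q" using q by (simp add: power2_eq_square)
  finally have third_sum: "(\<Sum>j=1..N. \<integral>x. \<bar>\<xi> j x\<bar> ^ 3 \<partial>P) \<le> q" .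
  have D: "(\<Sum>j=1..N. D j) \<le> \<bar>t\<bar> ^ 3 * q / 6 + t ^ 4 * q\<^sup>2 / 8"
  proof -
    have "(\<Sum>j=1..N. D j) = \<bar>t\<bar> ^ 3 / 6 * (\<Sum>j=1..N. \<integral>x. \<bar>\<xi> j x\<bar> ^ 3 \<partial>P) + t ^ 4 / 8 * (\<Sum>j=1..N. \<integral>x. \<xi> j x ^ 4 \<partial>P)"
      by (simp add: D_def sum.distrib sum_distrib_left)
    also have "\<dots> \<le> \<bar>t\<bar> ^ 3 / 6 * q + t ^ 4 / 8 * q\<^sup>2"
      using third_sum q by (intro add_mono mult_left_mono) auto
    finally show ?thesis by simp
  qed
  define W where "W x = (V N x - 1)\<^sup>2" for x
  have W: "integrable P W" "integral\<^sup>L P W \<le> r\<^sup>2" using r by (simp_all add: W_def[abs_def] V_def)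
  have pr: "pr N \<le> r\<^sup>2"
  proof -
    have "pr N = (\<integral>x. indicator {x \<in> space P. V N x > 2} x \<partial>P)"
      unfolding pr_def by simp
    also have "\<dots> \<le> integral\<^sup>L P W"
    proof (intro integral_mono W integrable_real_indicator)
      fix x
      have "1 \<le> W x" if "V N x > 2" using that power_mono[of 1 "V N x - 1" 2] by (simp add: W_def)
      then show "indicator {x \<in> space P. V N x > 2} x \<le> W x"
        by (auto simp: W_def split: split_indicator)
    qed (auto simp: PF.P.emeasure_eq_measure)
    finally show ?thesis using W by simp
  qed
  have last: "norm (exp (t\<^sup>2 / 2) * (\<integral>x. iexp (t * S N x) \<partial>P) - A N) \<le> exp (t\<^sup>2) * (r\<^sup>2 + t\<^sup>2 * r / 2)"
  proof -
    let ?Z = "\<lambda>x. complex_of_real (exp (t\<^sup>2 / 2)) * iexp (t * S N x) - iexp (t * S N x) * complex_of_real (g N x)"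
    have i1: "integrable P (\<lambda>x. iexp (t * S N x))"
      by (rule PF.P.integrable_const_bound[where B=1]) auto
    have "exp (t\<^sup>2 / 2) * (\<integral>x. iexp (t * S N x) \<partial>P) - A N
        = (\<integral>x. ?Z x \<partial>P)"
      unfolding A_def using i1 int_A[of N] by simp
    also have "norm \<dots> \<le> (\<integral>x. norm (?Z x) \<partial>P)"
      by (rule integral_norm_bound)
    also have "\<dots> \<le> (\<integral>x. exp (t\<^sup>2) * (W x + t\<^sup>2 / 2 * (W x / (2 * r) + r / 2)) \<partial>P)"
    proof (rule integral_mono)
      show "integrable P (\<lambda>x. exp (t\<^sup>2) * (W x + t\<^sup>2 / 2 * (W x / (2 * r) + r / 2)))" using W by auto
      show "integrable P (\<lambda>x. norm (?Z x))"
        using i1 int_A[of N] by (intro integrable_norm Bochner_Integration.integrable_diff integrable_mult_right) auto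
      fix x assume x: "x \<in> space P"
      have "norm (?Z x)
          = norm (iexp (t * S N x) * complex_of_real (exp (t\<^sup>2 / 2) - g N x))"
        by (simp add: algebra_simps)
      also have "\<dots> = \<bar>exp (t\<^sup>2 / 2) - g N x\<bar>" by (simp add: norm_mult del: of_real_diff)
      also have "\<dots> \<le> exp (t\<^sup>2) * (W x + t\<^sup>2 / 2 * \<bar>V N x - 1\<bar>)"
      proof (cases "V N x \<le> 2")
        case True
        have lip: "\<bar>exp a - exp b\<bar> \<le> exp c * \<bar>a - b\<bar>" if "a \<le> c" "b \<le> c" for a b c :: real
        proof -
          have *: "exp a - exp b \<le> exp c * (a - b)" if "b \<le> a" "a \<le> c" for a b :: real
          proof -
            have "exp a - exp b = exp a * (1 - exp (b - a))" by (simp add: algebra_simps mult_exp_exp)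
            also have "\<dots> \<le> exp a * (a - b)"
              using exp_ge_add_one_self[of "b - a"] by (intro mult_left_mono) (linarith, simp)
            also have "\<dots> \<le> exp c * (a - b)" using that by (intro mult_right_mono) auto
            finally show ?thesis .
          qed
          show ?thesis using *[of b a] *[of a b] that by (cases "b \<le> a") (auto simp: abs_real_def)
        qed
        have "\<bar>exp (t\<^sup>2 / 2) - g N x\<bar> \<le> exp (t\<^sup>2) * \<bar>t\<^sup>2 / 2 - t\<^sup>2 / 2 * V N x\<bar>"
          using True mult_left_mono[of "V N x" 2 "t\<^sup>2 / 2"] by (simp add: g_def) (intro lip, auto)
        also have "\<dots> = exp (t\<^sup>2) * (t\<^sup>2 / 2 * \<bar>V N x - 1\<bar>)"
        proof -
          have "t\<^sup>2 / 2 - t\<^sup>2 / 2 * V N x = - (t\<^sup>2 / 2 * (V N x - 1))" by (simp add: field_simps)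
          then show ?thesis by (simp only: abs_minus_cancel abs_mult) simp
        qed
        also have "\<dots> \<le> exp (t\<^sup>2) * (W x + t\<^sup>2 / 2 * \<bar>V N x - 1\<bar>)"
          by (intro mult_left_mono) (auto simp: W_def)
        finally show ?thesis .
      next
        case False
        then have "1 \<le> W x" using power_mono[of 1 "V N x - 1" 2] by (simp add: W_def)
        have "\<bar>exp (t\<^sup>2 / 2) - g N x\<bar> = exp (t\<^sup>2 / 2)" using False by (simp add: g_def)
        also have "\<dots> \<le> exp (t\<^sup>2) * 1" by simp
        also have "\<dots> \<le> exp (t\<^sup>2) * (W x + t\<^sup>2 / 2 * \<bar>V N x - 1\<bar>)"
          using \<open>1 \<le> W x\<close> by (intro mult_left_mono add_increasing2) auto
        finally show ?thesis .
      qed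
      also have "\<dots> \<le> exp (t\<^sup>2) * (W x + t\<^sup>2 / 2 * (W x / (2 * r) + r / 2))"
      proof -
        have "0 \<le> (\<bar>V N x - 1\<bar> - r)\<^sup>2" by simp
        also have "\<dots> = W x - 2 * r * \<bar>V N x - 1\<bar> + r\<^sup>2"
          unfolding W_def by (subst power2_abs[of "V N x - 1", symmetric]) (simp only: power2_diff, simp)
        finally have "\<bar>V N x - 1\<bar> \<le> W x / (2 * r) + r / 2"
          using r(1) by (simp add: field_simps power2_eq_square)
        then show ?thesis by (intro mult_left_mono add_left_mono) auto
      qed
      finally show "norm (?Z x)
        \<le> exp (t\<^sup>2) * (W x + t\<^sup>2 / 2 * (W x / (2 * r) + r / 2))" .
    qed
    also have "\<dots> = exp (t\<^sup>2) * (integral\<^sup>L P W + t\<^sup>2 / 2 * (integral\<^sup>L P W / (2 * r) + r / 2))"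
      using W(1) by (simp add: PF.P.prob_space)
    also have "\<dots> \<le> exp (t\<^sup>2) * (r\<^sup>2 + t\<^sup>2 / 2 * (r\<^sup>2 / (2 * r) + r / 2))"
      using W(2) r(1) by (intro mult_left_mono add_mono divide_right_mono order_refl) auto
    also have "\<dots> = exp (t\<^sup>2) * (r\<^sup>2 + t\<^sup>2 * r / 2)"
      using r(1) by (simp add: power2_eq_square)
    finally show ?thesis .
  qed
  let ?\<phi> = "\<integral>x. iexp (t * S N x) \<partial>P"
  have "norm (exp (t\<^sup>2 / 2) * ?\<phi> - 1) \<le> norm (exp (t\<^sup>2 / 2) * ?\<phi> - A N) + norm (A N - 1)"
    using norm_triangle_ineq[of "exp (t\<^sup>2 / 2) * ?\<phi> - A N" "A N - 1"] by simp
  also have "\<dots> \<le> exp (t\<^sup>2) * (r\<^sup>2 + t\<^sup>2 * r / 2) + exp (t\<^sup>2) * ((\<Sum>j=1..N. D j) + pr N)"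
    using last main[of N] by (intro add_mono) auto
  also have "\<dots> \<le> exp (t\<^sup>2) * (r\<^sup>2 + t\<^sup>2 * r / 2) + exp (t\<^sup>2) * ((\<bar>t\<bar> ^ 3 * q / 6 + t ^ 4 * q\<^sup>2 / 8) + r\<^sup>2)"
    using D pr by (intro add_left_mono mult_left_mono add_mono) auto
  finally have fin: "norm (exp (t\<^sup>2 / 2) * ?\<phi> - 1)
      \<le> exp (t\<^sup>2) * (\<bar>t\<bar> ^ 3 * q / 6 + t ^ 4 * q\<^sup>2 / 8 + 2 * r\<^sup>2 + t\<^sup>2 * r / 2)"
    by (simp add: algebra_simps)
  have "?\<phi> - exp (- (t\<^sup>2 / 2)) = complex_of_real (exp (- (t\<^sup>2 / 2))) * (exp (t\<^sup>2 / 2) * ?\<phi> - 1)"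
    by (simp add: right_diff_distrib mult.assoc[symmetric] flip: of_real_mult exp_add)
  then have "norm (?\<phi> - exp (- (t\<^sup>2 / 2))) = exp (- (t\<^sup>2 / 2)) * norm (exp (t\<^sup>2 / 2) * ?\<phi> - 1)"
    by (simp add: norm_mult)
  also have "\<dots> \<le> 1 * norm (exp (t\<^sup>2 / 2) * ?\<phi> - 1)" by (intro mult_right_mono) auto
  finally show ?thesis using fin by (simp add: S_def clt_error_def)
qed

end

section \<open>Centered kernels\<close>

lemma (in prob_space) expectation_square_sum_orthogonal:
  fixes f :: "'e \<Rightarrow> 'a \<Rightarrow> real"
  assumes fin: "finite T"
    and int: "\<And>e e'. e \<in> T \<Longrightarrow> e' \<in> T \<Longrightarrow> integrable M (\<lambda>x. f e x * f e' x)"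
    and orth: "\<And>e e'. e \<in> T \<Longrightarrow> e' \<in> T \<Longrightarrow> e \<noteq> e' \<Longrightarrow> expectation (\<lambda>x. f e x * f e' x) = 0"
  shows "expectation (\<lambda>x. (\<Sum>e\<in>T. f e x)\<^sup>2) = (\<Sum>e\<in>T. expectation (\<lambda>x. (f e x)\<^sup>2))"
proof -
  have "expectation (\<lambda>x. (\<Sum>e\<in>T. f e x)\<^sup>2) = expectation (\<lambda>x. \<Sum>e\<in>T. \<Sum>e'\<in>T. f e x * f e' x)"
    by (simp add: power2_eq_square sum_product)
  also have "\<dots> = (\<Sum>e\<in>T. \<Sum>e'\<in>T. expectation (\<lambda>x. f e x * f e' x))"
    using int by (simp add: Bochner_Integration.integral_sum)
  also have "\<dots> = (\<Sum>e\<in>T. \<Sum>e'\<in>T. if e' = e then expectation (\<lambda>x. (f e x)\<^sup>2) else 0)"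
    using orth by (intro sum.cong refl) (auto simp: power2_eq_square)
  also have "\<dots> = (\<Sum>e\<in>T. expectation (\<lambda>x. (f e x)\<^sup>2))"
    using fin by simp
  finally show ?thesis .
qed

lemma square_sum_le: "(x + y)\<^sup>2 \<le> 2 * (x\<^sup>2 + y\<^sup>2)" for x y :: real
  using zero_le_power2[of "x - y"] by (simp add: power2_eq_square algebra_simps)

lemma sum_fourth_power_le: "(x + y) ^ 4 \<le> 8 * (x ^ 4 + y ^ 4)" for x y :: real
proof -
  have 1: "(x + y)\<^sup>2 \<le> 2 * (x\<^sup>2 + y\<^sup>2)" by (rule square_sum_le)
  have 2: "(x\<^sup>2 + y\<^sup>2)\<^sup>2 \<le> 2 * ((x\<^sup>2)\<^sup>2 + (y\<^sup>2)\<^sup>2)" by (rule square_sum_le)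
  have "((x + y)\<^sup>2)\<^sup>2 \<le> (2 * (x\<^sup>2 + y\<^sup>2))\<^sup>2" using 1 by (rule power_mono) simp
  also have "\<dots> = 4 * (x\<^sup>2 + y\<^sup>2)\<^sup>2" unfolding power_mult_distrib by simp
  finally show ?thesis using 2 by (simp flip: power_mult)
qed

lemma (in prob_space) integrable_fourth_power_add:
  fixes f g :: "'a \<Rightarrow> real"
  assumes [measurable]: "f \<in> borel_measurable M" "g \<in> borel_measurable M"
    and "integrable M (\<lambda>x. f x ^ 4)" "integrable M (\<lambda>x. g x ^ 4)"
  shows "integrable M (\<lambda>x. (f x + g x) ^ 4)"
proof (rule Bochner_Integration.integrable_bound)
  show "integrable M (\<lambda>x. 8 * (f x ^ 4 + g x ^ 4))" using assms by auto
  show "AE x in M. norm ((f x + g x) ^ 4) \<le> norm (8 * (f x ^ 4 + g x ^ 4))"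
    using sum_fourth_power_le by (intro AE_I2) (simp add: abs_of_nonneg)
qed measurable

text \<open>
  The kernel is dominated by a sum of functions of one variable with four moments. This makes every
  integral below converge for all values of the other variables, not just for almost all of
  them. As b is at least 1, a sum of two of its values is at most twice their product.
\<close>

locale centered_kernel = iid_coordinates F N for F :: "'b measure" and N +
  fixes h :: "'b \<Rightarrow> 'b \<Rightarrow> real" and b :: "'b \<Rightarrow> real"
  assumes h_borel: "(\<lambda>(u, v). h u v) \<in> borel_measurable (F \<Otimes>\<^sub>M F)"
    and h_sym: "h u v = h v u"
    and h_bound: "u \<in> space F \<Longrightarrow> v \<in> space F \<Longrightarrow> \<bar>h u v\<bar> \<le> b u + b v"
    and h_centered: "u \<in> space F \<Longrightarrow> (\<integral>v. h u v \<partial>F) = 0"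
    and b_borel[measurable]: "b \<in> borel_measurable F"
    and b_ge_1: "u \<in> space F \<Longrightarrow> 1 \<le> b u"
    and b_int4: "integrable F (\<lambda>u. b u ^ 4)"
begin

lemma h_measurable[measurable (raw)]:
  "f \<in> measurable M F \<Longrightarrow> g \<in> measurable M F \<Longrightarrow> (\<lambda>x. h (f x) (g x)) \<in> borel_measurable M"
  using measurable_compose[OF measurable_Pair h_borel, of f M g] by simp

text \<open>
  The kernel of the square of the integral operator with kernel h.
\<close>

definition G :: "'b \<Rightarrow> 'b \<Rightarrow> real" where
  "G u v = (\<integral>z. h u z * h v z \<partial>F)"

lemma G_borel: "(\<lambda>(u, v). G u v) \<in> borel_measurable (F \<Otimes>\<^sub>M F)"
  unfolding G_def case_prod_beta by measurable

lemma G_measurable[measurable (raw)]: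
  "f \<in> measurable M F \<Longrightarrow> g \<in> measurable M F \<Longrightarrow> (\<lambda>x. G (f x) (g x)) \<in> borel_measurable M"
  using measurable_compose[OF measurable_Pair G_borel, of f M g] by simp

lemma G_sym: "G u v = G v u"
  by (simp add: G_def mult.commute)

lemma h_le_mult:
  assumes "u \<in> space F" "v \<in> space F"
  shows "\<bar>h u v\<bar> \<le> 2 * (b u * b v)"
proof -
  have "b u \<le> b u * b v" "b v \<le> b u * b v"
    using mult_left_mono[of 1 "b v" "b u"] mult_right_mono[of 1 "b u" "b v"] b_ge_1[OF assms(1)] b_ge_1[OF assms(2)] by auto
  then show ?thesis using h_bound[OF assms] by simp
qed

lemma b_int2: "integrable F (\<lambda>z. (b z)\<^sup>2)"
  using F.integrable_lower_powers(2)[OF b_borel b_int4, of 2] by simp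

lemma h_int4:
  assumes "u \<in> space F"
  shows "integrable F (\<lambda>v. h u v ^ 4)"
proof (rule Bochner_Integration.integrable_bound)
  show "integrable F (\<lambda>v. (2 * b u) ^ 4 * b v ^ 4)" using b_int4 by auto
  show "AE v in F. norm (h u v ^ 4) \<le> norm ((2 * b u) ^ 4 * b v ^ 4)"
  proof (rule AE_I2)
    fix v assume "v \<in> space F"
    then have "\<bar>h u v\<bar> ^ 4 \<le> (2 * b u * b v) ^ 4"
      using h_le_mult[OF assms] by (intro power_mono) (auto simp: mult.assoc)
    then show "norm (h u v ^ 4) \<le> norm ((2 * b u) ^ 4 * b v ^ 4)"
      by (simp add: power_mult_distrib)
  qed
qed (use assms in measurable)

lemma h_int2: "u \<in> space F \<Longrightarrow> integrable F (\<lambda>v. (h u v)\<^sup>2)"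
  and h_int1: "u \<in> space F \<Longrightarrow> integrable F (h u)"
  using F.integrable_lower_powers(2)[OF _ h_int4, of u 2] F.integrable_lower_powers(2)[OF _ h_int4, of u 1]
  by auto

lemma h_h_int:
  assumes u: "u \<in> space F" "v \<in> space F"
  shows "integrable F (\<lambda>z. h u z * h v z)"
proof (rule Bochner_Integration.integrable_bound)
  show "integrable F (\<lambda>z. (h u z)\<^sup>2 + (h v z)\<^sup>2)" using h_int2 u by auto
  have "\<bar>x * y\<bar> \<le> x\<^sup>2 + y\<^sup>2" for x y :: real
  proof -
    have "0 \<le> \<bar>x\<bar> * \<bar>y\<bar>" by simp
    then have "\<bar>x\<bar> * \<bar>y\<bar> \<le> x\<^sup>2 + y\<^sup>2"
      using sum_squares_bound[of "\<bar>x\<bar>" "\<bar>y\<bar>"] unfolding power2_abs by linarith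
    then show ?thesis by (simp add: abs_mult)
  qed
  then show "AE z in F. norm (h u z * h v z) \<le> norm ((h u z)\<^sup>2 + (h v z)\<^sup>2)"
    by (intro AE_I2) simp
qed (use u in measurable)

lemma G_bound:
  assumes u: "u \<in> space F" "v \<in> space F"
  shows "\<bar>G u v\<bar> \<le> 4 * (\<integral>z. (b z)\<^sup>2 \<partial>F) * (b u * b v)"
proof -
  have "\<bar>G u v\<bar> \<le> (\<integral>z. \<bar>h u z * h v z\<bar> \<partial>F)"
    unfolding G_def by (rule integral_abs_bound)
  also have "\<dots> \<le> (\<integral>z. 4 * (b u * b v) * (b z)\<^sup>2 \<partial>F)"
  proof (rule integral_mono)
    fix z assume z: "z \<in> space F"
    have "\<bar>h u z\<bar> * \<bar>h v z\<bar> \<le> (2 * (b u * b z)) * (2 * (b v * b z))"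
      using h_le_mult[OF u(1) z] h_le_mult[OF u(2) z] b_ge_1[OF u(1)] b_ge_1[OF z]
      by (intro mult_mono) auto
    then show "\<bar>h u z * h v z\<bar> \<le> 4 * (b u * b v) * (b z)\<^sup>2"
      by (simp add: abs_mult power2_eq_square mult_ac)
  qed (use h_h_int[OF u] b_int2 in auto)
  finally show ?thesis by (simp add: mult_ac)
qed

text \<open>
  By Fubini the integral over v can be carried out first, on the factor h v z.
\<close>

lemma G_centered:
  assumes u: "u \<in> space F"
  shows "(\<integral>v. G u v \<partial>F) = 0"
proof -
  interpret FF: pair_prob_space F F ..
  have b1: "integrable F b" using F.integrable_lower_powers(2)[OF b_borel b_int4, of 1] by simp
  have int: "integrable (F \<Otimes>\<^sub>M F) (\<lambda>(v, z). h u z * h v z)"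
  proof (rule Bochner_Integration.integrable_bound)
    show "integrable (F \<Otimes>\<^sub>M F) (\<lambda>(v, z). (4 * b u * b v) * (b z)\<^sup>2)"
    proof (rule FF.Fubini_integrable)
      have "integrable F (\<lambda>v. 4 * \<bar>b u\<bar> * \<bar>b v\<bar> * (\<integral>z. (b z)\<^sup>2 \<partial>F))" using b1 by auto
      then show "integrable F (\<lambda>v. \<integral>z. norm (case (v, z) of (v, z) \<Rightarrow> (4 * b u * b v) * (b z)\<^sup>2) \<partial>F)"
        by (simp add: abs_mult)
    qed (use b_int2 in auto)
  next
    show "AE x in F \<Otimes>\<^sub>M F. norm (case x of (v, z) \<Rightarrow> h u z * h v z) \<le> norm (case x of (v, z) \<Rightarrow> 4 * b u * b v * (b z)\<^sup>2)"
    proof (rule AE_I2, clarify)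
      fix v z assume "(v, z) \<in> space (F \<Otimes>\<^sub>M F)"
      then have vz: "v \<in> space F" "z \<in> space F" by (auto simp: space_pair_measure)
      have "\<bar>h u z\<bar> * \<bar>h v z\<bar> \<le> (2 * (b u * b z)) * (2 * (b v * b z))"
        using h_le_mult[OF u vz(2)] h_le_mult[OF vz] b_ge_1[OF u] b_ge_1[OF vz(2)]
        by (intro mult_mono) auto
      also have "\<dots> = 4 * b u * b v * (b z)\<^sup>2" by (simp add: power2_eq_square)
      finally show "norm (h u z * h v z) \<le> norm (4 * b u * b v * (b z)\<^sup>2)"
        using b_ge_1[OF u] b_ge_1[OF vz(1)] by (simp add: abs_mult)
    qed
  qed (use u in measurable)
  have "(\<integral>v. G u v \<partial>F) = (\<integral>z. (\<integral>v. h u z * h v z \<partial>F) \<partial>F)"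
    unfolding G_def using FF.Fubini_integral[OF int] by simp
  also have "\<dots> = 0"
  proof -
    have "(\<integral>v. h u z * h v z \<partial>F) = 0" if "z \<in> space F" for z
      using h_centered[OF that] h_sym[of z] by simp
    then have "(\<integral>z. (\<integral>v. h u z * h v z \<partial>F) \<partial>F) = (\<integral>z. 0 \<partial>F)"
      by (intro Bochner_Integration.integral_cong refl)
    then show ?thesis by simp
  qed
  finally show ?thesis .
qed

text \<open>
  The envelope dominates each b (x i), and a function is tame of degree k if it is at most a multiple of
  the k-th power of the envelope. The envelope has four moments, so tame functions of degree at most
  4 are integrable, also in each single variable. A polynomial in values of h is tame of its
  degree, and G counts as degree 2.
\<close>

definition envelope :: "(nat \<Rightarrow> 'b) \<Rightarrow> real" where
  "envelope x = 1 + (\<Sum>i=1..N. b (x i))"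

definition tame :: "nat \<Rightarrow> ((nat \<Rightarrow> 'b) \<Rightarrow> real) \<Rightarrow> bool" where
  "tame k f \<longleftrightarrow> f \<in> borel_measurable P \<and> (\<exists>C. \<forall>x\<in>space P. \<bar>f x\<bar> \<le> C * envelope x ^ k)"

lemma coord_in_space: "x \<in> space P \<Longrightarrow> i \<in> {1..N} \<Longrightarrow> x i \<in> space F"
  by (auto simp: space_PiM)

lemma b_le_envelope: "x \<in> space P \<Longrightarrow> i \<in> {1..N} \<Longrightarrow> b (x i) \<le> envelope x"
  and envelope_ge_1: "x \<in> space P \<Longrightarrow> 1 \<le> envelope x"
proof -
  assume x: "x \<in> space P"
  then have *: "0 \<le> b (x j)" if "j \<in> {1..N}" for j
    using b_ge_1[OF coord_in_space[OF x that]] by simp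
  show "1 \<le> envelope x" unfolding envelope_def using * sum_nonneg[of "{1..N}" "\<lambda>i. b (x i)"] by simp
  show "b (x i) \<le> envelope x" if i: "i \<in> {1..N}"
    using member_le_sum[of i "{1..N}" "\<lambda>i. b (x i)"] * i by (auto simp: envelope_def)
qed

lemma envelope_borel[measurable]: "envelope \<in> borel_measurable P"
  unfolding envelope_def[abs_def] by measurable

lemma envelope_int4: "integrable P (\<lambda>x. envelope x ^ 4)"
proof -
  have "integrable P (\<lambda>x. (1 + (\<Sum>i\<in>J. b (x i))) ^ 4)" if "finite J" "J \<subseteq> {1..N}" for J
    using that
  proof (induction J)
    case (insert j J)
    have [measurable]: "(\<lambda>x. \<Sum>i\<in>J. b (x i)) \<in> borel_measurable P" "(\<lambda>x. b (x j)) \<in> borel_measurable P"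
      using insert.prems by (auto intro!: borel_measurable_sum)
    have "integrable P (\<lambda>x. b (x j) ^ 4)"
      using integrable_coord[of j "\<lambda>u. b u ^ 4"] b_int4 insert.prems by simp
    then have "integrable P (\<lambda>x. ((1 + (\<Sum>i\<in>J. b (x i))) + b (x j)) ^ 4)"
      using insert by (intro PF.P.integrable_fourth_power_add[of "\<lambda>x. 1 + (\<Sum>i\<in>J. b (x i))" "\<lambda>x. b (x j)"]) auto
    then show ?case using insert by (simp add: add_ac)
  qed simp
  from this[of "{1..N}"] show ?thesis by (simp add: envelope_def)
qed

lemma tame_borel: "tame k f \<Longrightarrow> f \<in> borel_measurable P"
  by (simp add: tame_def)

lemma tame_integrable:
  assumes f: "tame k f" and k: "k \<le> 4"
  shows "integrable P f"
proof -
  obtain C where C: "\<And>x. x \<in> space P \<Longrightarrow> \<bar>f x\<bar> \<le> C * envelope x ^ k" using f by (auto simp: tame_def)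
  show ?thesis
  proof (rule Bochner_Integration.integrable_bound)
    show "integrable P (\<lambda>x. C * \<bar>envelope x\<bar> ^ k)"
      using PF.P.integrable_lower_powers(1)[OF envelope_borel envelope_int4 k] by simp
    show "AE x in P. norm (f x) \<le> norm (C * \<bar>envelope x\<bar> ^ k)"
    proof (rule AE_I2)
      fix x assume x: "x \<in> space P"
      have "\<bar>f x\<bar> \<le> C * envelope x ^ k" by (rule C[OF x])
      also have "\<dots> \<le> \<bar>C * envelope x ^ k\<bar>" by simp
      finally show "norm (f x) \<le> norm (C * \<bar>envelope x\<bar> ^ k)" by (simp add: abs_mult power_abs)
    qed
  qed (rule tame_borel[OF f])
qed

lemma tame_integrable_upd:
  assumes f: "tame k f" and k: "k \<le> 4" and x: "x \<in> space P" and j: "j \<in> {1..N}"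
  shows "integrable F (\<lambda>u. f (x(j := u)))"
proof -
  obtain C where C: "\<And>x. x \<in> space P \<Longrightarrow> \<bar>f x\<bar> \<le> C * envelope x ^ k" using f by (auto simp: tame_def)
  have Bu: "envelope (x(j := u)) \<le> envelope x + b u" if "u \<in> space F" for u
  proof -
    have "(\<Sum>i=1..N. b ((x(j := u)) i)) = b u + (\<Sum>i\<in>{1..N} - {j}. b (x i))"
      using j by (subst sum.remove[of _ j]) (auto intro!: sum.cong)
    also have "\<dots> \<le> b u + (\<Sum>i=1..N. b (x i))"
      using b_ge_1[OF coord_in_space[OF x]] by (intro add_left_mono sum_mono2) (auto intro: order_trans[of 0 1])
    finally show ?thesis by (simp add: envelope_def)
  qed
  show ?thesis
  proof (rule Bochner_Integration.integrable_bound)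
    have "integrable F (\<lambda>u. (envelope x + b u) ^ 4)"
      by (intro F.integrable_fourth_power_add b_int4) auto
    then show "integrable F (\<lambda>u. C * \<bar>envelope x + b u\<bar> ^ k)"
      using F.integrable_lower_powers(1)[OF _ _ k, of "\<lambda>u. envelope x + b u"] by simp
    show "AE u in F. norm (f (x(j := u))) \<le> norm (C * \<bar>envelope x + b u\<bar> ^ k)"
    proof (rule AE_I2)
      fix u assume u: "u \<in> space F"
      note xu = fun_upd_in_space[OF x u j]
      have "\<bar>f (x(j := u))\<bar> \<le> C * envelope (x(j := u)) ^ k" by (rule C[OF xu])
      also have "\<dots> \<le> \<bar>C\<bar> * envelope (x(j := u)) ^ k"
        using envelope_ge_1[OF xu] by (intro mult_right_mono) auto
      also have "\<dots> \<le> \<bar>C\<bar> * (envelope x + b u) ^ k"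
        using Bu[OF u] envelope_ge_1[OF xu] by (intro mult_left_mono power_mono) auto
      finally show "norm (f (x(j := u))) \<le> norm (C * \<bar>envelope x + b u\<bar> ^ k)"
        using envelope_ge_1[OF x] b_ge_1[OF u] by (simp add: abs_mult power_abs)
    qed
    show "(\<lambda>u. f (x(j := u))) \<in> borel_measurable F"
      using tame_borel[OF f] measurable_upd_const[OF x j] by (rule measurable_compose[rotated])
  qed
qed

lemma tame_mono:
  assumes f: "tame k f" and kl: "k \<le> l"
  shows "tame l f"
proof -
  obtain C where C: "\<And>x. x \<in> space P \<Longrightarrow> \<bar>f x\<bar> \<le> C * envelope x ^ k" using f by (auto simp: tame_def)
  have "\<bar>f x\<bar> \<le> \<bar>C\<bar> * envelope x ^ l" if x: "x \<in> space P" for x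
  proof -
    have "\<bar>f x\<bar> \<le> C * envelope x ^ k" by (rule C[OF x])
    also have "\<dots> \<le> \<bar>C\<bar> * envelope x ^ l"
      using envelope_ge_1[OF x] by (intro mult_mono power_increasing kl) auto
    finally show ?thesis .
  qed
  then show ?thesis using f unfolding tame_def by blast
qed

lemma tame_mult:
  assumes f: "tame k f" and g: "tame l g"
  shows "tame (k + l) (\<lambda>x. f x * g x)"
proof -
  obtain C where C: "\<And>x. x \<in> space P \<Longrightarrow> \<bar>f x\<bar> \<le> C * envelope x ^ k" using f by (auto simp: tame_def)
  obtain C' where C': "\<And>x. x \<in> space P \<Longrightarrow> \<bar>g x\<bar> \<le> C' * envelope x ^ l" using g by (auto simp: tame_def)
  have "\<bar>f x * g x\<bar> \<le> (C * C') * envelope x ^ (k + l)" if x: "x \<in> space P" for x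
  proof -
    have "\<bar>f x\<bar> * \<bar>g x\<bar> \<le> (C * envelope x ^ k) * (C' * envelope x ^ l)"
      using C[OF x] C'[OF x] order_trans[OF abs_ge_zero C[OF x]] by (intro mult_mono) auto
    then show ?thesis by (simp add: abs_mult power_add mult_ac)
  qed
  then show ?thesis using f g unfolding tame_def by (auto intro!: borel_measurable_times)
qed

lemma tame_const: "tame 0 (\<lambda>_. c)"
  by (auto simp: tame_def)

lemma tame_cmult: "tame k f \<Longrightarrow> tame k (\<lambda>x. c * f x)"
  using tame_mult[OF tame_const, of k f c] by simp

lemma tame_power: "tame k f \<Longrightarrow> tame (m * k) (\<lambda>x. f x ^ m)"
proof (induction m)
  case 0
  show ?case using tame_const[of 1] by simp
next
  case (Suc m)
  then show ?case using tame_mult[of k f "m * k" "\<lambda>x. f x ^ m"] by simp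
qed

lemma tame_add:
  assumes f: "tame k f" and g: "tame k g"
  shows "tame k (\<lambda>x. f x + g x)"
proof -
  obtain C where C: "\<And>x. x \<in> space P \<Longrightarrow> \<bar>f x\<bar> \<le> C * envelope x ^ k" using f by (auto simp: tame_def)
  obtain C' where C': "\<And>x. x \<in> space P \<Longrightarrow> \<bar>g x\<bar> \<le> C' * envelope x ^ k" using g by (auto simp: tame_def)
  have "\<bar>f x + g x\<bar> \<le> (C + C') * envelope x ^ k" if x: "x \<in> space P" for x
    using C[OF x] C'[OF x] by (simp add: distrib_right)
  then show ?thesis using f g unfolding tame_def by (auto intro!: borel_measurable_add)
qed

lemma tame_sum:
  assumes "\<And>i. i \<in> J \<Longrightarrow> tame k (f i)"
  shows "tame k (\<lambda>x. \<Sum>i\<in>J. f i x)"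
proof (cases "finite J")
  case True
  then show ?thesis using assms
  proof (induction J)
    case empty
    show ?case using tame_mono[OF tame_const[of 0], of k] by simp
  next
    case (insert j J)
    then show ?case using tame_add[of k "f j"] by simp
  qed
next
  case False
  then show ?thesis using tame_mono[OF tame_const[of 0], of k] by simp
qed

lemma tame_h:
  assumes ij: "i \<in> {1..N}" "j \<in> {1..N}"
  shows "tame 1 (\<lambda>x. h (x i) (x j))"
proof -
  have "\<bar>h (x i) (x j)\<bar> \<le> 2 * envelope x ^ 1" if x: "x \<in> space P" for x
    using h_bound[OF coord_in_space[OF x ij(1)] coord_in_space[OF x ij(2)]] b_le_envelope[OF x ij(1)] b_le_envelope[OF x ij(2)]
    by simp
  moreover have "(\<lambda>x. h (x i) (x j)) \<in> borel_measurable P" using ij by measurable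
  ultimately show ?thesis unfolding tame_def by blast
qed

lemma tame_G:
  assumes ij: "i \<in> {1..N}" "j \<in> {1..N}"
  shows "tame 2 (\<lambda>x. G (x i) (x j))"
proof -
  let ?c = "4 * (\<integral>z. (b z)\<^sup>2 \<partial>F)"
  have "\<bar>G (x i) (x j)\<bar> \<le> ?c * envelope x ^ 2" if x: "x \<in> space P" for x
  proof -
    have "\<bar>G (x i) (x j)\<bar> \<le> ?c * (b (x i) * b (x j))"
      by (rule G_bound[OF coord_in_space[OF x ij(1)] coord_in_space[OF x ij(2)]])
    also have "\<dots> \<le> ?c * (envelope x * envelope x)"
      using b_le_envelope[OF x ij(1)] b_le_envelope[OF x ij(2)] b_ge_1[OF coord_in_space[OF x ij(1)]]
        b_ge_1[OF coord_in_space[OF x ij(2)]] envelope_ge_1[OF x]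
      by (intro mult_left_mono mult_mono) auto
    finally show ?thesis by (simp add: power2_eq_square)
  qed
  moreover have "(\<lambda>x. G (x i) (x j)) \<in> borel_measurable P" using ij by measurable
  ultimately show ?thesis unfolding tame_def by blast
qed

lemma integral_zero_by_resampling:
  assumes f: "tame k f" "k \<le> 4" and j: "j \<in> {1..N}"
    and zero: "\<And>x. x \<in> space P \<Longrightarrow> (\<integral>u. f (x(j := u)) \<partial>F) = 0"
  shows "integral\<^sup>L P f = 0"
proof -
  have "integral\<^sup>L P f = (\<integral>x. 0 \<partial>P)"
    unfolding integral_resample[OF j tame_integrable[OF f]]
    by (intro Bochner_Integration.integral_cong refl zero)
  then show ?thesis by simp
qed

definition moment :: "nat \<Rightarrow> real" where
  "moment r = (\<integral>u. (\<integral>v. h u v ^ r \<partial>F) \<partial>F)"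

definition cycle :: real where
  "cycle = (\<integral>u. (\<integral>v. (G u v)\<^sup>2 \<partial>F) \<partial>F)"

lemma integral_h_power:
  assumes ij: "i \<in> {1..N}" "j \<in> {1..N}" "i \<noteq> j" and r: "r \<le> 4"
  shows "(\<integral>x. h (x i) (x j) ^ r \<partial>P) = moment r"
proof -
  have "integrable P (\<lambda>x. h (x i) (x j) ^ r)"
    using tame_integrable[OF tame_power[OF tame_h]] ij r by simp
  then show ?thesis unfolding moment_def
    by (intro integral_two_coords ij) auto
qed

lemma integral_G_square:
  assumes ij: "i \<in> {1..N}" "j \<in> {1..N}" "i \<noteq> j"
  shows "(\<integral>x. (G (x i) (x j))\<^sup>2 \<partial>P) = cycle"
proof -
  have "integrable P (\<lambda>x. (G (x i) (x j))\<^sup>2)"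
    using tame_integrable[OF tame_power[OF tame_G, of i j 2]] ij by simp
  then show ?thesis unfolding cycle_def
    by (intro integral_two_coords ij) auto
qed

text \<open>
  Vertices k and l of the cycle are opposite; integrating out either of them produces a
  factor G (x i) (x j).
\<close>

lemma integral_four_cycle:
  assumes d: "{i, j, k, l} \<subseteq> {1..N}" "distinct [i, j, k, l]"
  shows "(\<integral>x. h (x i) (x k) * h (x j) (x k) * h (x i) (x l) * h (x j) (x l) \<partial>P) = cycle"
proof -
  have r: "i \<in> {1..N}" "j \<in> {1..N}" "k \<in> {1..N}" "l \<in> {1..N}" using d by auto
  have t1: "tame 4 (\<lambda>x. h (x i) (x k) * h (x j) (x k) * h (x i) (x l) * h (x j) (x l))"
    using tame_mult[OF tame_mult[OF tame_mult[OF tame_h[OF r(1,3)] tame_h[OF r(2,3)]] tame_h[OF r(1,4)]] tame_h[OF r(2,4)]]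
    by simp
  have t2: "tame 4 (\<lambda>x. G (x i) (x j) * (h (x i) (x l) * h (x j) (x l)))"
    using tame_mult[OF tame_G[OF r(1,2)] tame_mult[OF tame_h[OF r(1,4)] tame_h[OF r(2,4)]]] by simp
  have "(\<integral>x. h (x i) (x k) * h (x j) (x k) * h (x i) (x l) * h (x j) (x l) \<partial>P)
      = (\<integral>x. (\<integral>u. (h (x i) u * h (x j) u) * (h (x i) (x l) * h (x j) (x l)) \<partial>F) \<partial>P)"
    using integral_resample[OF r(3) tame_integrable[OF t1]] d(2) by (simp add: mult.assoc)
  also have "\<dots> = (\<integral>x. G (x i) (x j) * (h (x i) (x l) * h (x j) (x l)) \<partial>P)"
    by (simp only: G_def integral_mult_left_zero)
  also have "\<dots> = (\<integral>x. (\<integral>u. G (x i) (x j) * (h (x i) u * h (x j) u) \<partial>F) \<partial>P)"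
    using integral_resample[OF r(4) tame_integrable[OF t2]] d(2) by simp
  also have "\<dots> = (\<integral>x. (G (x i) (x j))\<^sup>2 \<partial>P)"
    by (simp only: integral_mult_right_zero power2_eq_square G_def)
  also have "\<dots> = cycle" using integral_G_square[OF r(1,2)] d(2) by simp
  finally show ?thesis .
qed

section \<open>Moments of linear and quadratic forms in a centered kernel\<close>

lemma integral_h_first: "v \<in> space F \<Longrightarrow> (\<integral>u. h u v \<partial>F) = 0"
  using h_centered[of v] h_sym[of _ v] by simp

text \<open>
  For given x j, the values h (x i) (x j) are independent and centered. The factor W makes the identity
  cover the term of degree (2, 2) in the expansion of a fourth moment.
\<close>

lemma linear_form_second_moment:
  assumes J: "J \<subseteq> {1..N}" "j \<in> {1..N}" "j \<notin> J"
    and W: "tame 1 W" and W_free: "\<And>x u i. x \<in> space P \<Longrightarrow> u \<in> space F \<Longrightarrow> i \<in> J \<Longrightarrow> W (x(i := u)) = W x"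
  shows "(\<integral>x. ((\<Sum>i\<in>J. a i * h (x i) (x j)) * W x)\<^sup>2 \<partial>P)
    = (\<Sum>i\<in>J. (a i)\<^sup>2 * (\<integral>x. (h (x i) (x j))\<^sup>2 * (W x)\<^sup>2 \<partial>P))"
proof -
  have fin: "finite J" using J finite_subset by blast
  define f where "f i x = a i * h (x i) (x j) * W x" for i x
  have t: "tame 2 (f i)" if "i \<in> J" for i
    unfolding f_def[abs_def]
    using tame_mult[OF tame_cmult[OF tame_h] W, of i j "a i"] that J by auto
  have tt: "tame 4 (\<lambda>x. f i x * f i' x)" if "i \<in> J" "i' \<in> J" for i i'
    using tame_mult[OF t[OF that(1)] t[OF that(2)]] by simp
  have "(\<integral>x. ((\<Sum>i\<in>J. a i * h (x i) (x j)) * W x)\<^sup>2 \<partial>P) = (\<integral>x. (\<Sum>i\<in>J. f i x)\<^sup>2 \<partial>P)"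
    by (simp add: f_def sum_distrib_right)
  also have "\<dots> = (\<Sum>i\<in>J. \<integral>x. (f i x)\<^sup>2 \<partial>P)"
  proof (rule PF.P.expectation_square_sum_orthogonal[OF fin])
    fix i i' assume i: "i \<in> J" "i' \<in> J"
    show "integrable P (\<lambda>x. f i x * f i' x)" by (rule tame_integrable[OF tt[OF i]]) simp
    assume ne: "i \<noteq> i'"
    have ii: "i \<in> {1..N}" using i J by auto
    show "(\<integral>x. f i x * f i' x \<partial>P) = 0"
    proof (rule integral_zero_by_resampling[OF tt[OF i] _ ii])
      fix x assume x: "x \<in> space P"
      have "(\<integral>u. f i (x(i := u)) * f i' (x(i := u)) \<partial>F) = (\<integral>u. (a i * a i' * h (x i') (x j) * (W x)\<^sup>2) * h u (x j) \<partial>F)"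
        using i ne J W_free[OF x _ i(1)]
        by (intro Bochner_Integration.integral_cong) (auto simp: f_def power2_eq_square)
      also have "\<dots> = 0" using integral_h_first[OF coord_in_space[OF x J(2)]] by simp
      finally show "(\<integral>u. f i (x(i := u)) * f i' (x(i := u)) \<partial>F) = 0" .
    qed simp
  qed
  also have "\<dots> = (\<Sum>i\<in>J. (a i)\<^sup>2 * (\<integral>x. (h (x i) (x j))\<^sup>2 * (W x)\<^sup>2 \<partial>P))"
    by (simp add: f_def power_mult_distrib mult.assoc)
  finally show ?thesis .
qed

lemma moment_4_nonneg: "0 \<le> moment 4"
  unfolding moment_def by (intro Bochner_Integration.integral_nonneg) simp

text \<open>
  Induction on the number of terms: if y is a new term and A the old sum, then A^3 y and A y^3
  integrate to 0, and E A^2 y^2 is bounded through the orthogonality of the terms of A. The constant 3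
  persists because of the mixed term in the square of a sum: 3 (s + r)^2 = 3 s^2 + 6 s r + 3 r^2.
\<close>

lemma linear_form_fourth_moment:
  assumes J: "J \<subseteq> {1..N}" "j \<in> {1..N}" "j \<notin> J"
  shows "(\<integral>x. (\<Sum>i\<in>J. a i * h (x i) (x j)) ^ 4 \<partial>P) \<le> 3 * moment 4 * (\<Sum>i\<in>J. (a i)\<^sup>2)\<^sup>2"
proof -
  have "finite J" using J finite_subset by blast
  then show ?thesis using J
  proof (induction J)
    case (insert m J)
    define A where "A x = (\<Sum>i\<in>J. a i * h (x i) (x j))" for x
    define y where "y x = a m * h (x m) (x j)" for x
    have m: "m \<in> {1..N}" "m \<noteq> j" and J: "J \<subseteq> {1..N}" "j \<notin> J" "m \<notin> J" using insert by auto
    have mom: "(\<integral>x. h (x i) (x j) ^ 4 \<partial>P) = moment 4" if "i \<in> insert m J" for i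
      using that insert.prems by (intro integral_h_power) auto
    have tA: "tame 1 A" unfolding A_def[abs_def]
      using J insert.prems by (intro tame_sum tame_cmult tame_h) auto
    have ty: "tame 1 y" unfolding y_def[abs_def]
      using m insert.prems by (intro tame_cmult tame_h)
    note int = tame_integrable[OF _ order_refl]
    have t1: "tame 4 (\<lambda>x. A x ^ 3 * y x)" using tame_mult[OF tame_power[OF tA, of 3] ty] by simp
    have t2: "tame 4 (\<lambda>x. (A x * y x)\<^sup>2)" using tame_power[OF tame_mult[OF tA ty], of 2] by simp
    have t3: "tame 4 (\<lambda>x. A x * y x ^ 3)" using tame_mult[OF tA tame_power[OF ty, of 3]] by simp
    have t4: "tame 4 (\<lambda>x. A x ^ 4)" "tame 4 (\<lambda>x. y x ^ 4)"
      using tame_power[OF tA, of 4] tame_power[OF ty, of 4] by auto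
    have z1: "(\<integral>x. A x ^ 3 * y x \<partial>P) = 0"
    proof (rule integral_zero_by_resampling[OF t1 _ m(1)])
      fix x assume x: "x \<in> space P"
      have "A (x(m := u)) = A x" for u
        unfolding A_def using J m by (intro sum.cong) auto
      then have "(\<integral>u. A (x(m := u)) ^ 3 * y (x(m := u)) \<partial>F) = (\<integral>u. (A x ^ 3 * a m) * h u (x j) \<partial>F)"
        using m by (intro Bochner_Integration.integral_cong) (auto simp: y_def)
      also have "\<dots> = 0" using integral_h_first[OF coord_in_space[OF x \<open>j \<in> {1..N}\<close>]] by simp
      finally show "(\<integral>u. A (x(m := u)) ^ 3 * y (x(m := u)) \<partial>F) = 0" .
    qed simp
    have z3: "(\<integral>x. A x * y x ^ 3 \<partial>P) = 0"
    proof -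
      have t: "tame 4 (\<lambda>x. a i * h (x i) (x j) * y x ^ 3)" if "i \<in> J" for i
        using tame_mult[OF tame_cmult[OF tame_h] tame_power[OF ty, of 3], of i j "a i"] that J insert.prems by auto
      have "(\<integral>x. a i * h (x i) (x j) * y x ^ 3 \<partial>P) = 0" if i: "i \<in> J" for i
      proof (rule integral_zero_by_resampling[OF t[OF i], of i])
        fix x assume x: "x \<in> space P"
        have "y (x(i := u)) = y x" for u
          unfolding y_def using J m i by auto
        then have "(\<integral>u. a i * h ((x(i := u)) i) ((x(i := u)) j) * y (x(i := u)) ^ 3 \<partial>F) = (\<integral>u. (a i * y x ^ 3) * h u (x j) \<partial>F)"
          using J i by (intro Bochner_Integration.integral_cong) auto
        also have "\<dots> = 0" using integral_h_first[OF coord_in_space[OF x \<open>j \<in> {1..N}\<close>]] by simp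
        finally show "(\<integral>u. a i * h ((x(i := u)) i) ((x(i := u)) j) * y (x(i := u)) ^ 3 \<partial>F) = 0" .
      qed (use J i in auto)
      moreover have "(\<integral>x. A x * y x ^ 3 \<partial>P) = (\<Sum>i\<in>J. \<integral>x. a i * h (x i) (x j) * y x ^ 3 \<partial>P)"
        unfolding A_def sum_distrib_right using int[OF t] by (simp add: Bochner_Integration.integral_sum)
      ultimately show ?thesis by simp
    qed
    have z2: "(\<integral>x. (A x * y x)\<^sup>2 \<partial>P) \<le> (\<Sum>i\<in>J. (a i)\<^sup>2) * (a m)\<^sup>2 * moment 4"
    proof -
      have each: "(\<integral>x. (h (x i) (x j))\<^sup>2 * (y x)\<^sup>2 \<partial>P) \<le> (a m)\<^sup>2 * moment 4" if i: "i \<in> J" for i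
      proof -
        have th: "tame 4 (\<lambda>x. h (x k) (x j) ^ 4)" if "k \<in> insert m J" for k
          using tame_power[OF tame_h, of k j 4] that insert.prems by auto
        have thh: "tame 4 (\<lambda>x. (h (x i) (x j))\<^sup>2 * (y x)\<^sup>2)"
          using tame_mult[OF tame_power[OF tame_h, of i j 2] tame_power[OF ty, of 2]] i J insert.prems by auto
        have ineq: "(h (x i) (x j))\<^sup>2 * (y x)\<^sup>2 \<le> (a m)\<^sup>2 * ((h (x i) (x j) ^ 4 + h (x m) (x j) ^ 4) / 2)" for x
        proof -
          have "(h (x i) (x j))\<^sup>2 * (h (x m) (x j))\<^sup>2 \<le> (h (x i) (x j) ^ 4 + h (x m) (x j) ^ 4) / 2"
            using sum_squares_bound[of "(h (x i) (x j))\<^sup>2" "(h (x m) (x j))\<^sup>2"] by (simp flip: power_mult)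
          then have "(a m)\<^sup>2 * ((h (x i) (x j))\<^sup>2 * (h (x m) (x j))\<^sup>2) \<le> (a m)\<^sup>2 * ((h (x i) (x j) ^ 4 + h (x m) (x j) ^ 4) / 2)"
            by (rule mult_left_mono) simp
          then show ?thesis by (simp add: y_def power_mult_distrib mult_ac)
        qed
        have "(\<integral>x. (h (x i) (x j))\<^sup>2 * (y x)\<^sup>2 \<partial>P) \<le> (\<integral>x. (a m)\<^sup>2 * ((h (x i) (x j) ^ 4 + h (x m) (x j) ^ 4) / 2) \<partial>P)"
          by (rule integral_mono) (use ineq int[OF thh] int[OF th] i in auto)
        also have "\<dots> = (a m)\<^sup>2 * moment 4"
          using int[OF th] i mom by simp
        finally show ?thesis .
      qed
      have y_free: "y (x(i := u)) = y x" if "i \<in> J" for x u i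
        unfolding y_def using J m that by auto
      have "(\<integral>x. (A x * y x)\<^sup>2 \<partial>P) = (\<Sum>i\<in>J. (a i)\<^sup>2 * (\<integral>x. (h (x i) (x j))\<^sup>2 * (y x)\<^sup>2 \<partial>P))"
        unfolding A_def by (rule linear_form_second_moment[OF J(1) \<open>j \<in> {1..N}\<close> J(2) ty y_free])
      also have "\<dots> \<le> (\<Sum>i\<in>J. (a i)\<^sup>2 * ((a m)\<^sup>2 * moment 4))"
        by (intro sum_mono mult_left_mono each) auto
      finally show ?thesis by (simp add: sum_distrib_right mult.assoc)
    qed
    have z4: "(\<integral>x. y x ^ 4 \<partial>P) = a m ^ 4 * moment 4"
      using mom[of m] by (simp add: y_def power_mult_distrib)
    have IH: "(\<integral>x. A x ^ 4 \<partial>P) \<le> 3 * moment 4 * (\<Sum>i\<in>J. (a i)\<^sup>2)\<^sup>2"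
      unfolding A_def using insert by auto
    have expand: "(A x + y x) ^ 4 = A x ^ 4 + 4 * (A x ^ 3 * y x) + 6 * (A x * y x)\<^sup>2 + 4 * (A x * y x ^ 3) + y x ^ 4" for x
      by (simp add: power4_eq_xxxx power3_eq_cube power2_eq_square algebra_simps)
    have "(\<integral>x. (\<Sum>i\<in>insert m J. a i * h (x i) (x j)) ^ 4 \<partial>P) = (\<integral>x. (A x + y x) ^ 4 \<partial>P)"
      using insert by (simp add: A_def y_def add.commute)
    also have "\<dots> = (\<integral>x. A x ^ 4 \<partial>P) + 4 * (\<integral>x. A x ^ 3 * y x \<partial>P) + 6 * (\<integral>x. (A x * y x)\<^sup>2 \<partial>P)
        + 4 * (\<integral>x. A x * y x ^ 3 \<partial>P) + (\<integral>x. y x ^ 4 \<partial>P)"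
      unfolding expand using int[OF t1] int[OF t2] int[OF t3] int[OF t4(1)] int[OF t4(2)] by simp
    also have "\<dots> \<le> 3 * moment 4 * (\<Sum>i\<in>J. (a i)\<^sup>2)\<^sup>2 + 6 * ((\<Sum>i\<in>J. (a i)\<^sup>2) * (a m)\<^sup>2 * moment 4) + a m ^ 4 * moment 4"
      using IH z1 z2 z3 z4 by simp
    also have "\<dots> \<le> 3 * moment 4 * ((a m)\<^sup>2 + (\<Sum>i\<in>J. (a i)\<^sup>2))\<^sup>2"
    proof -
      have "a m ^ 4 * moment 4 \<le> 3 * (((a m)\<^sup>2)\<^sup>2 * moment 4)"
        using moment_4_nonneg by (simp flip: power_mult)
      then show ?thesis by (simp add: power2_sum algebra_simps)
    qed
    also have "\<dots> = 3 * moment 4 * (\<Sum>i\<in>insert m J. (a i)\<^sup>2)\<^sup>2" using insert by simp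
    finally show ?case .
  qed simp
qed

text \<open>
  Two different pairs leave an index that occurs in only one of them, and resampling
  that index shows that they are uncorrelated.
\<close>

lemma pair_form_second_moment:
  assumes tame: "\<And>i k. i \<in> {1..N} \<Longrightarrow> k \<in> {1..N} \<Longrightarrow> tame 2 (\<lambda>x. \<phi> (x i) (x k))"
    and sym: "\<And>u v. \<phi> u v = \<phi> v u"
    and centered: "\<And>u. u \<in> space F \<Longrightarrow> (\<integral>v. \<phi> u v \<partial>F) = 0"
    and square: "\<And>i k. i \<in> {1..N} \<Longrightarrow> k \<in> {1..N} \<Longrightarrow> i \<noteq> k \<Longrightarrow> (\<integral>x. (\<phi> (x i) (x k))\<^sup>2 \<partial>P) = m"
    and T: "T \<subseteq> {1..N} \<times> {1..N}"
    and asym: "\<And>i k. (i, k) \<in> T \<Longrightarrow> i \<noteq> k \<and> (k, i) \<notin> T"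
  shows "(\<integral>x. (\<Sum>(i, k)\<in>T. c i k * \<phi> (x i) (x k))\<^sup>2 \<partial>P) = (\<Sum>(i, k)\<in>T. (c i k)\<^sup>2) * m"
proof -
  have fin: "finite T" using T finite_subset by blast
  define f where "f e x = c (fst e) (snd e) * \<phi> (x (fst e)) (x (snd e))" for e x
  have t: "tame 2 (f e)" if "e \<in> T" for e
    unfolding f_def[abs_def] using that T by (intro tame_cmult tame) auto
  have tt: "tame 4 (\<lambda>x. f e x * f e' x)" if "e \<in> T" "e' \<in> T" for e e'
    using tame_mult[OF t[OF that(1)] t[OF that(2)]] by simp
  have "(\<integral>x. (\<Sum>(i, k)\<in>T. c i k * \<phi> (x i) (x k))\<^sup>2 \<partial>P) = (\<integral>x. (\<Sum>e\<in>T. f e x)\<^sup>2 \<partial>P)"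
    by (simp add: f_def case_prod_beta)
  also have "\<dots> = (\<Sum>e\<in>T. \<integral>x. (f e x)\<^sup>2 \<partial>P)"
  proof (rule PF.P.expectation_square_sum_orthogonal[OF fin])
    fix e e' assume e: "e \<in> T" "e' \<in> T"
    show "integrable P (\<lambda>x. f e x * f e' x)" by (rule tame_integrable[OF tt[OF e]]) simp
    assume ne: "e \<noteq> e'"
    obtain i k i' k' where ee: "e = (i, k)" "e' = (i', k')" by fastforce
    have r: "i \<in> {1..N}" "k \<in> {1..N}" "i' \<in> {1..N}" "k' \<in> {1..N}" "i \<noteq> k" "i' \<noteq> k'"
      using e T asym ee by auto
    have "i \<notin> {i', k'} \<or> k \<notin> {i', k'}"
      using ne e asym ee by auto
    then show "(\<integral>x. f e x * f e' x \<partial>P) = 0"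
    proof
      assume i: "i \<notin> {i', k'}"
      show ?thesis
      proof (rule integral_zero_by_resampling[OF tt[OF e] _ r(1)])
        fix x assume x: "x \<in> space P"
        have "(\<integral>u. f e (x(i := u)) * f e' (x(i := u)) \<partial>F) = (\<integral>u. (c i k * f e' x) * \<phi> (x k) u \<partial>F)"
          using i r by (intro Bochner_Integration.integral_cong) (auto simp: f_def ee sym[of _ "x k"])
        also have "\<dots> = 0" using centered[OF coord_in_space[OF x r(2)]] by simp
        finally show "(\<integral>u. f e (x(i := u)) * f e' (x(i := u)) \<partial>F) = 0" .
      qed simp
    next
      assume k: "k \<notin> {i', k'}"
      show ?thesis
      proof (rule integral_zero_by_resampling[OF tt[OF e] _ r(2)])
        fix x assume x: "x \<in> space P"
        have "(\<integral>u. f e (x(k := u)) * f e' (x(k := u)) \<partial>F) = (\<integral>u. (c i k * f e' x) * \<phi> (x i) u \<partial>F)"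
          using k r by (intro Bochner_Integration.integral_cong) (auto simp: f_def ee)
        also have "\<dots> = 0" using centered[OF coord_in_space[OF x r(1)]] by simp
        finally show "(\<integral>u. f e (x(k := u)) * f e' (x(k := u)) \<partial>F) = 0" .
      qed simp
    qed
  qed
  also have "\<dots> = (\<Sum>e\<in>T. (c (fst e) (snd e))\<^sup>2 * m)"
    using T asym by (intro sum.cong refl) (force simp: f_def power_mult_distrib square)
  also have "\<dots> = (\<Sum>(i, k)\<in>T. (c i k)\<^sup>2) * m" by (simp add: sum_distrib_right case_prod_beta)
  finally show ?thesis .
qed

lemma integral_G_diagonal: "(\<integral>u. G u u \<partial>F) = moment 2"
  by (simp add: G_def moment_def power2_eq_square)

text \<open>
  G (x i) (x i) is the second moment of h (x i) Z for an independent Z, and has mean 1. Its variance is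
  at most E h^4 by the inequality of Jensen.
\<close>

lemma diagonal_second_moment:
  assumes D: "moment 2 = 1" and N: "1 \<le> N"
  shows "(\<integral>x. (\<Sum>i=1..N. c i * (G (x i) (x i) - 1))\<^sup>2 \<partial>P) \<le> (\<Sum>i=1..N. (c i)\<^sup>2) * moment 4"
proof -
  define f where "f i x = c i * (G (x i) (x i) - 1)" for i x
  have t: "tame 2 (\<lambda>x. G (x i) (x i) - 1)" if "i \<in> {1..N}" for i
    using tame_add[OF tame_G[OF that that] tame_mono[OF tame_const[of "-1"]]] by simp
  have tt: "tame 4 (\<lambda>x. f i x * f i' x)" if "i \<in> {1..N}" "i' \<in> {1..N}" for i i'
    using tame_mult[OF tame_cmult[OF t[OF that(1)]] tame_cmult[OF t[OF that(2)]], of "c i" "c i'"]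
    by (simp add: f_def)
  have N1: "1 \<in> {1..N}" using N by simp
  have g1: "integrable F (\<lambda>u. G u u)"
    using tame_integrable[OF tame_G[OF N1 N1]] integrable_coord[OF N1, of "\<lambda>u. G u u"] by simp
  have g2: "integrable F (\<lambda>u. (G u u)\<^sup>2)"
    using tame_integrable[OF tame_power[OF tame_G[OF N1 N1], of 2]] integrable_coord[OF N1, of "\<lambda>u. (G u u)\<^sup>2"]
    by simp
  have single: "(\<integral>x. (G (x i) (x i) - 1)\<^sup>2 \<partial>P) \<le> moment 4" if i: "i \<in> {1..N}" for i
  proof -
    have "(\<integral>x. (G (x i) (x i) - 1)\<^sup>2 \<partial>P) = (\<integral>u. (G u u - 1)\<^sup>2 \<partial>F)"
      by (rule integral_coord[OF i]) measurable
    also have "\<dots> = (\<integral>u. (G u u)\<^sup>2 \<partial>F) - 1"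
      using g1 g2 D integral_G_diagonal by (simp add: power2_diff F.prob_space)
    also have "\<dots> \<le> (\<integral>u. (G u u)\<^sup>2 \<partial>F)" by simp
    also have "\<dots> \<le> moment 4"
      unfolding moment_def
    proof (rule integral_mono_AE[OF g2])
      have h4: "integrable F (\<lambda>u. \<integral>v. h u v ^ 4 \<partial>F)"
      proof (rule Bochner_Integration.integrable_bound)
        show "integrable F (\<lambda>u. \<integral>v. 8 * (b u ^ 4 + b v ^ 4) \<partial>F)"
          using b_int4 by (simp add: F.prob_space)
        show "AE u in F. norm (\<integral>v. h u v ^ 4 \<partial>F) \<le> norm (\<integral>v. 8 * (b u ^ 4 + b v ^ 4) \<partial>F)"
        proof (rule AE_I2)
          fix u assume u: "u \<in> space F"
          have "(\<integral>v. h u v ^ 4 \<partial>F) \<le> (\<integral>v. 8 * (b u ^ 4 + b v ^ 4) \<partial>F)"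
          proof (rule integral_mono[OF h_int4[OF u]])
            fix v assume v: "v \<in> space F"
            have "\<bar>h u v\<bar> ^ 4 \<le> (b u + b v) ^ 4" by (intro power_mono h_bound u v) simp
            then show "h u v ^ 4 \<le> 8 * (b u ^ 4 + b v ^ 4)"
              using sum_fourth_power_le[of "b u" "b v"] by simp
          qed (use b_int4 in auto)
          moreover have "0 \<le> (\<integral>v. h u v ^ 4 \<partial>F)" by (intro Bochner_Integration.integral_nonneg) simp
          ultimately show "norm (\<integral>v. h u v ^ 4 \<partial>F) \<le> norm (\<integral>v. 8 * (b u ^ 4 + b v ^ 4) \<partial>F)" by simp
        qed
      qed measurable
      show "integrable F (\<lambda>u. \<integral>v. h u v ^ 4 \<partial>F)" by (rule h4)
      show "AE u in F. (G u u)\<^sup>2 \<le> (\<integral>v. h u v ^ 4 \<partial>F)"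
      proof (rule AE_I2)
        fix u assume u: "u \<in> space F"
        have "(\<integral>v. (h u v)\<^sup>2 \<partial>F)\<^sup>2 \<le> (\<integral>v. ((h u v)\<^sup>2)\<^sup>2 \<partial>F)"
          using h_int2[OF u] h_int4[OF u] by (intro F.square_expectation_le) (auto simp flip: power_mult)
        then show "(G u u)\<^sup>2 \<le> (\<integral>v. h u v ^ 4 \<partial>F)"
          by (simp add: G_def power2_eq_square power4_eq_xxxx mult.assoc)
      qed
    qed
    finally show ?thesis .
  qed
  have "(\<integral>x. (\<Sum>i=1..N. f i x)\<^sup>2 \<partial>P) = (\<Sum>i=1..N. \<integral>x. (f i x)\<^sup>2 \<partial>P)"
  proof (rule PF.P.expectation_square_sum_orthogonal)
    fix i i' assume i: "i \<in> {1..N}" "i' \<in> {1..N}"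
    show "integrable P (\<lambda>x. f i x * f i' x)" by (rule tame_integrable[OF tt[OF i]]) simp
    assume ne: "i \<noteq> i'"
    show "(\<integral>x. f i x * f i' x \<partial>P) = 0"
    proof (rule integral_zero_by_resampling[OF tt[OF i] _ i(1)])
      fix x assume x: "x \<in> space P"
      have "(\<integral>u. f i (x(i := u)) * f i' (x(i := u)) \<partial>F) = (\<integral>u. (c i * f i' x) * (G u u - 1) \<partial>F)"
        using ne by (intro Bochner_Integration.integral_cong) (auto simp: f_def)
      also have "\<dots> = 0" using g1 D integral_G_diagonal by (simp add: F.prob_space)
      finally show "(\<integral>u. f i (x(i := u)) * f i' (x(i := u)) \<partial>F) = 0" .
    qed simp
  qed simp
  also have "\<dots> = (\<Sum>i=1..N. (c i)\<^sup>2 * (\<integral>x. (G (x i) (x i) - 1)\<^sup>2 \<partial>P))"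
    by (simp add: f_def power_mult_distrib)
  also have "\<dots> \<le> (\<Sum>i=1..N. (c i)\<^sup>2 * moment 4)"
    by (intro sum_mono mult_left_mono single) auto
  finally show ?thesis by (simp add: f_def sum_distrib_right)
qed

section \<open>A central limit bound for quadratic forms\<close>

lemma cycle_nonneg: "0 \<le> cycle"
  unfolding cycle_def by (intro Bochner_Integration.integral_nonneg) simp

lemma moment_2_square_le:
  assumes "2 \<le> N"
  shows "(moment 2)\<^sup>2 \<le> moment 4"
proof -
  have 1: "1 \<in> {1..N}" "2 \<in> {1..N}" "(1::nat) \<noteq> 2" using assms by auto
  have "(\<integral>x. (h (x 1) (x 2))\<^sup>2 \<partial>P)\<^sup>2 \<le> (\<integral>x. ((h (x 1) (x 2))\<^sup>2)\<^sup>2 \<partial>P)"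
    using tame_integrable[OF tame_power[OF tame_h[OF 1(1,2)], of 2]]
      tame_integrable[OF tame_power[OF tame_h[OF 1(1,2)], of 4]]
    by (intro PF.P.square_expectation_le) (simp_all flip: power_mult)
  then show ?thesis
    using integral_h_power[OF 1, of 2] integral_h_power[OF 1, of 4] by (simp flip: power_mult)
qed

lemma quadratic_form_mean_and_variance:
  assumes T: "T \<subseteq> {1..N} \<times> {1..N}"
    and asym: "\<And>i k. (i, k) \<in> T \<Longrightarrow> i \<noteq> k \<and> (k, i) \<notin> T"
  shows "integrable P (\<lambda>x. \<Sum>(i, k)\<in>T. c i k * h (x i) (x k))"
    and "(\<integral>x. (\<Sum>(i, k)\<in>T. c i k * h (x i) (x k)) \<partial>P) = 0"
    and "integrable P (\<lambda>x. (\<Sum>(i, k)\<in>T. c i k * h (x i) (x k))\<^sup>2)"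
    and "(\<integral>x. (\<Sum>(i, k)\<in>T. c i k * h (x i) (x k))\<^sup>2 \<partial>P) = (\<Sum>(i, k)\<in>T. (c i k)\<^sup>2) * moment 2"
proof -
  have t: "tame 1 (\<lambda>x. c i k * h (x i) (x k))" if "(i, k) \<in> T" for i k
    using that T by (intro tame_cmult tame_h) auto
  have tS: "tame 1 (\<lambda>x. \<Sum>(i, k)\<in>T. c i k * h (x i) (x k))"
    unfolding case_prod_beta using T by (intro tame_sum tame_cmult tame_h) auto
  show "integrable P (\<lambda>x. \<Sum>(i, k)\<in>T. c i k * h (x i) (x k))"
    by (rule tame_integrable[OF tS]) simp
  show "integrable P (\<lambda>x. (\<Sum>(i, k)\<in>T. c i k * h (x i) (x k))\<^sup>2)"
    using tame_integrable[OF tame_power[OF tS, of 2]] by simp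
  have "(\<integral>x. c i k * h (x i) (x k) \<partial>P) = 0" if ik: "(i, k) \<in> T" for i k
  proof (rule integral_zero_by_resampling[OF t[OF ik], of k])
    fix x assume x: "x \<in> space P"
    have "i \<in> {1..N}" "i \<noteq> k" using ik T asym by auto
    then show "(\<integral>u. c i k * h ((x(k := u)) i) ((x(k := u)) k) \<partial>F) = 0"
      using h_centered[OF coord_in_space[OF x, of i]] by simp
  qed (use ik T in auto)
  then have "(\<Sum>(i, k)\<in>T. \<integral>x. c i k * h (x i) (x k) \<partial>P) = 0"
    by (intro sum.neutral) auto
  moreover have "(\<integral>x. (\<Sum>(i, k)\<in>T. c i k * h (x i) (x k)) \<partial>P) = (\<Sum>(i, k)\<in>T. \<integral>x. c i k * h (x i) (x k) \<partial>P)"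
    unfolding case_prod_beta using tame_integrable[OF t]
    by (intro Bochner_Integration.integral_sum) auto
  ultimately show "(\<integral>x. (\<Sum>(i, k)\<in>T. c i k * h (x i) (x k)) \<partial>P) = 0"
    by simp
  show "(\<integral>x. (\<Sum>(i, k)\<in>T. c i k * h (x i) (x k))\<^sup>2 \<partial>P) = (\<Sum>(i, k)\<in>T. (c i k)\<^sup>2) * moment 2"
    by (rule pair_form_second_moment)
       (use T asym h_sym h_centered integral_h_power[of _ _ 2] tame_mono[OF tame_h, of _ _ 2] in auto)
qed

text \<open>
  The martingale differences are the column sums \<xi> j. Their conditional variances add up to a
  quadratic form in G with the matrix c i k, the sum over j of v i j * v k j. As each v i j is at most \<beta> / N, all
  entries of c are at most \<beta>^2 / N, while its trace is 1. Hence the diagonal of c has sum of squares at most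
  \<beta>^2 / N, which is multiplied by the fourth moment of h, and the whole matrix has sum of squares at most
  \<beta>^4, which is multiplied by the second moment of G.
\<close>

theorem quadratic_form_char_bound:
  fixes v :: "nat \<Rightarrow> nat \<Rightarrow> real"
  assumes D: "moment 2 = 1"
    and lower: "\<And>i j. \<not> i < j \<Longrightarrow> v i j = 0"
    and \<beta>: "0 < \<beta>" "\<And>i j. i \<in> {1..N} \<Longrightarrow> j \<in> {1..N} \<Longrightarrow> \<bar>v i j\<bar> \<le> \<beta> / real N"
    and norm: "(\<Sum>j=1..N. \<Sum>i=1..N. (v i j)\<^sup>2) = 1"
  shows "cmod ((\<integral>x. iexp (t * (\<Sum>j=1..N. \<Sum>i=1..N. v i j * h (x i) (x j))) \<partial>P) - exp (- (t\<^sup>2 / 2)))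
    \<le> clt_error t (sqrt (3 * \<beta>\<^sup>2 * (moment 4 / real N)))
        (sqrt (3 * \<beta>\<^sup>2 * (moment 4 / real N) + 6 * \<beta> ^ 4 * cycle))"
proof -
  define M where "M = \<beta>\<^sup>2 * (moment 4 / real N)"
  define \<xi> where "\<xi> j x = (\<Sum>i=1..N. v i j * h (x i) (x j))" for j x
  define s where "s j x = (\<Sum>i=1..N. \<Sum>k=1..N. v i j * v k j * G (x i) (x k))" for j x
  define c where "c i k = (\<Sum>j=1..N. v i j * v k j)" for i k
  have N: "2 \<le> N"
  proof (rule ccontr)
    assume "\<not> 2 \<le> N"
    then have "v i j = 0" if "i \<in> {1..N}" "j \<in> {1..N}" for i j using that by (intro lower) auto
    then show False using norm by simp
  qed
  have m4: "1 \<le> moment 4" using moment_2_square_le[OF N] D by simp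
  have M: "0 < M" unfolding M_def using \<beta>(1) m4 N by simp
  have vsq: "(v i j)\<^sup>2 \<le> (\<beta> / real N)\<^sup>2" if "i \<in> {1..N}" "j \<in> {1..N}" for i j
    using power_mono[OF \<beta>(2)[OF that], of 2] by simp
  have row: "(\<Sum>i=1..N. (v i j)\<^sup>2) \<le> \<beta>\<^sup>2 / real N" if j: "j \<in> {1..N}" for j
  proof -
    have "(\<Sum>i=1..N. (v i j)\<^sup>2) \<le> (\<Sum>i=1..N. (\<beta> / real N)\<^sup>2)" by (intro sum_mono vsq j)
    then show ?thesis using N by (simp add: power2_eq_square)
  qed
  have c_bound: "\<bar>c i k\<bar> \<le> \<beta>\<^sup>2 / real N" if "i \<in> {1..N}" "k \<in> {1..N}" for i k
  proof -
    have "\<bar>c i k\<bar> \<le> (\<Sum>j=1..N. \<bar>v i j\<bar> * \<bar>v k j\<bar>)"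
      unfolding c_def by (rule order_trans[OF sum_abs]) (simp add: abs_mult)
    also have "\<dots> \<le> (\<Sum>j=1..N. \<beta> / real N * (\<beta> / real N))"
      using \<beta> that by (intro sum_mono mult_mono) auto
    finally show ?thesis using N by (simp add: power2_eq_square)
  qed
  have c_diag: "c i i = (\<Sum>j=1..N. (v i j)\<^sup>2)" for i by (simp add: c_def power2_eq_square)
  have c_total: "(\<Sum>i=1..N. c i i) = 1"
    unfolding c_diag by (subst sum.swap) (rule norm)
  have c0: "0 \<le> c i i" for i unfolding c_diag by (intro sum_nonneg) simp
  have \<xi>_J: "\<xi> j x = (\<Sum>i\<in>{1..<j}. v i j * h (x i) (x j))" if "j \<in> {1..N}" for j x
    unfolding \<xi>_def using that lower by (intro sum.mono_neutral_right) (auto simp: not_less)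
  have sq_J: "(\<Sum>i=1..N. (v i j)\<^sup>2) = (\<Sum>i\<in>{1..<j}. (v i j)\<^sup>2)" if "j \<in> {1..N}" for j
    using that lower by (intro sum.mono_neutral_right) (auto simp: not_less)
  have t\<xi>: "tame 1 (\<xi> j)" if "j \<in> {1..N}" for j
    unfolding \<xi>_def[abs_def] using that by (intro tame_sum tame_cmult tame_h)
  have t\<xi>4: "tame 4 (\<lambda>x. \<xi> j x ^ 4)" if "j \<in> {1..N}" for j
    using tame_power[OF t\<xi>[OF that], of 4] by simp
  have ts: "tame 2 (s j)" if "j \<in> {1..N}" for j
    unfolding s_def[abs_def] using that by (intro tame_sum tame_cmult tame_G)
  have upd: "\<xi> j (x(j := u)) = (\<Sum>i=1..N. v i j * h (x i) u)" for j x u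
    unfolding \<xi>_def by (intro sum.cong refl) (use lower in auto)
  have fourth: "(\<integral>x. \<xi> j x ^ 4 \<partial>P) \<le> 3 * M * (\<Sum>i=1..N. (v i j)\<^sup>2)" if j: "j \<in> {1..N}" for j
  proof -
    have "(\<integral>x. \<xi> j x ^ 4 \<partial>P) \<le> 3 * moment 4 * (\<Sum>i=1..N. (v i j)\<^sup>2)\<^sup>2"
      unfolding \<xi>_J[OF j] sq_J[OF j] by (rule linear_form_fourth_moment) (use j in auto)
    also have "\<dots> = 3 * moment 4 * ((\<Sum>i=1..N. (v i j)\<^sup>2) * (\<Sum>i=1..N. (v i j)\<^sup>2))"
      by (simp add: power2_eq_square)
    also have "\<dots> \<le> 3 * moment 4 * ((\<beta>\<^sup>2 / real N) * (\<Sum>i=1..N. (v i j)\<^sup>2))"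
      using m4 row[OF j] by (intro mult_left_mono mult_right_mono sum_nonneg) auto
    finally show ?thesis by (simp add: M_def mult_ac)
  qed
  have second: "(\<integral>x. (\<xi> j x)\<^sup>2 \<partial>P) = (\<Sum>i=1..N. (v i j)\<^sup>2)" if j: "j \<in> {1..N}" for j
  proof -
    have "(\<integral>x. (\<xi> j x)\<^sup>2 \<partial>P) = (\<integral>x. ((\<Sum>i\<in>{1..<j}. v i j * h (x i) (x j)) * 1)\<^sup>2 \<partial>P)"
      by (simp add: \<xi>_J[OF j])
    also have "\<dots> = (\<Sum>i\<in>{1..<j}. (v i j)\<^sup>2 * (\<integral>x. (h (x i) (x j))\<^sup>2 * 1\<^sup>2 \<partial>P))"
      by (rule linear_form_second_moment) (use j tame_mono[OF tame_const] in auto)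
    also have "\<dots> = (\<Sum>i\<in>{1..<j}. (v i j)\<^sup>2)"
      using j by (intro sum.cong refl) (simp add: integral_h_power D)
    finally show ?thesis by (simp add: sq_J[OF j])
  qed
  define T where "T = {(i, k). i \<in> {1..N} \<and> k \<in> {1..N} \<and> i < k}"
  define T' where "T' = {(i, k). i \<in> {1..N} \<and> k \<in> {1..N} \<and> k < i}"
  have TT: "T \<subseteq> {1..N} \<times> {1..N}" "T' \<subseteq> {1..N} \<times> {1..N}" by (auto simp: T_def T'_def)
  have finT: "finite T" "finite T'" using TT finite_subset by blast+
  define U where "U x = (\<Sum>(i, k)\<in>T. c i k * G (x i) (x k))" for x
  define U' where "U' x = (\<Sum>(i, k)\<in>T'. c i k * G (x i) (x k))" for x
  define Dg where "Dg x = (\<Sum>i=1..N. c i i * (G (x i) (x i) - 1))" for x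
  \<comment> \<open>The part above the diagonal and its mirror image are estimated separately, because the
    orthogonality of distinct pairs holds for unordered pairs.\<close>
  have V: "(\<Sum>j=1..N. s j x) - 1 = Dg x + U x + U' x" for x
  proof -
    have "(\<Sum>j=1..N. s j x) = (\<Sum>i=1..N. \<Sum>k=1..N. c i k * G (x i) (x k))"
    proof -
      have "(\<Sum>j=1..N. s j x) = (\<Sum>i=1..N. \<Sum>j=1..N. \<Sum>k=1..N. v i j * v k j * G (x i) (x k))"
        unfolding s_def by (rule sum.swap)
      also have "\<dots> = (\<Sum>i=1..N. \<Sum>k=1..N. \<Sum>j=1..N. v i j * v k j * G (x i) (x k))"
        by (intro sum.cong refl sum.swap)
      finally show ?thesis by (simp add: c_def sum_distrib_right)
    qed
    also have "\<dots> = (\<Sum>(i, k)\<in>{1..N} \<times> {1..N}. c i k * G (x i) (x k))"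
      by (rule sum.cartesian_product)
    also have "{1..N} \<times> {1..N} = (\<lambda>i. (i, i)) ` {1..N} \<union> (T \<union> T')"
      by (auto simp: T_def T'_def)
    also have "(\<Sum>(i, k)\<in>(\<lambda>i. (i, i)) ` {1..N} \<union> (T \<union> T'). c i k * G (x i) (x k))
        = (\<Sum>(i, k)\<in>(\<lambda>i. (i, i)) ` {1..N}. c i k * G (x i) (x k)) + (U x + U' x)"
      unfolding U_def U'_def using finT
      by (subst sum.union_disjoint, simp, simp, force simp: T_def T'_def,
          subst sum.union_disjoint) (auto simp: T_def T'_def)
    also have "(\<Sum>(i, k)\<in>(\<lambda>i. (i, i)) ` {1..N}. c i k * G (x i) (x k)) = (\<Sum>i=1..N. c i i * G (x i) (x i))"
      by (subst sum.reindex) (auto simp: inj_on_def)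
    finally show ?thesis
      using c_total by (simp add: Dg_def right_diff_distrib sum_subtractf)
  qed
  have tU: "tame 2 U" "tame 2 U'" unfolding U_def[abs_def] U'_def[abs_def] using TT
    by (auto intro!: tame_sum tame_cmult tame_G simp: case_prod_beta)
  have tDg: "tame 2 Dg" unfolding Dg_def[abs_def]
  proof (intro tame_sum tame_cmult)
    fix i assume i: "i \<in> {1..N}"
    show "tame 2 (\<lambda>x. G (x i) (x i) - 1)"
      using tame_add[OF tame_G[OF i i] tame_mono[OF tame_const[of "-1"]]] by simp
  qed
  have int2: "integrable P (\<lambda>x. (f x)\<^sup>2)" if "tame 2 f" for f
    using tame_integrable[OF tame_power[OF that, of 2]] by simp
  have csq: "(\<Sum>(i, k)\<in>S. (c i k)\<^sup>2) \<le> \<beta> ^ 4" if S: "S \<subseteq> {1..N} \<times> {1..N}" for S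
  proof -
    have "(\<Sum>(i, k)\<in>S. (c i k)\<^sup>2) \<le> (\<Sum>(i, k)\<in>{1..N} \<times> {1..N}. (c i k)\<^sup>2)"
      by (rule sum_mono2) (use S in auto)
    also have "\<dots> \<le> (\<Sum>(i, k)\<in>{1..N} \<times> {1..N}. (\<beta>\<^sup>2 / real N)\<^sup>2)"
    proof (rule sum_mono, clarify)
      fix i k assume "i \<in> {1..N}" "k \<in> {1..N}"
      then show "(c i k)\<^sup>2 \<le> (\<beta>\<^sup>2 / real N)\<^sup>2" using power_mono[OF c_bound, of i k 2] by simp
    qed
    also have "\<dots> = \<beta> ^ 4" using N by (simp add: power_divide power2_eq_square power4_eq_xxxx)
    finally show ?thesis .
  qed
  have EU: "(\<integral>x. (U x)\<^sup>2 \<partial>P) \<le> \<beta> ^ 4 * cycle" "(\<integral>x. (U' x)\<^sup>2 \<partial>P) \<le> \<beta> ^ 4 * cycle"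
    unfolding U_def U'_def using TT csq cycle_nonneg
    by (subst pair_form_second_moment[where m=cycle and \<phi>=G, OF tame_G G_sym G_centered integral_G_square];
        auto simp: T_def T'_def intro!: mult_right_mono)+
  have EDg: "(\<integral>x. (Dg x)\<^sup>2 \<partial>P) \<le> M"
  proof -
    have "(\<integral>x. (Dg x)\<^sup>2 \<partial>P) \<le> (\<Sum>i=1..N. (c i i)\<^sup>2) * moment 4"
      unfolding Dg_def by (rule diagonal_second_moment[OF D]) (use N in simp)
    also have "\<dots> \<le> (\<beta>\<^sup>2 / real N) * moment 4"
    proof (rule mult_right_mono)
      have "(\<Sum>i=1..N. (c i i)\<^sup>2) \<le> (\<Sum>i=1..N. \<beta>\<^sup>2 / real N * c i i)"
        unfolding power2_eq_square using c_bound c0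
        by (intro sum_mono mult_right_mono) (auto simp: power2_eq_square abs_le_iff)
      then show "(\<Sum>i=1..N. (c i i)\<^sup>2) \<le> \<beta>\<^sup>2 / real N"
        unfolding sum_distrib_left[symmetric] c_total by simp
    qed (use m4 in simp)
    finally show ?thesis by (simp add: M_def)
  qed
  have tV: "tame 2 (\<lambda>x. (\<Sum>j=1..N. s j x) - 1)"
    unfolding V by (intro tame_add tU tDg)
  have ER: "(\<integral>x. ((\<Sum>j=1..N. s j x) - 1)\<^sup>2 \<partial>P) \<le> 3 * M + 6 * \<beta> ^ 4 * cycle"
  proof -
    have three: "(a + b + d)\<^sup>2 \<le> 3 * (a\<^sup>2 + b\<^sup>2 + d\<^sup>2)" for a b d :: real
      using zero_le_power2[of "a - b"] zero_le_power2[of "a - d"] zero_le_power2[of "b - d"]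
      by (simp add: power2_eq_square algebra_simps)
    have "(\<integral>x. ((\<Sum>j=1..N. s j x) - 1)\<^sup>2 \<partial>P) \<le> (\<integral>x. 3 * ((Dg x)\<^sup>2 + (U x)\<^sup>2 + (U' x)\<^sup>2) \<partial>P)"
    proof (rule integral_mono)
      show "integrable P (\<lambda>x. ((\<Sum>j=1..N. s j x) - 1)\<^sup>2)" by (rule int2[OF tV])
      show "integrable P (\<lambda>x. 3 * ((Dg x)\<^sup>2 + (U x)\<^sup>2 + (U' x)\<^sup>2))"
        using int2 tU tDg by auto
    qed (unfold V, rule three)
    also have "\<dots> = 3 * ((\<integral>x. (Dg x)\<^sup>2 \<partial>P) + (\<integral>x. (U x)\<^sup>2 \<partial>P) + (\<integral>x. (U' x)\<^sup>2 \<partial>P))"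
      using int2 tU tDg by simp
    finally show ?thesis using EU EDg by simp
  qed
  define q where "q = sqrt (3 * M)"
  define r where "r = sqrt (3 * M + 6 * \<beta> ^ 4 * cycle)"
  have q: "0 < q" "q\<^sup>2 = 3 * M" using M by (simp_all add: q_def)
  have Mc: "0 < 3 * M + 6 * \<beta> ^ 4 * cycle" using M cycle_nonneg by (intro add_pos_nonneg) auto
  have r: "0 < r" "r\<^sup>2 = 3 * M + 6 * \<beta> ^ 4 * cycle" using Mc by (simp_all add: r_def)
  have "cmod ((\<integral>x. iexp (t * (\<Sum>j=1..N. \<xi> j x)) \<partial>P) - exp (- (t\<^sup>2 / 2))) \<le> clt_error t q r"
  proof (rule martingale_char_bound[where s=s])
    fix j assume j: "j \<in> {1..N}"
    show "\<xi> j \<in> borel_measurable P" by (rule tame_borel[OF t\<xi>[OF j]])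
    show "integrable P (\<lambda>x. \<xi> j x ^ 4)" by (rule tame_integrable[OF t\<xi>4[OF j]]) simp
    fix x assume x: "x \<in> space P"
    show "integrable F (\<lambda>u. \<xi> j (x(j := u)) ^ 4)"
      by (rule tame_integrable_upd[OF t\<xi>4[OF j] _ x j]) simp
    show "(\<integral>u. \<xi> j (x(j := u)) \<partial>F) = 0"
      unfolding upd using h_int1[OF coord_in_space[OF x]] h_centered[OF coord_in_space[OF x]]
      by (subst Bochner_Integration.integral_sum) auto
    show "(\<integral>u. (\<xi> j (x(j := u)))\<^sup>2 \<partial>F) = s j x"
    proof -
      have hh: "integrable F (\<lambda>u. h (x i) u * h (x k) u)" if "i \<in> {1..N}" "k \<in> {1..N}" for i k
        by (rule h_h_int[OF coord_in_space[OF x that(1)] coord_in_space[OF x that(2)]])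
      have "(\<integral>u. (\<xi> j (x(j := u)))\<^sup>2 \<partial>F)
          = (\<integral>u. (\<Sum>i=1..N. \<Sum>k=1..N. v i j * v k j * (h (x i) u * h (x k) u)) \<partial>F)"
        unfolding upd power2_eq_square sum_product by (simp add: mult_ac)
      also have "\<dots> = (\<Sum>i=1..N. \<integral>u. (\<Sum>k=1..N. v i j * v k j * (h (x i) u * h (x k) u)) \<partial>F)"
        by (rule Bochner_Integration.integral_sum) (intro Bochner_Integration.integrable_sum integrable_mult_right hh)
      also have "\<dots> = (\<Sum>i=1..N. \<Sum>k=1..N. \<integral>u. v i j * v k j * (h (x i) u * h (x k) u) \<partial>F)"
        by (intro sum.cong refl Bochner_Integration.integral_sum integrable_mult_right hh)
      also have "\<dots> = (\<Sum>i=1..N. \<Sum>k=1..N. v i j * v k j * (\<integral>u. h (x i) u * h (x k) u \<partial>F))"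
        by simp
      finally show ?thesis by (simp add: s_def G_def)
    qed
  next
    fix j l x u assume x: "x \<in> space P" "u \<in> space F" and j: "j \<in> {1..N}" "l \<in> {1..N}" "j < l"
    show "\<xi> j (x(l := u)) = \<xi> j x"
      unfolding \<xi>_J[OF j(1)] using j by (intro sum.cong) auto
  next
    show "(\<Sum>j=1..N. \<integral>x. (\<xi> j x)\<^sup>2 \<partial>P) = 1" using second norm by simp
    have "(\<Sum>j=1..N. \<integral>x. \<xi> j x ^ 4 \<partial>P) \<le> (\<Sum>j=1..N. 3 * M * (\<Sum>i=1..N. (v i j)\<^sup>2))"
      by (intro sum_mono fourth)
    also have "\<dots> = 3 * M" using norm by (simp flip: sum_distrib_left)
    finally show "(\<Sum>j=1..N. \<integral>x. \<xi> j x ^ 4 \<partial>P) \<le> q\<^sup>2" by (simp add: q)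
    show "integrable P (\<lambda>x. ((\<Sum>j=1..N. s j x) - 1)\<^sup>2)" by (rule int2[OF tV])
    show "(\<integral>x. ((\<Sum>j=1..N. s j x) - 1)\<^sup>2 \<partial>P) \<le> r\<^sup>2" using ER by (simp add: r)
  qed (use q r in auto)
  then show ?thesis by (simp add: \<xi>_def q_def r_def M_def mult.assoc)
qed

end

section \<open>The double centered distance as a centered kernel\<close>

lemma edist_measurable[measurable (raw)]:
  assumes f: "f \<in> measurable M (Rvec p)" and g: "g \<in> measurable M (Rvec p)"
  shows "(\<lambda>x. edist p (f x) (g x)) \<in> borel_measurable M"
proof -
  have [measurable]: "(\<lambda>x. f x i) \<in> borel_measurable M" "(\<lambda>x. g x i) \<in> borel_measurable M" if "i < p" for i
    using measurable_compose[OF f[unfolded Rvec_def] measurable_component_singleton, of i]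
      measurable_compose[OF g[unfolded Rvec_def] measurable_component_singleton, of i] that by auto
  show ?thesis unfolding edist_def enorm_def L2_set_def by measurable
qed

lemma enorm_measurable[measurable]: "enorm p \<in> borel_measurable (Rvec p)"
  unfolding enorm_def[abs_def] L2_set_def Rvec_def by measurable

lemma edist_commute: "edist p x y = edist p y x"
  by (simp add: edist_def enorm_def L2_set_def power2_commute)

lemma enorm_nonneg: "0 \<le> enorm p x"
  by (simp add: enorm_def L2_set_nonneg)

lemma edist_nonneg: "0 \<le> edist p x y"
  by (simp add: edist_def enorm_nonneg)

lemma edist_le: "edist p x y \<le> enorm p x + enorm p y"
proof -
  have "edist p x y \<le> L2_set x {..<p} + L2_set (\<lambda>i. - y i) {..<p}"
    using L2_set_triangle_ineq[of x "\<lambda>i. - y i" "{..<p}"] by (simp add: edist_def enorm_def)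
  also have "L2_set (\<lambda>i. - y i) {..<p} = L2_set y {..<p}" by (simp add: L2_set_def)
  finally show ?thesis by (simp add: enorm_def)
qed

text \<open>
  The law F of an observation, with the moment and nondegeneracy conditions on the dcd.
\<close>

locale sampled_law = F: prob_space F for F :: "(nat \<Rightarrow> real) measure" +
  fixes p :: nat
  assumes sets_F[measurable_cong]: "sets F = sets (Rvec p)"
    and norm_int4: "integrable F (\<lambda>x. enorm p x ^ 4)"
    and nondegenerate: "0 < dcd_moment p F 2"
begin

lemma norm_int: "integrable F (enorm p)"
  using F.integrable_lower_powers(2)[OF _ norm_int4, of 1] by simp

lemma edist_int: "integrable F (edist p u)"  if u: "u \<in> space F"
proof (rule Bochner_Integration.integrable_bound)
  show "integrable F (\<lambda>v. enorm p u + enorm p v)" using norm_int by auto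
  show "AE v in F. norm (edist p u v) \<le> norm (enorm p u + enorm p v)"
    using edist_le[of p u] edist_nonneg[of p u] by (intro AE_I2) (simp add: add_nonneg_nonneg enorm_nonneg)
qed (use u sets_eq_imp_space_eq[OF sets_F] in \<open>auto intro!: edist_measurable measurable_ident_sets[OF sets_F]\<close>)

lemma mean_distance: "(\<integral>w. edist p (w 1) (w 2) \<partial>iid_copies F 2) = (\<integral>u. (\<integral>v. edist p u v \<partial>F) \<partial>F)"
proof -
  interpret I: iid_coordinates F 2 ..
  have n1: "integrable I.P (\<lambda>w. enorm p (w i))" if "i \<in> {1..2}" for i
    using norm_int I.integrable_coord[OF that, of "enorm p"] by simp
  have "integrable I.P (\<lambda>w. edist p (w 1) (w 2))"
  proof (rule Bochner_Integration.integrable_bound)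
    show "integrable I.P (\<lambda>w. enorm p (w 1) + enorm p (w 2))" using n1 by auto
    show "AE w in I.P. norm (edist p (w 1) (w 2)) \<le> norm (enorm p (w 1) + enorm p (w 2))"
      using edist_le[of p] edist_nonneg[of p] by (intro AE_I2) (simp add: add_nonneg_nonneg enorm_nonneg)
  qed measurable
  then show ?thesis
    unfolding iid_copies_def by (intro I.integral_two_coords) auto
qed

lemma dcd_eq:
  "dcd p F x y = edist p x y - (\<integral>v. edist p x v \<partial>F) - (\<integral>v. edist p y v \<partial>F) + (\<integral>u. (\<integral>v. edist p u v \<partial>F) \<partial>F)"
  unfolding dcd_def mean_distance by (simp add: edist_commute[of p _ y])

lemma mean_edist_int: "integrable F (\<lambda>u. \<integral>v. edist p u v \<partial>F)"
proof (rule Bochner_Integration.integrable_bound)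
  show "integrable F (\<lambda>u. enorm p u + (\<integral>v. enorm p v \<partial>F))" using norm_int by auto
  show "AE u in F. norm (\<integral>v. edist p u v \<partial>F) \<le> norm (enorm p u + (\<integral>v. enorm p v \<partial>F))"
  proof (rule AE_I2)
    fix u assume u: "u \<in> space F"
    have "(\<integral>v. edist p u v \<partial>F) \<le> (\<integral>v. enorm p u + enorm p v \<partial>F)"
      using norm_int edist_int[OF u] edist_le by (intro integral_mono) auto
    moreover have "0 \<le> (\<integral>v. edist p u v \<partial>F)"
      by (intro Bochner_Integration.integral_nonneg edist_nonneg)
    ultimately show "norm (\<integral>v. edist p u v \<partial>F) \<le> norm (enorm p u + (\<integral>v. enorm p v \<partial>F))"
      using norm_int by (simp add: F.prob_space)
  qed
qed measurable

lemma dcd_bound: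
  assumes x: "x \<in> space F" "y \<in> space F"
  shows "\<bar>dcd p F x y\<bar> \<le> (2 * enorm p x + 2 * (\<integral>v. enorm p v \<partial>F)) + (2 * enorm p y + 2 * (\<integral>v. enorm p v \<partial>F))"
proof -
  let ?m = "\<integral>v. enorm p v \<partial>F"
  have A: "0 \<le> (\<integral>v. edist p x v \<partial>F)" "(\<integral>v. edist p x v \<partial>F) \<le> enorm p x + ?m" if "x \<in> space F" for x
  proof -
    have "(\<integral>v. edist p x v \<partial>F) \<le> (\<integral>v. enorm p x + enorm p v \<partial>F)"
      using norm_int edist_int[OF that] edist_le by (intro integral_mono) auto
    then show "(\<integral>v. edist p x v \<partial>F) \<le> enorm p x + ?m" using norm_int by (simp add: F.prob_space)
    show "0 \<le> (\<integral>v. edist p x v \<partial>F)"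
      by (intro Bochner_Integration.integral_nonneg edist_nonneg)
  qed
  have B: "0 \<le> (\<integral>u. (\<integral>v. edist p u v \<partial>F) \<partial>F)"
    by (intro Bochner_Integration.integral_nonneg edist_nonneg)
  have "(\<integral>u. (\<integral>v. edist p u v \<partial>F) \<partial>F) \<le> (\<integral>u. enorm p u + ?m \<partial>F)"
    using norm_int mean_edist_int A by (intro integral_mono) auto
  also have "\<dots> = 2 * ?m" using norm_int by (simp add: F.prob_space)
  finally show ?thesis
    using A[OF x(1)] A[OF x(2)] B edist_le[of p x y] edist_nonneg[of p x y] enorm_nonneg[of p x] enorm_nonneg[of p y]
    unfolding dcd_eq by linarith
qed

lemma dcd_centered:
  assumes "x \<in> space F"
  shows "(\<integral>y. dcd p F x y \<partial>F) = 0"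
  unfolding dcd_eq using edist_int[OF assms] mean_edist_int by (simp add: F.prob_space)

text \<open>
  Scaled to second moment 1.
\<close>

definition unit_dcd :: "(nat \<Rightarrow> real) \<Rightarrow> (nat \<Rightarrow> real) \<Rightarrow> real" where
  "unit_dcd x y = dcd p F x y / sqrt (dcd_moment p F 2)"

definition unit_dcd_bound :: "(nat \<Rightarrow> real) \<Rightarrow> real" where
  "unit_dcd_bound x = 1 + (2 * enorm p x + 2 * (\<integral>v. enorm p v \<partial>F)) / sqrt (dcd_moment p F 2)"

lemma centered_kernel: "centered_kernel F unit_dcd unit_dcd_bound"
proof unfold_locales
  note D = nondegenerate
  show "(\<lambda>(u, v). unit_dcd u v) \<in> borel_measurable (F \<Otimes>\<^sub>M F)"
    unfolding unit_dcd_def dcd_eq case_prod_beta by measurable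
  show "unit_dcd u v = unit_dcd v u" for u v
    unfolding unit_dcd_def dcd_eq using edist_commute[of p u v] by simp
  show "\<bar>unit_dcd u v\<bar> \<le> unit_dcd_bound u + unit_dcd_bound v" if uv: "u \<in> space F" "v \<in> space F" for u v
  proof -
    have "\<bar>unit_dcd u v\<bar> = \<bar>dcd p F u v\<bar> / sqrt (dcd_moment p F 2)" using D by (simp add: unit_dcd_def)
    also have "\<dots> \<le> ((2 * enorm p u + 2 * (\<integral>v. enorm p v \<partial>F)) + (2 * enorm p v + 2 * (\<integral>v. enorm p v \<partial>F))) / sqrt (dcd_moment p F 2)"
      using D by (intro divide_right_mono dcd_bound uv) auto
    also have "\<dots> \<le> unit_dcd_bound u + unit_dcd_bound v" by (simp add: unit_dcd_bound_def add_divide_distrib)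
    finally show ?thesis .
  qed
  show "(\<integral>v. unit_dcd u v \<partial>F) = 0" if "u \<in> space F" for u
    unfolding unit_dcd_def using dcd_centered[OF that] by simp
  show [measurable]: "unit_dcd_bound \<in> borel_measurable F"
    unfolding unit_dcd_bound_def[abs_def] by measurable
  show "1 \<le> unit_dcd_bound u" for u
    unfolding unit_dcd_bound_def using D by (auto intro!: divide_nonneg_nonneg add_nonneg_nonneg enorm_nonneg Bochner_Integration.integral_nonneg)
  show "integrable F (\<lambda>u. unit_dcd_bound u ^ 4)"
  proof -
    define m where "m = 1 + 2 * (\<integral>v. enorm p v \<partial>F) / sqrt (dcd_moment p F 2)"
    have eq: "unit_dcd_bound u = m + 2 / sqrt (dcd_moment p F 2) * enorm p u" for u
      by (simp add: unit_dcd_bound_def m_def add_divide_distrib)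
    show ?thesis unfolding eq
      by (rule F.integrable_fourth_power_add) (auto simp: power_mult_distrib power_divide norm_int4)
  qed
qed

lemma moment_unit_dcd:
  assumes "r \<le> 4"
  shows "centered_kernel.moment F unit_dcd r = dcd_moment p F r / sqrt (dcd_moment p F 2) ^ r"
proof -
  interpret centered_kernel F 2 unit_dcd unit_dcd_bound by (rule centered_kernel)
  show ?thesis
    using integral_h_power[of 1 2 r] assms
    by (simp add: unit_dcd_def power_divide dcd_moment_def iid_copies_def)
qed

lemma moment_unit_dcd_2: "centered_kernel.moment F unit_dcd 2 = 1"
  using moment_unit_dcd[of 2] nondegenerate by simp

lemma moment_unit_dcd_4: "centered_kernel.moment F unit_dcd 4 = dcd_moment p F 4 / (dcd_moment p F 2)\<^sup>2"
proof -
  have "sqrt (dcd_moment p F 2) ^ 4 = (sqrt (dcd_moment p F 2) ^ 2) ^ 2" by (simp flip: power_mult)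
  then show ?thesis using moment_unit_dcd[of 4] nondegenerate by simp
qed

lemma cycle_unit_dcd: "centered_kernel.cycle F unit_dcd = dcd_cycle p F / (dcd_moment p F 2)\<^sup>2"
proof -
  interpret centered_kernel F 4 unit_dcd unit_dcd_bound by (rule centered_kernel)
  have s: "s * s * s * s = (s\<^sup>2)\<^sup>2" for s :: real by (simp add: power2_eq_square)
  have "cycle = dcd_cycle p F / ((sqrt (dcd_moment p F 2))\<^sup>2)\<^sup>2"
    using integral_four_cycle[of 1 2 3 4]
    unfolding unit_dcd_def dcd_cycle_def iid_copies_def times_divide_times_eq s by simp
  then show ?thesis using nondegenerate by simp
qed

end

section \<open>The Gini covariance as a quadratic form for fixed labels\<close>

definition pairs :: "nat set \<Rightarrow> (nat \<times> nat) set" where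
  "pairs I = {(i, j). i \<in> I \<and> j \<in> I \<and> i < j}"

lemma finite_pairs: "finite I \<Longrightarrow> finite (pairs I)"
  by (rule finite_subset[of _ "I \<times> I"]) (auto simp: pairs_def)

lemma real_choose_two: "real (m choose 2) = real m * (real m - 1) / 2"
proof -
  have "even (m * (m - 1))" by (cases "even m") auto
  then have "2 * (m choose 2) = m * (m - 1)" unfolding choose_two by (rule dvd_mult_div_cancel)
  then have "2 * real (m choose 2) = real m * real (m - 1)" by (metis of_nat_mult of_nat_numeral)
  then show ?thesis by (cases m) auto
qed

lemma card_pairs:
  assumes "finite I"
  shows "card (pairs I) = card I choose 2"
  using assms
proof (induction I rule: finite_linorder_max_induct)
  case empty
  show ?case by (simp add: pairs_def)
next
  case (insert b A)
  have eq: "pairs (insert b A) = pairs A \<union> (\<lambda>a. (a, b)) ` A"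
    using insert.hyps by (auto simp: pairs_def)
  have "card (pairs (insert b A)) = card (pairs A) + card ((\<lambda>a. (a, b)) ` A)"
    unfolding eq using insert.hyps by (intro card_Un_disjoint finite_pairs) (auto simp: pairs_def)
  also have "card ((\<lambda>a. (a, b)) ` A) = card A" by (rule card_image) (auto simp: inj_on_def)
  moreover have "b \<notin> A" using insert.hyps by auto
  ultimately show ?case using insert by (simp add: numeral_2_eq_2)
qed

text \<open>
  Each index i occurs once as the smaller and once as the larger member of its pairs.
\<close>

lemma sum_pairs_additive:
  fixes w :: "nat \<Rightarrow> nat \<Rightarrow> real"
  assumes fin: "finite I" and sym: "\<And>i j. w i j = w j i"
  shows "(\<Sum>(i, j)\<in>pairs I. w i j * (\<alpha> i + \<alpha> j)) = (\<Sum>i\<in>I. \<alpha> i * (\<Sum>j\<in>I - {i}. w i j))"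
proof -
  have "(\<Sum>(i, j)\<in>pairs I. w i j * (\<alpha> i + \<alpha> j))
      = (\<Sum>(i, j)\<in>pairs I. w i j * \<alpha> i) + (\<Sum>(i, j)\<in>pairs I. w j i * \<alpha> j)"
    unfolding sum.distrib[symmetric] using sym by (intro sum.cong refl) (auto simp: algebra_simps)
  also have "(\<Sum>(i, j)\<in>pairs I. w j i * \<alpha> j) = (\<Sum>(i, j)\<in>prod.swap ` pairs I. w i j * \<alpha> i)"
    by (subst sum.reindex) (auto simp: case_prod_beta)
  also have "(\<Sum>(i, j)\<in>pairs I. w i j * \<alpha> i) + (\<Sum>(i, j)\<in>prod.swap ` pairs I. w i j * \<alpha> i)
      = (\<Sum>(i, j)\<in>pairs I \<union> prod.swap ` pairs I. w i j * \<alpha> i)"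
    using fin by (intro sum.union_disjoint[symmetric] finite_imageI finite_pairs) (auto simp: pairs_def)
  also have "pairs I \<union> prod.swap ` pairs I = (SIGMA i:I. I - {i})"
    by (simp add: set_eq_iff pair_in_swap_image) (auto simp: pairs_def)
  also have "(\<Sum>(i, j)\<in>(SIGMA i:I. I - {i}). w i j * \<alpha> i) = (\<Sum>i\<in>I. \<Sum>j\<in>I - {i}. w i j * \<alpha> i)"
    using fin by (intro sum.Sigma[symmetric]) auto
  finally show ?thesis by (simp add: sum_distrib_left mult.commute)
qed

locale labelled_sample =
  fixes K :: nat and L :: "nat \<Rightarrow> 'c" and n :: nat and y :: "nat \<Rightarrow> 'c"
  assumes K: "2 \<le> K"
    and L: "inj_on L {1..K}"
    and labels: "i \<in> {1..n} \<Longrightarrow> y i \<in> L ` {1..K}"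
    and sizes: "k \<in> {1..K} \<Longrightarrow> 2 \<le> class_size n y (L k)"
begin

text \<open>
  The coefficient that a pair of observations of class l receives from the class terms that gCov
  subtracts.
\<close>

definition class_weight :: "'c \<Rightarrow> real" where
  "class_weight l = real (class_size n y l) / real n / real (class_size n y l choose 2)"

definition weight :: "nat \<Rightarrow> nat \<Rightarrow> real" where
  "weight i j = 1 / real (n choose 2) - (if y i = y j then class_weight (y i) else 0)"

lemma weight_sym: "weight i j = weight j i"
  by (simp add: weight_def)

lemma class_set_disjoint:
  "k \<in> {1..K} \<Longrightarrow> k' \<in> {1..K} \<Longrightarrow> k \<noteq> k' \<Longrightarrow> class_set n y (L k) \<inter> class_set n y (L k') = {}"
  using inj_onD[OF L, of k k'] by (fastforce simp: class_set_def)

lemma finite_class_set: "finite (class_set n y l)"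
  by (simp add: class_set_def)

lemma sum_class_sizes: "(\<Sum>k=1..K. class_size n y (L k)) = n"
proof -
  have "(\<Sum>k=1..K. class_size n y (L k)) = card (\<Union>k\<in>{1..K}. class_set n y (L k))"
    unfolding class_size_def using class_set_disjoint finite_class_set
    by (intro card_UN_disjoint[symmetric]) auto
  also have "(\<Union>k\<in>{1..K}. class_set n y (L k)) = {1..n}"
    using labels by (fastforce simp: class_set_def)
  finally show ?thesis by simp
qed

lemma n_ge_4: "4 \<le> n"
proof -
  have "2 * K \<le> (\<Sum>k=1..K. class_size n y (L k))"
    using sum_mono[of "{1..K}" "\<lambda>_. 2" "\<lambda>k. class_size n y (L k)"] sizes by simp
  then show ?thesis using sum_class_sizes K by simp
qed

lemma sum_over_classes:
  fixes f :: "'c \<Rightarrow> nat \<times> nat \<Rightarrow> real"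
  shows "(\<Sum>k=1..K. \<Sum>e\<in>pairs (class_set n y (L k)). f (L k) e)
    = (\<Sum>(i, j)\<in>pairs {1..n}. if y i = y j then f (y i) (i, j) else 0)"
proof -
  have "(\<Sum>k=1..K. \<Sum>e\<in>pairs (class_set n y (L k)). f (L k) e)
      = (\<Sum>k=1..K. \<Sum>e\<in>pairs (class_set n y (L k)). f (y (fst e)) e)"
    by (intro sum.cong refl) (auto simp: pairs_def class_set_def)
  also have "\<dots> = (\<Sum>e\<in>(\<Union>k\<in>{1..K}. pairs (class_set n y (L k))). f (y (fst e)) e)"
  proof (rule sum.UNION_disjoint[symmetric])
    show "\<forall>i\<in>{1..K}. \<forall>j\<in>{1..K}. i \<noteq> j \<longrightarrow> pairs (class_set n y (L i)) \<inter> pairs (class_set n y (L j)) = {}"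
      using class_set_disjoint by (fastforce simp: pairs_def)
  qed (simp_all add: finite_pairs finite_class_set)
  also have "(\<Union>k\<in>{1..K}. pairs (class_set n y (L k))) = {e \<in> pairs {1..n}. y (fst e) = y (snd e)}"
    using labels by (fastforce simp: pairs_def class_set_def)
  also have "(\<Sum>e\<in>\<dots>. f (y (fst e)) e) = (\<Sum>e\<in>pairs {1..n}. if y (fst e) = y (snd e) then f (y (fst e)) e else 0)"
    by (rule sum.inter_filter) (simp add: finite_pairs)
  finally show ?thesis by (simp add: case_prod_beta cong: if_cong)
qed

lemma gCov_eq_weighted_sum:
  "gCov K L p n x y = (\<Sum>(i, j)\<in>pairs {1..n}. weight i j * edist p (x i) (x j))"
proof -
  have U: "U_stat p x I = (\<Sum>(i, j)\<in>pairs I. edist p (x i) (x j)) / real (card I choose 2)" for I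
    by (simp add: U_stat_def pairs_def)
  have "(\<Sum>k=1..K. real (class_size n y (L k)) / real n * U_stat p x (class_set n y (L k)))
      = (\<Sum>k=1..K. \<Sum>e\<in>pairs (class_set n y (L k)). class_weight (L k) * (case e of (i, j) \<Rightarrow> edist p (x i) (x j)))"
    unfolding U sum_distrib_left[symmetric]
    by (intro sum.cong refl) (simp add: class_weight_def class_size_def)
  also have "\<dots> = (\<Sum>(i, j)\<in>pairs {1..n}. if y i = y j then class_weight (y i) * edist p (x i) (x j) else 0)"
    by (subst sum_over_classes) (auto intro!: sum.cong)
  finally show ?thesis
    unfolding gCov_def U
    by (simp add: sum_divide_distrib case_prod_beta flip: sum_subtractf)
       (auto intro!: sum.cong simp: weight_def left_diff_distrib)
qed

lemma class_weight_eq: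
  assumes "k \<in> {1..K}"
  shows "class_weight (L k) = 2 / (real n * (real (class_size n y (L k)) - 1))"
proof -
  have "class_size n y (L k) \<ge> 2" by (rule sizes[OF assms])
  then show ?thesis unfolding class_weight_def real_choose_two by simp
qed

text \<open>
  The two parts of the weight contribute 2 / n and -2 / n: the whole sample through n - 1 pairs of weight
  2 / (n (n - 1)), the class of i, of size m, through m - 1 pairs of weight -2 / (n (m - 1)).
\<close>

lemma weight_row_sum:
  assumes i: "i \<in> {1..n}"
  shows "(\<Sum>j\<in>{1..n} - {i}. weight i j) = 0"
proof -
  obtain k where k: "k \<in> {1..K}" "y i = L k" using labels[OF i] by auto
  have "(\<Sum>j\<in>{1..n} - {i}. if y i = y j then class_weight (y i) else 0)
      = (\<Sum>j\<in>{j \<in> {1..n} - {i}. y i = y j}. class_weight (y i))"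
    by (rule sum.inter_filter[symmetric]) simp
  also have "{j \<in> {1..n} - {i}. y i = y j} = class_set n y (L k) - {i}"
    using k by (auto simp: class_set_def)
  also have "(\<Sum>j\<in>class_set n y (L k) - {i}. class_weight (y i)) = real (class_size n y (L k) - 1) * class_weight (L k)"
    using i k by (simp add: class_size_def card_Diff_singleton class_set_def)
  also have "\<dots> = 2 / real n"
    using sizes[OF k(1)] n_ge_4 unfolding class_weight_eq[OF k(1)] by (simp add: of_nat_diff field_simps)
  finally have c: "(\<Sum>j\<in>{1..n} - {i}. if y i = y j then class_weight (y i) else 0) = 2 / real n" .
  have "(\<Sum>j\<in>{1..n} - {i}. 1 / real (n choose 2)) = 2 / real n"
    using i n_ge_4 unfolding real_choose_two by (simp add: card_Diff_singleton of_nat_diff field_simps)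
  then show ?thesis unfolding weight_def sum_subtractf c by simp
qed

text \<open>
  The additive part a u + a v contributes the row sums of the weights, which vanish.
\<close>

lemma gCov_eq_centered:
  assumes g: "\<And>u v. g u v = edist p u v - (a u + a v)"
  shows "gCov K L p n x y = (\<Sum>(i, j)\<in>pairs {1..n}. weight i j * g (x i) (x j))"
proof -
  have "(\<Sum>(i, j)\<in>pairs {1..n}. weight i j * (a (x i) + a (x j))) = 0"
    by (subst sum_pairs_additive) (auto simp: weight_sym weight_row_sum)
  moreover have "(\<Sum>(i, j)\<in>pairs {1..n}. weight i j * g (x i) (x j))
      = (\<Sum>(i, j)\<in>pairs {1..n}. weight i j * edist p (x i) (x j))
        - (\<Sum>(i, j)\<in>pairs {1..n}. weight i j * (a (x i) + a (x j)))"
    unfolding g by (simp add: case_prod_beta right_diff_distrib flip: sum_subtractf)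
  ultimately show ?thesis by (simp add: gCov_eq_weighted_sum)
qed

text \<open>
  In the expanded square the mixed term is -2 times the reciprocal of n choose 2, since the class
  proportions add up to 1; the pure term of the whole sample gives it back once.
\<close>

lemma sum_weight_squares:
  "(\<Sum>(i, j)\<in>pairs {1..n}. (weight i j)\<^sup>2) * D = sigma0_sq K n (\<lambda>k. class_size n y (L k)) D"
proof -
  let ?A = "1 / real (n choose 2)"
  have cnt: "(\<Sum>e\<in>pairs (class_set n y l). c) = real (class_size n y l choose 2) * c" for l and c :: real
    by (simp add: card_pairs finite_class_set class_size_def)
  have pos: "0 < real (n choose 2)" "\<And>k. k \<in> {1..K} \<Longrightarrow> 0 < real (class_size n y (L k) choose 2)"
    using n_ge_4 sizes by (auto simp: zero_less_binomial)
  have one: "(\<Sum>k=1..K. real (class_size n y (L k)) / real n) = 1"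
    using sum_class_sizes n_ge_4 by (simp flip: sum_divide_distrib of_nat_sum)
  have "(\<Sum>(i, j)\<in>pairs {1..n}. (weight i j)\<^sup>2)
      = (\<Sum>(i, j)\<in>pairs {1..n}. ?A\<^sup>2 + (if y i = y j then (class_weight (y i))\<^sup>2 - 2 * ?A * class_weight (y i) else 0))"
    by (intro sum.cong refl) (auto simp: weight_def power2_diff)
  also have "\<dots> = real (n choose 2) * ?A\<^sup>2
      + (\<Sum>(i, j)\<in>pairs {1..n}. if y i = y j then (class_weight (y i))\<^sup>2 - 2 * ?A * class_weight (y i) else 0)"
    by (simp add: case_prod_beta sum.distrib card_pairs)
  also have "(\<Sum>(i, j)\<in>pairs {1..n}. if y i = y j then (class_weight (y i))\<^sup>2 - 2 * ?A * class_weight (y i) else 0)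
      = (\<Sum>k=1..K. real (class_size n y (L k) choose 2) * ((class_weight (L k))\<^sup>2 - 2 * ?A * class_weight (L k)))"
    by (subst sum_over_classes[symmetric]) (simp only: cnt)
  also have "\<dots> = (\<Sum>k=1..K. (real (class_size n y (L k)) / real n)\<^sup>2 * inverse (real (class_size n y (L k) choose 2))
      - 2 * ?A * (real (class_size n y (L k)) / real n))"
  proof (rule sum.cong[OF refl])
    fix k assume "k \<in> {1..K}"
    then have "real (class_size n y (L k) choose 2) \<noteq> 0" using pos(2) by force
    then have "real (class_size n y (L k) choose 2) * ((a / real (class_size n y (L k) choose 2))\<^sup>2
        - 2 * ?A * (a / real (class_size n y (L k) choose 2)))
      = a\<^sup>2 * inverse (real (class_size n y (L k) choose 2)) - 2 * ?A * a" for a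
      by (simp add: field_simps power2_eq_square)
    then show "real (class_size n y (L k) choose 2) * ((class_weight (L k))\<^sup>2 - 2 * ?A * class_weight (L k))
      = (real (class_size n y (L k)) / real n)\<^sup>2 * inverse (real (class_size n y (L k) choose 2))
        - 2 * ?A * (real (class_size n y (L k)) / real n)"
      unfolding class_weight_def .
  qed
  also have "\<dots> = (\<Sum>k=1..K. (real (class_size n y (L k)) / real n)\<^sup>2 * inverse (real (class_size n y (L k) choose 2))) - 2 * ?A"
    unfolding sum_subtractf sum_distrib_left[symmetric] one by simp
  also have "real (n choose 2) * ?A\<^sup>2 = ?A" using pos by (simp add: power2_eq_square)
  finally show ?thesis by (simp add: sigma0_sq_def inverse_eq_divide)
qed

text \<open>
  Each class contributes more than 2 / n^2, so two classes give more than 4 / n^2, and the subtracted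
  reciprocal of n choose 2 is at most 3 / n^2 for n at least 4.
\<close>

lemma sum_weight_squares_ge: "1 / (real n)\<^sup>2 \<le> (\<Sum>(i, j)\<in>pairs {1..n}. (weight i j)\<^sup>2)"
proof -
  have n: "4 \<le> real n" using n_ge_4 by simp
  have "(\<Sum>k=1..K. 2 / (real n)\<^sup>2) \<le> (\<Sum>k=1..K. (real (class_size n y (L k)) / real n)\<^sup>2 * inverse (real (class_size n y (L k) choose 2)))"
  proof (rule sum_mono)
    fix k assume k: "k \<in> {1..K}"
    define m where "m = real (class_size n y (L k))"
    have m: "2 \<le> m" using sizes[OF k] by (simp add: m_def)
    have "2 / (real n)\<^sup>2 \<le> 2 * (m / (m - 1)) / (real n)\<^sup>2"
    proof (rule divide_right_mono)
      have "1 \<le> m / (m - 1)" using m by (simp add: le_divide_eq)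
      then show "2 \<le> 2 * (m / (m - 1))" by linarith
    qed simp
    also have "\<dots> = (m / real n)\<^sup>2 * inverse (m * (m - 1) / 2)"
      using m n by (simp add: field_simps power2_eq_square)
    finally show "2 / (real n)\<^sup>2 \<le> (real (class_size n y (L k)) / real n)\<^sup>2 * inverse (real (class_size n y (L k) choose 2))"
      by (simp add: real_choose_two m_def)
  qed
  moreover have "(\<Sum>k=1..K. 2 / (real n)\<^sup>2) \<ge> 4 / (real n)\<^sup>2"
    using K by (simp add: divide_right_mono)
  moreover have "inverse (real (n choose 2)) \<le> 3 / (real n)\<^sup>2"
    using n unfolding real_choose_two by (simp add: field_simps power2_eq_square)
  ultimately have "4 / (real n)\<^sup>2 - 3 / (real n)\<^sup>2 \<le> sigma0_sq K n (\<lambda>k. class_size n y (L k)) 1"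
    unfolding sigma0_sq_def mult_1_right by linarith
  then show ?thesis using sum_weight_squares[of 1] by simp
qed

lemma weight_bound:
  assumes \<delta>: "0 < \<delta>" "\<delta> \<le> 1" "\<And>k. k \<in> {1..K} \<Longrightarrow> \<delta> * real n \<le> real (class_size n y (L k))"
    and i: "i \<in> {1..n}"
  shows "\<bar>weight i j\<bar> \<le> 4 / \<delta> / (real n)\<^sup>2"
proof -
  have n: "4 \<le> real n" using n_ge_4 by simp
  have *: "2 / (real n * (m - 1)) \<le> 4 / \<delta> / (real n)\<^sup>2" "0 \<le> 2 / (real n * (m - 1))"
    if m: "2 \<le> m" "\<delta> * real n \<le> m" for m
  proof -
    have "\<delta> * (real n * real n) \<le> real n * m" using m(2) n by (simp add: mult.left_commute)
    also have "\<dots> \<le> real n * (2 * (m - 1))" using m n by (intro mult_left_mono) auto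
    finally have le: "\<delta> * (real n)\<^sup>2 \<le> 2 * (real n * (m - 1))" by (simp add: power2_eq_square algebra_simps)
    have "2 / (real n * (m - 1)) = 4 / (2 * (real n * (m - 1)))" by simp
    also have "\<dots> \<le> 4 / (\<delta> * (real n)\<^sup>2)"
      using le \<delta>(1) n m by (intro divide_left_mono) auto
    finally show "2 / (real n * (m - 1)) \<le> 4 / \<delta> / (real n)\<^sup>2" by simp
    show "0 \<le> 2 / (real n * (m - 1))" using m n by simp
  qed
  have "\<delta> * real n \<le> real n" using \<delta>(2) n by simp
  then have A: "1 / real (n choose 2) \<le> 4 / \<delta> / (real n)\<^sup>2" "0 \<le> 1 / real (n choose 2)"
    using *[of "real n"] n unfolding real_choose_two by auto
  obtain k where k: "k \<in> {1..K}" "y i = L k" using labels[OF i] by auto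
  have "class_weight (y i) \<le> 4 / \<delta> / (real n)\<^sup>2" "0 \<le> class_weight (y i)"
    unfolding k(2) class_weight_eq[OF k(1)] using *[OF _ \<delta>(3)[OF k(1)]] sizes[OF k(1)] by auto
  then have "0 \<le> (if y i = y j then class_weight (y i) else 0)"
    "(if y i = y j then class_weight (y i) else 0) \<le> 4 / \<delta> / (real n)\<^sup>2"
    using \<delta>(1) by auto
  then show ?thesis using A unfolding weight_def by linarith
qed

end

section \<open>Conditioning on the labels\<close>

lemma sum_pairs_square:
  fixes f :: "nat \<Rightarrow> nat \<Rightarrow> real"
  shows "(\<Sum>(i, j)\<in>pairs {1..n}. f i j) = (\<Sum>j=1..n. \<Sum>i=1..n. if i < j then f i j else 0)"
proof -
  have "pairs {1..n} = {e \<in> {1..n} \<times> {1..n}. fst e < snd e}" by (auto simp: pairs_def)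
  then have "(\<Sum>(i, j)\<in>pairs {1..n}. f i j)
      = (\<Sum>e\<in>{1..n} \<times> {1..n}. if fst e < snd e then f (fst e) (snd e) else 0)"
    by (simp add: case_prod_beta sum.inter_filter)
  also have "\<dots> = (\<Sum>i=1..n. \<Sum>j=1..n. if i < j then f i j else 0)"
    by (simp add: sum.cartesian_product case_prod_beta cong: if_cong)
  also have "\<dots> = (\<Sum>j=1..n. \<Sum>i=1..n. if i < j then f i j else 0)" by (rule sum.swap)
  finally show ?thesis .
qed

context sampled_law
begin

lemma gCov_eq_dcd_sum:
  assumes "labelled_sample K L n y"
  shows "gCov K L p n x y = (\<Sum>(i, j)\<in>pairs {1..n}. labelled_sample.weight n y i j * dcd p F (x i) (x j))"
proof -
  interpret S: labelled_sample K L n y by fact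
  show ?thesis
    by (rule S.gCov_eq_centered[where a="\<lambda>u. (\<integral>v. edist p u v \<partial>F) - (\<integral>u. (\<integral>v. edist p u v \<partial>F) \<partial>F) / 2"])
       (simp add: dcd_eq)
qed

lemma gCov_mean_and_variance_given_labels:
  assumes "labelled_sample K L n y"
  shows "integrable (PiM {1..n} (\<lambda>_. F)) (\<lambda>x. gCov K L p n x y)"
    and "(\<integral>x. gCov K L p n x y \<partial>PiM {1..n} (\<lambda>_. F)) = 0"
    and "integrable (PiM {1..n} (\<lambda>_. F)) (\<lambda>x. (gCov K L p n x y)\<^sup>2)"
    and "(\<integral>x. (gCov K L p n x y)\<^sup>2 \<partial>PiM {1..n} (\<lambda>_. F))
      = sigma0_sq K n (\<lambda>k. class_size n y (L k)) (dcd_moment p F 2)"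
proof -
  interpret S: labelled_sample K L n y by fact
  interpret centered_kernel F n unit_dcd unit_dcd_bound by (rule centered_kernel)
  let ?s = "sqrt (dcd_moment p F 2)"
  have eq: "gCov K L p n x y = (\<Sum>(i, j)\<in>pairs {1..n}. (?s * S.weight i j) * unit_dcd (x i) (x j))" for x
    unfolding gCov_eq_dcd_sum[OF assms] unit_dcd_def using nondegenerate by simp
  have T: "pairs {1..n} \<subseteq> {1..n} \<times> {1..n}" "\<And>i k. (i, k) \<in> pairs {1..n} \<Longrightarrow> i \<noteq> k \<and> (k, i) \<notin> pairs {1..n}"
    by (auto simp: pairs_def)
  note q = quadratic_form_mean_and_variance[OF T, where c="\<lambda>i j. ?s * S.weight i j"]
  show "integrable P (\<lambda>x. gCov K L p n x y)" "(\<integral>x. gCov K L p n x y \<partial>P) = 0"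
    "integrable P (\<lambda>x. (gCov K L p n x y)\<^sup>2)"
    unfolding eq by (rule q; assumption)+
  have "(\<integral>x. (gCov K L p n x y)\<^sup>2 \<partial>P) = (\<Sum>(i, j)\<in>pairs {1..n}. (?s * S.weight i j)\<^sup>2) * moment 2"
    unfolding eq by (rule q(4))
  also have "\<dots> = (\<Sum>(i, j)\<in>pairs {1..n}. (S.weight i j)\<^sup>2) * dcd_moment p F 2"
    using nondegenerate by (simp add: moment_unit_dcd_2 power_mult_distrib sum_distrib_left case_prod_beta mult.commute)
  finally show "(\<integral>x. (gCov K L p n x y)\<^sup>2 \<partial>P) = sigma0_sq K n (\<lambda>k. class_size n y (L k)) (dcd_moment p F 2)"
    by (simp add: S.sum_weight_squares)
qed

text \<open>
  The weights are at most 4 / (\<delta> n^2) and their sum of squares is at least 1 / n^2, so after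
  normalization they are at most \<beta> / n with \<beta> = 4 / \<delta>.
\<close>

theorem gCov_char_bound_given_labels:
  assumes "labelled_sample K L n y"
    and \<delta>: "0 < \<delta>" "\<delta> \<le> 1" "\<And>k. k \<in> {1..K} \<Longrightarrow> \<delta> * real n \<le> real (class_size n y (L k))"
  shows "cmod ((\<integral>x. iexp (t * (gCov K L p n x y
        / sqrt (sigma0_sq K n (\<lambda>k. class_size n y (L k)) (dcd_moment p F 2)))) \<partial>PiM {1..n} (\<lambda>_. F))
      - exp (- (t\<^sup>2 / 2)))
    \<le> clt_error t (sqrt (3 * (4 / \<delta>)\<^sup>2 * (dcd_moment p F 4 / (real n * (dcd_moment p F 2)\<^sup>2))))
        (sqrt (3 * (4 / \<delta>)\<^sup>2 * (dcd_moment p F 4 / (real n * (dcd_moment p F 2)\<^sup>2))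
          + 6 * (4 / \<delta>) ^ 4 * (dcd_cycle p F / (dcd_moment p F 2)\<^sup>2)))"
proof -
  interpret S: labelled_sample K L n y by fact
  interpret centered_kernel F n unit_dcd unit_dcd_bound by (rule centered_kernel)
  define W where "W = (\<Sum>(i, j)\<in>pairs {1..n}. (S.weight i j)\<^sup>2)"
  define v where "v i j = (if i < j then S.weight i j / sqrt W else 0)" for i j
  have n: "0 < real n" using S.n_ge_4 by simp
  have W1: "1 / (real n)\<^sup>2 \<le> W" unfolding W_def by (rule S.sum_weight_squares_ge)
  moreover have "0 < 1 / (real n)\<^sup>2" using n by simp
  ultimately have W0: "0 < W" by linarith
  have "1 / real n = sqrt (1 / (real n)\<^sup>2)" using n by (simp add: real_sqrt_divide)
  also have "\<dots> \<le> sqrt W" using W1 by (rule real_sqrt_le_mono)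
  finally have sW: "1 / real n \<le> sqrt W" .
  have sig: "sqrt (sigma0_sq K n (\<lambda>k. class_size n y (L k)) (dcd_moment p F 2)) = sqrt W * sqrt (dcd_moment p F 2)"
    unfolding S.sum_weight_squares[symmetric] W_def by (rule real_sqrt_mult)
  have stat: "gCov K L p n x y / sqrt (sigma0_sq K n (\<lambda>k. class_size n y (L k)) (dcd_moment p F 2))
      = (\<Sum>j=1..n. \<Sum>i=1..n. v i j * unit_dcd (x i) (x j))" for x
  proof -
    have "gCov K L p n x y / (sqrt W * sqrt (dcd_moment p F 2))
        = (\<Sum>(i, j)\<in>pairs {1..n}. S.weight i j / sqrt W * unit_dcd (x i) (x j))"
      unfolding gCov_eq_dcd_sum[OF assms(1)] unit_dcd_def by (simp add: sum_divide_distrib case_prod_beta)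
    also have "\<dots> = (\<Sum>j=1..n. \<Sum>i=1..n. v i j * unit_dcd (x i) (x j))"
      unfolding sum_pairs_square by (intro sum.cong refl) (simp add: v_def)
    finally show ?thesis by (simp add: sig)
  qed
  have "cmod ((\<integral>x. iexp (t * (\<Sum>j=1..n. \<Sum>i=1..n. v i j * unit_dcd (x i) (x j))) \<partial>P) - exp (- (t\<^sup>2 / 2)))
    \<le> clt_error t (sqrt (3 * (4 / \<delta>)\<^sup>2 * (moment 4 / real n)))
        (sqrt (3 * (4 / \<delta>)\<^sup>2 * (moment 4 / real n) + 6 * (4 / \<delta>) ^ 4 * cycle))"
  proof (rule quadratic_form_char_bound)
    show "moment 2 = 1" by (rule moment_unit_dcd_2)
    show "0 < 4 / \<delta>" using \<delta> by simp
    show "v i j = 0" if "\<not> i < j" for i j using that by (simp add: v_def)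
    show "\<bar>v i j\<bar> \<le> 4 / \<delta> / real n" if i: "i \<in> {1..n}" for i j
    proof (cases "i < j")
      case True
      then have "\<bar>v i j\<bar> = \<bar>S.weight i j\<bar> / sqrt W" using W0 by (simp add: v_def)
      also have "\<dots> \<le> (4 / \<delta> / (real n)\<^sup>2) / sqrt W"
        using W0 by (intro divide_right_mono S.weight_bound \<delta> i) auto
      also have "\<dots> \<le> (4 / \<delta> / (real n)\<^sup>2) / (1 / real n)"
        using sW n W0 \<delta>(1) by (intro divide_left_mono) auto
      also have "\<dots> = 4 / \<delta> / real n" using n by (simp add: power2_eq_square)
      finally show ?thesis .
    qed (use \<delta> in \<open>simp add: v_def\<close>)
    have "(\<Sum>j=1..n. \<Sum>i=1..n. (v i j)\<^sup>2) = (\<Sum>(i, j)\<in>pairs {1..n}. (S.weight i j)\<^sup>2 / W)"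
      unfolding sum_pairs_square using W0 by (intro sum.cong refl) (simp add: v_def power_divide)
    also have "\<dots> = 1"
      using W0 by (simp add: case_prod_beta W_def flip: sum_divide_distrib)
    finally show "(\<Sum>j=1..n. \<Sum>i=1..n. (v i j)\<^sup>2) = 1" .
  qed
  then show ?thesis
    by (simp add: stat moment_unit_dcd_4 cycle_unit_dcd mult.commute)
qed

end

text \<open>
  One member of the sequence: M carries the sample, J is the law of a single labelled observation.
\<close>

locale labelled_model = M: prob_space M + J: prob_space J
  for M :: "'a measure" and J :: "((nat \<Rightarrow> real) \<times> 'c) measure" +
  fixes K :: nat and L :: "nat \<Rightarrow> 'c" and pr :: "nat \<Rightarrow> real" and n p :: nat
    and F :: "(nat \<Rightarrow> real) measure"
    and X :: "nat \<Rightarrow> 'a \<Rightarrow> (nat \<Rightarrow> real)" and Y :: "nat \<Rightarrow> 'a \<Rightarrow> 'c"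
  assumes K: "2 \<le> K"
    and L: "inj_on L {1..K}"
    and J_sets: "sets J = sets (Rvec p \<Otimes>\<^sub>M count_space (L ` {1..K}))"
    and F: "F = distr J (Rvec p) fst"
    and Y_law: "\<And>k. k \<in> {1..K} \<Longrightarrow> measure J {z \<in> space J. snd z = L k} = pr k"
    and pr_pos: "\<And>k. k \<in> {1..K} \<Longrightarrow> 0 < pr k"
    and indep: "indep_rvs J (Rvec p) fst (count_space (L ` {1..K})) snd"
    and sample: "iid_sample M J n (\<lambda>i \<omega>. (X i \<omega>, Y i \<omega>))"
begin

abbreviation Lab :: "'c set" where
  "Lab \<equiv> L ` {1..K}"

abbreviation P :: "(nat \<Rightarrow> nat \<Rightarrow> real) measure" where
  "P \<equiv> PiM {1..n} (\<lambda>_. F)"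

lemma fst_measurable: "fst \<in> measurable J (Rvec p)"
  and snd_measurable: "snd \<in> measurable J (count_space Lab)"
  using indep by (auto simp: indep_rvs_def)

sublocale F: prob_space F
  unfolding F by (rule J.prob_space_distr[OF fst_measurable])

sublocale I: iid_coordinates F n ..

lemma sets_F[measurable_cong]: "sets F = sets (Rvec p)"
  by (simp add: F)

lemma XY_measurable: "i \<in> {1..n} \<Longrightarrow> (\<lambda>\<omega>. (X i \<omega>, Y i \<omega>)) \<in> measurable M J"
  using sample by (auto simp: iid_sample_def M.indep_vars_def)

lemma X_measurable: "i \<in> {1..n} \<Longrightarrow> X i \<in> measurable M (Rvec p)"
  and Y_measurable: "i \<in> {1..n} \<Longrightarrow> Y i \<in> measurable M (count_space Lab)"
  using measurable_compose[OF XY_measurable fst_measurable, of i]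
    measurable_compose[OF XY_measurable snd_measurable, of i] by auto

definition Xs :: "'a \<Rightarrow> nat \<Rightarrow> nat \<Rightarrow> real" where
  "Xs \<omega> = (\<lambda>i\<in>{1..n}. X i \<omega>)"

text \<open>
  The label vector is restricted to the indices 1, ..., n, so that it ranges over a finite set.
\<close>

definition Ys :: "'a \<Rightarrow> nat \<Rightarrow> 'c" where
  "Ys \<omega> = (\<lambda>i\<in>{1..n}. Y i \<omega>)"

definition labelings :: "(nat \<Rightarrow> 'c) set" where
  "labelings = {1..n} \<rightarrow>\<^sub>E Lab"

definition label_event :: "(nat \<Rightarrow> 'c) \<Rightarrow> 'a set" where
  "label_event y = {\<omega> \<in> space M. Ys \<omega> = y}"

lemma finite_labelings: "finite labelings"
  unfolding labelings_def by (rule finite_PiE) auto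

lemma Xs_measurable: "Xs \<in> measurable M P"
  unfolding Xs_def by (rule measurable_restrict) (simp add: X_measurable cong: measurable_cong_sets[OF refl sets_F])

lemma Y_in_Lab: "\<omega> \<in> space M \<Longrightarrow> i \<in> {1..n} \<Longrightarrow> Y i \<omega> \<in> Lab"
  using measurable_space[OF Y_measurable] by simp

lemma Ys_in_labelings: "\<omega> \<in> space M \<Longrightarrow> Ys \<omega> \<in> labelings"
  using Y_in_Lab by (auto simp: Ys_def labelings_def)

lemma label_event_eq: "y \<in> labelings \<Longrightarrow> label_event y = {\<omega> \<in> space M. \<forall>i\<in>{1..n}. Y i \<omega> = y i}"
  by (auto simp: label_event_def Ys_def labelings_def PiE_iff extensional_def restrict_def fun_eq_iff)

lemma prob_observation:
  assumes i: "i \<in> {1..n}" and E: "E \<in> sets F" and k: "k \<in> {1..K}"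
  shows "{\<omega> \<in> space M. X i \<omega> \<in> E \<and> Y i \<omega> = L k} = (\<lambda>\<omega>. (X i \<omega>, Y i \<omega>)) -` {z \<in> space J. fst z \<in> E \<and> snd z = L k} \<inter> space M"
    and "{z \<in> space J. fst z \<in> E \<and> snd z = L k} \<in> sets J"
    and "M.prob {\<omega> \<in> space M. X i \<omega> \<in> E \<and> Y i \<omega> = L k} = measure F E * pr k"
proof -
  let ?R = "{z \<in> space J. fst z \<in> E \<and> snd z = L k}"
  have E': "E \<in> sets (Rvec p)" using E by (simp add: sets_F)
  have Lk: "{L k} \<in> sets (count_space Lab)" using k by auto
  have R: "?R = (fst -` E \<inter> space J) \<inter> (snd -` {L k} \<inter> space J)" by auto
  show RJ: "?R \<in> sets J"
    unfolding R using measurable_sets[OF fst_measurable E'] measurable_sets[OF snd_measurable Lk] by auto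
  show eq: "{\<omega> \<in> space M. X i \<omega> \<in> E \<and> Y i \<omega> = L k} = (\<lambda>\<omega>. (X i \<omega>, Y i \<omega>)) -` ?R \<inter> space M"
    using measurable_space[OF XY_measurable[OF i]] by auto
  have "M.prob {\<omega> \<in> space M. X i \<omega> \<in> E \<and> Y i \<omega> = L k} = measure (distr M J (\<lambda>\<omega>. (X i \<omega>, Y i \<omega>))) ?R"
    unfolding eq using RJ XY_measurable[OF i] by (simp add: measure_distr)
  also have "distr M J (\<lambda>\<omega>. (X i \<omega>, Y i \<omega>)) = J"
    using sample i by (simp add: iid_sample_def)
  also have "measure J ?R = measure J (fst -` E \<inter> space J) * measure J (snd -` {L k} \<inter> space J)"
    unfolding R using indep E' Lk by (intro J.indep_setD) (auto simp: indep_rvs_def)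
  also have "measure J (fst -` E \<inter> space J) = measure F E"
    unfolding F using fst_measurable E' by (simp add: measure_distr)
  also have "snd -` {L k} \<inter> space J = {z \<in> space J. snd z = L k}" by auto
  finally show "M.prob {\<omega> \<in> space M. X i \<omega> \<in> E \<and> Y i \<omega> = L k} = measure F E * pr k"
    using Y_law[OF k] by simp
qed

lemma prob_sample:
  assumes n: "1 \<le> n" and y: "y \<in> labelings" and E: "\<And>i. i \<in> {1..n} \<Longrightarrow> E i \<in> sets F"
  shows "label_event y \<inter> (Xs -` (Pi\<^sub>E {1..n} E) \<inter> space M) \<in> sets M"
    and "M.prob (label_event y \<inter> (Xs -` (Pi\<^sub>E {1..n} E) \<inter> space M))
      = (\<Prod>i=1..n. measure F (E i) * pr (inv_into {1..K} L (y i)))"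
proof -
  define \<kappa> where "\<kappa> i = inv_into {1..K} L (y i)" for i
  have \<kappa>: "\<kappa> i \<in> {1..K}" "L (\<kappa> i) = y i" if "i \<in> {1..n}" for i
  proof -
    have "y i \<in> Lab" using y that by (auto simp: labelings_def)
    then show "\<kappa> i \<in> {1..K}" "L (\<kappa> i) = y i" unfolding \<kappa>_def by (rule inv_into_into, rule f_inv_into_f)
  qed
  define R where "R i = {z \<in> space J. fst z \<in> E i \<and> snd z = L (\<kappa> i)}" for i
  note obs = prob_observation[OF _ E \<kappa>(1)]
  have eq: "label_event y \<inter> (Xs -` (Pi\<^sub>E {1..n} E) \<inter> space M) = (\<Inter>i\<in>{1..n}. (\<lambda>\<omega>. (X i \<omega>, Y i \<omega>)) -` R i \<inter> space M)"
  proof -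
    have "label_event y \<inter> (Xs -` (Pi\<^sub>E {1..n} E) \<inter> space M) = (\<Inter>i\<in>{1..n}. {\<omega> \<in> space M. X i \<omega> \<in> E i \<and> Y i \<omega> = L (\<kappa> i)})"
      unfolding label_event_eq[OF y] using n \<kappa>(2) by (auto simp: Xs_def PiE_iff)
    also have "\<dots> = (\<Inter>i\<in>{1..n}. (\<lambda>\<omega>. (X i \<omega>, Y i \<omega>)) -` R i \<inter> space M)"
      by (rule INF_cong[OF refl]) (simp add: obs(1) R_def)
    finally show ?thesis .
  qed
  have R: "R i \<in> sets J" if "i \<in> {1..n}" for i unfolding R_def by (rule obs(2)[OF that that that])
  show "label_event y \<inter> (Xs -` (Pi\<^sub>E {1..n} E) \<inter> space M) \<in> sets M"
    unfolding eq using n R XY_measurable by (intro sets.finite_INT measurable_sets) auto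
  have "M.prob (\<Inter>i\<in>{1..n}. (\<lambda>\<omega>. (X i \<omega>, Y i \<omega>)) -` R i \<inter> space M)
      = (\<Prod>i=1..n. M.prob ((\<lambda>\<omega>. (X i \<omega>, Y i \<omega>)) -` R i \<inter> space M))"
    using sample n R by (intro M.indep_varsD_finite[where M'="\<lambda>_. J"]) (auto simp: iid_sample_def)
  also have "\<dots> = (\<Prod>i=1..n. measure F (E i) * pr (\<kappa> i))"
  proof (rule prod.cong[OF refl])
    fix i assume i: "i \<in> {1..n}"
    show "M.prob ((\<lambda>\<omega>. (X i \<omega>, Y i \<omega>)) -` R i \<inter> space M) = measure F (E i) * pr (\<kappa> i)"
      unfolding R_def obs(1)[OF i i i, symmetric] by (rule obs(3)[OF i i i])
  qed
  finally show "M.prob (label_event y \<inter> (Xs -` (Pi\<^sub>E {1..n} E) \<inter> space M))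
      = (\<Prod>i=1..n. measure F (E i) * pr (inv_into {1..K} L (y i)))"
    unfolding eq \<kappa>_def .
qed

lemma label_event:
  assumes n: "1 \<le> n" and y: "y \<in> labelings"
  shows "label_event y \<in> sets M" "0 < M.prob (label_event y)"
    and "M.prob (label_event y) = (\<Prod>i=1..n. pr (inv_into {1..K} L (y i)))"
proof -
  have "Xs -` (Pi\<^sub>E {1..n} (\<lambda>_. space F)) \<inter> space M = space M"
    using measurable_space[OF Xs_measurable] by (auto simp: space_PiM)
  then have *: "label_event y \<inter> (Xs -` (Pi\<^sub>E {1..n} (\<lambda>_. space F)) \<inter> space M) = label_event y"
    by (auto simp: label_event_def)
  show "label_event y \<in> sets M"
    using prob_sample(1)[OF n y, of "\<lambda>_. space F"] * by simp
  show eq: "M.prob (label_event y) = (\<Prod>i=1..n. pr (inv_into {1..K} L (y i)))"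
    using prob_sample(2)[OF n y, of "\<lambda>_. space F"] * by (simp add: F.prob_space)
  show "0 < M.prob (label_event y)"
    unfolding eq using y by (intro prod_pos pr_pos inv_into_into) (auto simp: labelings_def)
qed

text \<open>
  On a product of sets E i, the probability of the sample together with the labels y is the product of
  the probabilities of E i times that of the labels.
\<close>

lemma distr_given_labels:
  assumes n: "1 \<le> n" and y: "y \<in> labelings"
  shows "distr (uniform_measure M (label_event y)) P Xs = P"
proof (rule I.PF.PiM_eqI)
  note le = label_event[OF n y]
  have Xm: "Xs \<in> measurable (uniform_measure M (label_event y)) P"
    using Xs_measurable by (simp cong: measurable_cong_sets)
  fix E :: "nat \<Rightarrow> (nat \<Rightarrow> real) set" assume E: "\<And>i. i \<in> {1..n} \<Longrightarrow> E i \<in> sets F"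
  have EP: "Pi\<^sub>E {1..n} E \<in> sets P" using E by (intro sets_PiM_I_finite) auto
  have S: "Xs -` Pi\<^sub>E {1..n} E \<inter> space M \<in> sets M" by (rule measurable_sets[OF Xs_measurable EP])
  have U: "prob_space (uniform_measure M (label_event y))"
    using le(1,2) by (intro prob_space_uniform_measure) (auto simp: M.emeasure_eq_measure)
  interpret U: prob_space "uniform_measure M (label_event y)" by (rule U)
  have "emeasure (distr (uniform_measure M (label_event y)) P Xs) (Pi\<^sub>E {1..n} E)
      = emeasure (uniform_measure M (label_event y)) (Xs -` Pi\<^sub>E {1..n} E \<inter> space M)"
    using Xm EP by (simp add: emeasure_distr)
  also have "\<dots> = measure (uniform_measure M (label_event y)) (Xs -` Pi\<^sub>E {1..n} E \<inter> space M)"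
    by (rule U.emeasure_eq_measure)
  also have "\<dots> = M.prob (label_event y \<inter> (Xs -` Pi\<^sub>E {1..n} E \<inter> space M)) / M.prob (label_event y)"
    using le(1,2) S by (subst measure_uniform_measure) (auto simp: M.emeasure_eq_measure)
  also have "\<dots> = (\<Prod>i=1..n. measure F (E i))"
  proof -
    have nz: "(\<Prod>i=1..n. pr (inv_into {1..K} L (y i))) \<noteq> 0"
      using le(2) unfolding le(3) by linarith
    have ps: "M.prob (label_event y \<inter> (Xs -` (Pi\<^sub>E {1..n} E) \<inter> space M))
        = (\<Prod>i=1..n. measure F (E i) * pr (inv_into {1..K} L (y i)))"
      by (rule prob_sample(2)[OF n y]) (rule E)
    show ?thesis
      unfolding ps le(3) prod.distrib nonzero_mult_div_cancel_right[OF nz] by (rule refl)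
  qed
  also have "\<dots> = (\<Prod>i\<in>{1..n}. emeasure F (E i))"
    by (simp add: F.emeasure_eq_measure prod_ennreal)
  finally show "emeasure (distr (uniform_measure M (label_event y)) P Xs) (Pi\<^sub>E {1..n} E) = (\<Prod>i\<in>{1..n}. emeasure F (E i))" .
qed simp_all

lemma uniform_measure_eq_density:
  assumes A: "0 < M.prob A"
  shows "uniform_measure M A = density M (\<lambda>x. ennreal (indicator A x / M.prob A))"
proof -
  have "indicator A x / emeasure M A = ennreal (indicator A x / M.prob A)" for x
    using A by (simp add: M.emeasure_eq_measure divide_ennreal split: split_indicator flip: ennreal_1)
  then show ?thesis by (simp add: uniform_measure_def)
qed

lemma integral_on_label_event:
  fixes \<phi> :: "(nat \<Rightarrow> nat \<Rightarrow> real) \<Rightarrow> 'e::{banach, second_countable_topology}"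
  assumes n: "1 \<le> n" and y: "y \<in> labelings" and \<phi>: "integrable P \<phi>"
  shows "integrable M (\<lambda>\<omega>. indicator (label_event y) \<omega> *\<^sub>R \<phi> (Xs \<omega>))"
    and "(\<integral>\<omega>. indicator (label_event y) \<omega> *\<^sub>R \<phi> (Xs \<omega>) \<partial>M) = M.prob (label_event y) *\<^sub>R integral\<^sup>L P \<phi>"
proof -
  note le[measurable] = label_event[OF n y]
  let ?U = "uniform_measure M (label_event y)"
  let ?g = "\<lambda>\<omega>. indicator (label_event y) \<omega> / M.prob (label_event y)"
  have \<phi>m[measurable]: "\<phi> \<in> borel_measurable P" using \<phi> by auto
  note Xs_measurable[measurable]
  have Xm: "Xs \<in> measurable ?U P" using Xs_measurable by (simp cong: measurable_cong_sets)
  have m: "(\<lambda>\<omega>. \<phi> (Xs \<omega>)) \<in> borel_measurable M" "?g \<in> borel_measurable M" "AE \<omega> in M. 0 \<le> ?g \<omega>"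
    using le by auto
  have U: "?U = density M ?g" by (rule uniform_measure_eq_density[OF le(2)])
  have "integrable ?U (\<lambda>\<omega>. \<phi> (Xs \<omega>))"
    using \<phi> integrable_distr_eq[OF Xm \<phi>m] distr_given_labels[OF n y] by simp
  then have "integrable M (\<lambda>\<omega>. ?g \<omega> *\<^sub>R \<phi> (Xs \<omega>))"
    unfolding U integrable_density[OF m] .
  then have "integrable M (\<lambda>\<omega>. M.prob (label_event y) *\<^sub>R (?g \<omega> *\<^sub>R \<phi> (Xs \<omega>)))"
    by (rule integrable_scaleR_right)
  then show "integrable M (\<lambda>\<omega>. indicator (label_event y) \<omega> *\<^sub>R \<phi> (Xs \<omega>))"
    using le(2) by simp
  have "integral\<^sup>L P \<phi> = (\<integral>\<omega>. \<phi> (Xs \<omega>) \<partial>?U)"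
    using integral_distr[OF Xm \<phi>m] distr_given_labels[OF n y] by simp
  also have "\<dots> = (\<integral>\<omega>. ?g \<omega> *\<^sub>R \<phi> (Xs \<omega>) \<partial>M)"
    unfolding U by (rule integral_density[OF m])
  finally have 1: "integral\<^sup>L P \<phi> = (\<integral>\<omega>. ?g \<omega> *\<^sub>R \<phi> (Xs \<omega>) \<partial>M)" .
  have "M.prob (label_event y) *\<^sub>R integral\<^sup>L P \<phi> = (\<integral>\<omega>. M.prob (label_event y) *\<^sub>R (?g \<omega> *\<^sub>R \<phi> (Xs \<omega>)) \<partial>M)"
    unfolding 1 by (rule integral_scaleR_right[symmetric])
  then show "(\<integral>\<omega>. indicator (label_event y) \<omega> *\<^sub>R \<phi> (Xs \<omega>) \<partial>M) = M.prob (label_event y) *\<^sub>R integral\<^sup>L P \<phi>"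
    using le(2) by simp
qed

lemma integral_over_labels:
  fixes \<phi> :: "(nat \<Rightarrow> 'c) \<Rightarrow> (nat \<Rightarrow> nat \<Rightarrow> real) \<Rightarrow> 'e::{banach, second_countable_topology}"
  assumes n: "1 \<le> n" and S: "S \<subseteq> labelings" and \<phi>: "\<And>y. y \<in> S \<Longrightarrow> integrable P (\<phi> y)"
  shows "integrable M (\<lambda>\<omega>. indicator {\<omega> \<in> space M. Ys \<omega> \<in> S} \<omega> *\<^sub>R \<phi> (Ys \<omega>) (Xs \<omega>))"
    and "(\<integral>\<omega>. indicator {\<omega> \<in> space M. Ys \<omega> \<in> S} \<omega> *\<^sub>R \<phi> (Ys \<omega>) (Xs \<omega>) \<partial>M)
      = (\<Sum>y\<in>S. M.prob (label_event y) *\<^sub>R integral\<^sup>L P (\<phi> y))"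
proof -
  have fin: "finite S" using S finite_labelings by (rule finite_subset)
  have eq: "indicator {\<omega> \<in> space M. Ys \<omega> \<in> S} \<omega> *\<^sub>R \<phi> (Ys \<omega>) (Xs \<omega>)
      = (\<Sum>y\<in>S. indicator (label_event y) \<omega> *\<^sub>R \<phi> y (Xs \<omega>))" if \<omega>: "\<omega> \<in> space M" for \<omega>
  proof -
    have "(\<Sum>y\<in>S. indicator (label_event y) \<omega> *\<^sub>R \<phi> y (Xs \<omega>)) = (\<Sum>y\<in>S. if y = Ys \<omega> then \<phi> y (Xs \<omega>) else 0)"
      using \<omega> by (intro sum.cong refl) (auto simp: label_event_def indicator_def)
    then show ?thesis using fin \<omega> by (simp add: indicator_def)
  qed
  note l = integral_on_label_event[OF n subsetD[OF S] \<phi>]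
  have "integrable M (\<lambda>\<omega>. \<Sum>y\<in>S. indicator (label_event y) \<omega> *\<^sub>R \<phi> y (Xs \<omega>))"
    using l(1) by (intro Bochner_Integration.integrable_sum)
  then show "integrable M (\<lambda>\<omega>. indicator {\<omega> \<in> space M. Ys \<omega> \<in> S} \<omega> *\<^sub>R \<phi> (Ys \<omega>) (Xs \<omega>))"
    by (rule iffD1[OF Bochner_Integration.integrable_cong, rotated -1]) (simp_all only: eq)
  have "(\<integral>\<omega>. indicator {\<omega> \<in> space M. Ys \<omega> \<in> S} \<omega> *\<^sub>R \<phi> (Ys \<omega>) (Xs \<omega>) \<partial>M)
      = (\<integral>\<omega>. (\<Sum>y\<in>S. indicator (label_event y) \<omega> *\<^sub>R \<phi> y (Xs \<omega>)) \<partial>M)"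
    by (rule Bochner_Integration.integral_cong) (simp_all only: eq)
  also have "\<dots> = (\<Sum>y\<in>S. \<integral>\<omega>. indicator (label_event y) \<omega> *\<^sub>R \<phi> y (Xs \<omega>) \<partial>M)"
    using l(1) by (intro Bochner_Integration.integral_sum)
  also have "\<dots> = (\<Sum>y\<in>S. M.prob (label_event y) *\<^sub>R integral\<^sup>L P (\<phi> y))"
    using l(2) by (intro sum.cong refl)
  finally show "(\<integral>\<omega>. indicator {\<omega> \<in> space M. Ys \<omega> \<in> S} \<omega> *\<^sub>R \<phi> (Ys \<omega>) (Xs \<omega>) \<partial>M)
      = (\<Sum>y\<in>S. M.prob (label_event y) *\<^sub>R integral\<^sup>L P (\<phi> y))" .
qed

text \<open>
  Hoeffding's inequality at half the mean: the deviation n pr k / 2 gives the exponent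
  2 (n pr k / 2)^2 / n.
\<close>

lemma class_size_lower_tail:
  assumes k: "k \<in> {1..K}" and n: "1 \<le> n"
  shows "M.prob {\<omega> \<in> space M. real (class_size n (\<lambda>i. Y i \<omega>) (L k)) \<le> real n * pr k / 2}
    \<le> exp (- (real n * (pr k)\<^sup>2 / 2))"
proof -
  let ?Z = "\<lambda>i \<omega>. indicator {L k} (Y i \<omega>) :: real"
  have ind: "M.indep_vars (\<lambda>_. borel) ?Z {1..n}"
  proof -
    have "(\<lambda>z. indicator {L k} (snd z)) \<in> borel_measurable J"
      by (rule measurable_compose[OF snd_measurable]) simp
    then show ?thesis
      using M.indep_vars_compose2[of "\<lambda>_. J" "\<lambda>i \<omega>. (X i \<omega>, Y i \<omega>)" "{1..n}" "\<lambda>_ z. indicator {L k} (snd z)" "\<lambda>_. borel"] sample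
      by (simp add: iid_sample_def)
  qed
  interpret H: Hoeffding_ineq M "{1..n}" ?Z "\<lambda>_. 0" "\<lambda>_. 1" "\<Sum>i\<in>{1..n}. M.expectation (?Z i)"
  proof unfold_locales
    show "M.indep_vars (\<lambda>_. borel) ?Z {1..n}" by (rule ind)
    show "AE \<omega> in M. ?Z i \<omega> \<in> {0..1}" for i by (rule AE_I2) (simp add: indicator_def)
  qed simp_all
  have E: "M.expectation (?Z i) = pr k" if i: "i \<in> {1..n}" for i
  proof -
    have "M.expectation (?Z i) = M.expectation (indicator {\<omega> \<in> space M. X i \<omega> \<in> space F \<and> Y i \<omega> = L k})"
      using measurable_space[OF X_measurable[OF i]]
      by (intro Bochner_Integration.integral_cong refl) (auto simp: indicator_def sets_eq_imp_space_eq[OF sets_F])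
    also have "\<dots> = M.prob {\<omega> \<in> space M. X i \<omega> \<in> space F \<and> Y i \<omega> = L k}"
      by (simp add: Int_def conj_ac)
    also have "\<dots> = pr k" using prob_observation(3)[OF i sets.top k] by (simp add: F.prob_space)
    finally show ?thesis .
  qed
  have cs: "real (class_size n (\<lambda>i. Y i \<omega>) (L k)) = (\<Sum>i\<in>{1..n}. ?Z i \<omega>)" for \<omega>
    by (simp add: class_size_def class_set_def indicator_def sum.If_cases Int_def)
  have "M.prob {\<omega> \<in> space M. (\<Sum>i\<in>{1..n}. ?Z i \<omega>) \<le> (\<Sum>i\<in>{1..n}. M.expectation (?Z i)) - real n * pr k / 2}
      \<le> exp (- 2 * (real n * pr k / 2)\<^sup>2 / (\<Sum>i\<in>{1..n}. (1 - 0)\<^sup>2))"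
    using n pr_pos[OF k] by (intro H.Hoeffding_ineq_le) auto
  then show ?thesis
    using n E by (simp add: cs power2_eq_square mult_ac)
qed

end

section \<open>Averaging over the labels and passage to the limit\<close>

text \<open>
  This makes the event of prescribed class sizes possible, so that conditioning on it is
  meaningful.
\<close>

lemma exists_labelling_with_class_sizes:
  fixes c :: "'k \<Rightarrow> nat"
  assumes I: "finite I" and A: "finite A" and card: "card A = (\<Sum>k\<in>I. c k)"
  obtains f where "f \<in> A \<rightarrow> I" "\<And>k. k \<in> I \<Longrightarrow> card {a \<in> A. f a = k} = c k"
proof -
  have "card A = card (SIGMA k:I. {..<c k})" using I card by simp
  then obtain g where g: "bij_betw g A (SIGMA k:I. {..<c k})"
    using finite_same_card_bij[of A "SIGMA k:I. {..<c k}"] A I by auto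
  show ?thesis
  proof (rule that[of "\<lambda>a. fst (g a)"])
    show "(\<lambda>a. fst (g a)) \<in> A \<rightarrow> I"
      using bij_betwE[OF g] by fastforce
    fix k assume k: "k \<in> I"
    have "g ` {a \<in> A. fst (g a) = k} = {k} \<times> {..<c k}"
    proof
      show "g ` {a \<in> A. fst (g a) = k} \<subseteq> {k} \<times> {..<c k}"
        using bij_betwE[OF g] by fastforce
      show "{k} \<times> {..<c k} \<subseteq> g ` {a \<in> A. fst (g a) = k}"
      proof
        fix z assume z: "z \<in> {k} \<times> {..<c k}"
        then have "z \<in> g ` A" using k bij_betw_imp_surj_on[OF g] by auto
        then obtain a where a: "a \<in> A" "z = g a" by auto
        then have "fst (g a) = k" using z by auto
        then show "z \<in> g ` {a \<in> A. fst (g a) = k}" using a by blast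
      qed
    qed
    moreover have "inj_on g {a \<in> A. fst (g a) = k}"
      using bij_betw_imp_inj_on[OF g] by (rule inj_on_subset) auto
    ultimately show "card {a \<in> A. fst (g a) = k} = c k"
      using card_image[of g "{a \<in> A. fst (g a) = k}"] by simp
  qed
qed

lemma clt_error_nonneg: "0 \<le> q \<Longrightarrow> 0 \<le> r \<Longrightarrow> 0 \<le> clt_error t q r"
  by (auto simp: clt_error_def intro!: mult_nonneg_nonneg add_nonneg_nonneg)

lemma class_set_cong: "(\<And>i. i \<in> {1..n} \<Longrightarrow> y i = y' i) \<Longrightarrow> class_set n y l = class_set n y' l"
  by (auto simp: class_set_def)

lemma U_stat_cong: "(\<And>i. i \<in> I \<Longrightarrow> x i = x' i) \<Longrightarrow> U_stat p x I = U_stat p x' I"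
  unfolding U_stat_def by (intro arg_cong2[where f="(/)"] sum.cong refl) auto

lemma gCov_cong:
  assumes "\<And>i. i \<in> {1..n} \<Longrightarrow> x i = x' i" "\<And>i. i \<in> {1..n} \<Longrightarrow> y i = y' i"
  shows "gCov K L p n x y = gCov K L p n x' y'"
proof -
  have c: "class_set n y l = class_set n y' l" for l by (rule class_set_cong) (rule assms(2))
  have "U_stat p x I = U_stat p x' I" if "I \<subseteq> {1..n}" for I
    using that assms(1) by (intro U_stat_cong) auto
  moreover have "class_set n y' l \<subseteq> {1..n}" for l by (auto simp: class_set_def)
  ultimately show ?thesis by (simp add: gCov_def class_size_def c)
qed

locale gini_model = labelled_model M J K L pr n p F X Y
  for M :: "'a measure" and J :: "((nat \<Rightarrow> real) \<times> 'c) measure" and K L pr n p F X Y +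
  assumes norm_int4: "integrable F (\<lambda>x. enorm p x ^ 4)"
    and nondegenerate: "0 < dcd_moment p F 2"
begin

sublocale sampled_law F p
  by unfold_locales (rule sets_F norm_int4 nondegenerate)+

abbreviation gini :: "'a \<Rightarrow> real" where
  "gini \<omega> \<equiv> gCov K L p n (\<lambda>i. X i \<omega>) (\<lambda>i. Y i \<omega>)"

abbreviation sizes :: "'a \<Rightarrow> nat \<Rightarrow> nat" where
  "sizes \<omega> \<equiv> \<lambda>k. class_size n (\<lambda>i. Y i \<omega>) (L k)"

lemma gini_eq: "gini \<omega> = gCov K L p n (Xs \<omega>) (Ys \<omega>)"
  by (rule gCov_cong) (simp_all add: Xs_def Ys_def)

lemma class_size_eq: "class_size n (\<lambda>i. Y i \<omega>) l = class_size n (Ys \<omega>) l"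
  unfolding class_size_def by (rule arg_cong[where f=card], rule class_set_cong) (simp add: Ys_def)

lemma Ys_measurable: "Ys \<in> measurable M (count_space labelings)"
proof -
  have "Ys -` {y} \<inter> space M \<in> sets M" if y: "y \<in> labelings" for y
  proof -
    have "Ys -` {y} \<inter> space M = label_event y" by (auto simp: label_event_def)
    moreover have "label_event y \<in> sets M"
    proof (cases "1 \<le> n")
      case False
      then show ?thesis using label_event_eq[OF y] by simp
    qed (rule label_event(1)[OF _ y])
    ultimately show ?thesis by simp
  qed
  then show ?thesis
    unfolding measurable_count_space_eq2[OF finite_labelings] using Ys_in_labelings by auto
qed

lemma label_property_event: "{\<omega> \<in> space M. Q (Ys \<omega>)} \<in> sets M"
proof -
  have "Ys -` {y \<in> labelings. Q y} \<inter> space M \<in> sets M"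
    by (rule measurable_sets[OF Ys_measurable]) simp
  also have "Ys -` {y \<in> labelings. Q y} \<inter> space M = {\<omega> \<in> space M. Q (Ys \<omega>)}"
    using Ys_in_labelings by auto
  finally show ?thesis .
qed

lemma gCov_measurable: "(\<lambda>x. gCov K L p n x y) \<in> borel_measurable P"
proof -
  have "(\<lambda>x. U_stat p x I) \<in> borel_measurable P" if I: "I \<subseteq> {1..n}" for I
  proof -
    have "(\<lambda>x. x i) \<in> measurable P (Rvec p)" if "i \<in> I" for i
      unfolding measurable_cong_sets[OF refl sets_F[symmetric]]
      using that I by (intro measurable_component_singleton) auto
    then have "(\<lambda>x. edist p (x i) (x j)) \<in> borel_measurable P" if "i \<in> I" "j \<in> I" for i j
      using that by (intro edist_measurable) auto
    then show ?thesis unfolding U_stat_def case_prod_beta by measurable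
  qed
  moreover have "class_set n y l \<subseteq> {1..n}" for l by (auto simp: class_set_def)
  ultimately show ?thesis unfolding gCov_def
    by (intro borel_measurable_diff borel_measurable_sum borel_measurable_times) auto
qed

lemma function_of_sample_measurable:
  assumes "\<And>y. f y \<in> borel_measurable P"
  shows "(\<lambda>\<omega>. f (Ys \<omega>) (Xs \<omega>)) \<in> borel_measurable M"
  by (rule measurable_compose_countable'[OF _ Ys_measurable countable_finite[OF finite_labelings]])
     (rule measurable_compose[OF Xs_measurable assms])

abbreviation standardized :: "'a \<Rightarrow> real" where
  "standardized \<omega> \<equiv> gini \<omega> / sqrt (sigma0_sq K n (sizes \<omega>) (dcd_moment p F 2))"

definition standardized_given :: "(nat \<Rightarrow> 'c) \<Rightarrow> (nat \<Rightarrow> nat \<Rightarrow> real) \<Rightarrow> real" where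
  "standardized_given y x = gCov K L p n x y / sqrt (sigma0_sq K n (\<lambda>k. class_size n y (L k)) (dcd_moment p F 2))"

lemma standardized_eq: "standardized \<omega> = standardized_given (Ys \<omega>) (Xs \<omega>)"
  by (simp add: standardized_given_def gini_eq class_size_eq)

lemma standardized_given_measurable: "standardized_given y \<in> borel_measurable P"
  unfolding standardized_given_def[abs_def]
  by (intro borel_measurable_divide gCov_measurable) simp

lemma standardized_measurable: "standardized \<in> borel_measurable M"
  unfolding standardized_eq by (rule function_of_sample_measurable) (rule standardized_given_measurable)

lemma sum_prob_label_event:
  assumes n: "1 \<le> n" and S: "S \<subseteq> labelings"
  shows "(\<Sum>y\<in>S. M.prob (label_event y)) = M.prob {\<omega> \<in> space M. Ys \<omega> \<in> S}"
proof -
  have "{\<omega> \<in> space M. Ys \<omega> \<in> S} \<inter> space M = {\<omega> \<in> space M. Ys \<omega> \<in> S}" by auto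
  then show ?thesis
    using integral_over_labels(2)[OF n S, of "\<lambda>_ _. 1::real"] by (simp add: I.PF.P.prob_space)
qed

lemma pr_le_1: "k \<in> {1..K} \<Longrightarrow> pr k \<le> 1"
  using Y_law[of k] J.prob_le_1 by metis

text \<open>
  The characteristic function is the average over the labels of the conditional ones. Each labelling
  whose classes all have at least \<delta> n members satisfies the bound for given labels, and each of
  the others contributes at most 2 times its probability.
\<close>

theorem standardized_char_bound:
  assumes \<delta>: "0 < \<delta>" "\<And>k. k \<in> {1..K} \<Longrightarrow> \<delta> \<le> pr k / 2" and n: "2 \<le> \<delta> * real n"
  shows "cmod (char (distr M borel standardized) t - exp (- (t\<^sup>2 / 2)))
    \<le> clt_error t (sqrt (3 * (4 / \<delta>)\<^sup>2 * (dcd_moment p F 4 / (real n * (dcd_moment p F 2)\<^sup>2))))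
        (sqrt (3 * (4 / \<delta>)\<^sup>2 * (dcd_moment p F 4 / (real n * (dcd_moment p F 2)\<^sup>2))
          + 6 * (4 / \<delta>) ^ 4 * (dcd_cycle p F / (dcd_moment p F 2)\<^sup>2)))
      + 2 * (\<Sum>k=1..K. exp (- (real n * (pr k)\<^sup>2 / 2)))" (is "_ \<le> ?err + 2 * ?tail")
proof -
  have n1: "1 \<le> n" using n by (cases "n = 0") auto
  have \<delta>1: "\<delta> \<le> 1" using \<delta>(2)[of 1] pr_le_1[of 1] K by simp
  define \<gamma> where "\<gamma> = complex_of_real (exp (- (t\<^sup>2 / 2)))"
  define a where "a y = (\<integral>x. iexp (t * standardized_given y x) \<partial>P)" for y
  have int: "integrable P (\<lambda>x. iexp (t * standardized_given y x))" for y
    using standardized_given_measurable[of y] by (intro I.PF.P.integrable_const_bound[where B=1]) auto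
  have "char (distr M borel standardized) t = (\<integral>\<omega>. iexp (t * standardized \<omega>) \<partial>M)"
    unfolding char_def using standardized_measurable by (subst integral_distr) auto
  also have "\<dots> = (\<integral>\<omega>. indicator {\<omega> \<in> space M. Ys \<omega> \<in> labelings} \<omega> *\<^sub>R iexp (t * standardized_given (Ys \<omega>) (Xs \<omega>)) \<partial>M)"
    by (intro Bochner_Integration.integral_cong refl) (simp add: standardized_eq Ys_in_labelings)
  also have "\<dots> = (\<Sum>y\<in>labelings. M.prob (label_event y) *\<^sub>R a y)"
    unfolding a_def by (rule integral_over_labels(2)[OF n1 order_refl int])
  finally have ch: "char (distr M borel standardized) t = (\<Sum>y\<in>labelings. M.prob (label_event y) *\<^sub>R a y)" .
  have "{\<omega> \<in> space M. Ys \<omega> \<in> labelings} = space M" using Ys_in_labelings by auto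
  then have total: "(\<Sum>y\<in>labelings. M.prob (label_event y)) = 1"
    using sum_prob_label_event[OF n1 order_refl] by (simp add: M.prob_space)
  define bad where "bad = {y \<in> labelings. \<exists>k\<in>{1..K}. real (class_size n y (L k)) < \<delta> * real n}"
  have err: "0 \<le> ?err"
  proof -
    interpret centered_kernel F n unit_dcd unit_dcd_bound by (rule centered_kernel)
    have "0 \<le> dcd_moment p F 4"
      unfolding dcd_moment_def by (intro Bochner_Integration.integral_nonneg) simp
    moreover have "0 \<le> dcd_cycle p F"
      using cycle_nonneg nondegenerate unfolding cycle_unit_dcd by (simp add: zero_le_divide_iff)
    ultimately show ?thesis
      by (intro clt_error_nonneg real_sqrt_ge_zero add_nonneg_nonneg mult_nonneg_nonneg divide_nonneg_nonneg) auto
  qed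
  have good: "cmod (a y - \<gamma>) \<le> ?err" if y: "y \<in> labelings" "y \<notin> bad" for y
  proof -
    have sz: "\<delta> * real n \<le> real (class_size n y (L k))" if "k \<in> {1..K}" for k
      using y that by (auto simp: bad_def not_less)
    have "labelled_sample K L n y"
    proof
      show "y i \<in> L ` {1..K}" if "i \<in> {1..n}" for i using y(1) that by (auto simp: labelings_def)
      show "2 \<le> class_size n y (L k)" if "k \<in> {1..K}" for k
        using sz[OF that] n by linarith
    qed (rule K L)+
    from gCov_char_bound_given_labels[OF this \<delta>(1) \<delta>1 sz, of t]
    show ?thesis unfolding a_def \<gamma>_def standardized_given_def .
  qed
  have any: "cmod (a y - \<gamma>) \<le> 2" for y
  proof -
    have "cmod (a y) \<le> (\<integral>x. norm (iexp (t * standardized_given y x)) \<partial>P)"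
      unfolding a_def by (rule integral_norm_bound)
    then have "cmod (a y) \<le> 1" by (simp add: I.PF.P.prob_space)
    moreover have "cmod \<gamma> \<le> 1" by (simp add: \<gamma>_def)
    ultimately show ?thesis using norm_triangle_ineq4[of "a y" \<gamma>] by linarith
  qed
  have bad: "(\<Sum>y\<in>bad. M.prob (label_event y)) \<le> ?tail"
  proof -
    let ?B = "\<lambda>k. {\<omega> \<in> space M. real (class_size n (Ys \<omega>) (L k)) \<le> real n * pr k / 2}"
    have meas: "?B k \<in> sets M" for k by (rule label_property_event)
    have "(\<Sum>y\<in>bad. M.prob (label_event y)) = M.prob {\<omega> \<in> space M. Ys \<omega> \<in> bad}"
      by (rule sum_prob_label_event[OF n1]) (auto simp: bad_def)
    also have "\<dots> \<le> M.prob (\<Union>k\<in>{1..K}. ?B k)"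
    proof (rule M.finite_measure_mono)
      show "{\<omega> \<in> space M. Ys \<omega> \<in> bad} \<subseteq> (\<Union>k\<in>{1..K}. ?B k)"
      proof
        fix \<omega> assume \<omega>: "\<omega> \<in> {\<omega> \<in> space M. Ys \<omega> \<in> bad}"
        then obtain k where k: "k \<in> {1..K}" "real (class_size n (Ys \<omega>) (L k)) < \<delta> * real n"
          by (auto simp: bad_def)
        have "\<delta> * real n \<le> pr k / 2 * real n" using \<delta>(2)[OF k(1)] by (intro mult_right_mono) auto
        then have "real (class_size n (Ys \<omega>) (L k)) \<le> real n * pr k / 2" using k(2) by (simp add: mult.commute)
        then show "\<omega> \<in> (\<Union>k\<in>{1..K}. ?B k)" using \<omega> k(1) by auto
      qed
      show "(\<Union>k\<in>{1..K}. ?B k) \<in> sets M" using meas by auto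
    qed
    also have "\<dots> \<le> (\<Sum>k=1..K. M.prob (?B k))"
      using meas by (intro M.finite_measure_subadditive_finite) auto
    also have "\<dots> \<le> ?tail"
      using class_size_lower_tail[OF _ n1] by (intro sum_mono) (simp add: class_size_eq)
    finally show ?thesis .
  qed
  have "char (distr M borel standardized) t - \<gamma> = (\<Sum>y\<in>labelings. M.prob (label_event y) *\<^sub>R (a y - \<gamma>))"
    unfolding ch by (simp add: scaleR_diff_right sum_subtractf total flip: scaleR_left.sum)
  also have "cmod \<dots> \<le> (\<Sum>y\<in>labelings. M.prob (label_event y) * cmod (a y - \<gamma>))"
    by (rule order_trans[OF norm_sum]) simp
  also have "\<dots> \<le> (\<Sum>y\<in>labelings. M.prob (label_event y) * ?err + (if y \<in> bad then M.prob (label_event y) * 2 else 0))"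
  proof (rule sum_mono)
    fix y assume y: "y \<in> labelings"
    show "M.prob (label_event y) * cmod (a y - \<gamma>) \<le> M.prob (label_event y) * ?err + (if y \<in> bad then M.prob (label_event y) * 2 else 0)"
    proof (cases "y \<in> bad")
      case True
      have "M.prob (label_event y) * cmod (a y - \<gamma>) \<le> M.prob (label_event y) * 2"
        by (intro mult_left_mono any) simp
      moreover have "0 \<le> M.prob (label_event y) * ?err" using err by (intro mult_nonneg_nonneg) auto
      ultimately show ?thesis using True by simp
    next
      case False
      then show ?thesis using good[OF y False] by (simp add: mult_left_mono)
    qed
  qed
  also have "\<dots> = ?err + 2 * (\<Sum>y\<in>bad. M.prob (label_event y))"
  proof -
    have "(\<Sum>y\<in>labelings. M.prob (label_event y) * ?err) = ?err"
      unfolding sum_distrib_right[symmetric] total by simp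
    moreover have "(\<Sum>y\<in>labelings. if y \<in> bad then M.prob (label_event y) * 2 else 0) = (\<Sum>y\<in>bad. M.prob (label_event y) * 2)"
      using finite_labelings by (intro sum.mono_neutral_cong_right) (auto simp: bad_def)
    ultimately show ?thesis unfolding sum.distrib by (simp add: sum_distrib_left mult.commute)
  qed
  also have "\<dots> \<le> ?err + 2 * ?tail" using bad by simp
  finally show ?thesis unfolding \<gamma>_def .
qed

text \<open>
  The event is a disjoint union of events with fixed labels. On each of them gCov has the same conditional
  mean 0 and, as the variance depends on the labels only through the class sizes, the same conditional second
  moment.
\<close>

theorem variance_given_class_sizes:
  assumes c: "\<And>k. k \<in> {1..K} \<Longrightarrow> 2 \<le> c k" "(\<Sum>k=1..K. c k) = n"
  shows "prob_space.variance (uniform_measure M {\<omega> \<in> space M. \<forall>k\<in>{1..K}. sizes \<omega> k = c k}) gini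
    = sigma0_sq K n c (dcd_moment p F 2)"
proof -
  define S where "S = {y \<in> labelings. \<forall>k\<in>{1..K}. class_size n y (L k) = c k}"
  define A where "A = {\<omega> \<in> space M. \<forall>k\<in>{1..K}. sizes \<omega> k = c k}"
  have A: "A = {\<omega> \<in> space M. Ys \<omega> \<in> S}"
    using Ys_in_labelings by (auto simp: A_def S_def class_size_eq)
  have A_meas: "A \<in> sets M" unfolding A by (rule label_property_event)
  have SL: "S \<subseteq> labelings" by (auto simp: S_def)
  have finS: "finite S" using SL finite_labelings by (rule finite_subset)
  have n: "1 \<le> n"
  proof -
    have "c 1 \<le> (\<Sum>k=1..K. c k)" using K by (intro member_le_sum) auto
    then show ?thesis using c(1)[of 1] c(2) K by simp
  qed
  have "S \<noteq> {}"
  proof -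
    obtain f where f: "f \<in> {1..n} \<rightarrow> {1..K}" "\<And>k. k \<in> {1..K} \<Longrightarrow> card {i \<in> {1..n}. f i = k} = c k"
      using exists_labelling_with_class_sizes[of "{1..K}" "{1..n}" c] c(2) by auto
    define y where "y = (\<lambda>i\<in>{1..n}. L (f i))"
    have "class_size n y (L k) = c k" if k: "k \<in> {1..K}" for k
    proof -
      have "class_set n y (L k) = {i \<in> {1..n}. f i = k}"
        unfolding class_set_def y_def
      proof (rule Collect_cong, rule conj_cong[OF refl])
        fix i assume i: "i \<in> {1..n}"
        then have "f i \<in> {1..K}" using f(1) by auto
        then show "(restrict (\<lambda>i. L (f i)) {1..n} i = L k) = (f i = k)"
          using inj_on_eq_iff[OF L _ k] i by simp
      qed
      then show ?thesis unfolding class_size_def using f(2)[OF k] by (simp only:)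
    qed
    moreover have "y \<in> labelings" using f(1) by (auto simp: y_def labelings_def)
    ultimately show ?thesis by (auto simp: S_def)
  qed
  have PA: "M.prob A = (\<Sum>y\<in>S. M.prob (label_event y))"
    unfolding A by (rule sum_prob_label_event[OF n SL, symmetric])
  have PA0: "0 < M.prob A"
    unfolding PA using label_event(2)[OF n] SL \<open>S \<noteq> {}\<close> finS by (intro sum_pos) auto
  let ?U = "uniform_measure M A"
  have U: "?U = density M (\<lambda>x. ennreal (indicator A x / M.prob A))"
    by (rule uniform_measure_eq_density[OF PA0])
  have mean: "(\<integral>\<omega>. \<phi> (Ys \<omega>) (Xs \<omega>) \<partial>?U) = m"
    if \<phi>: "\<And>y. \<phi> y \<in> borel_measurable P" "\<And>y. y \<in> S \<Longrightarrow> integrable P (\<phi> y)"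
      and m: "\<And>y. y \<in> S \<Longrightarrow> integral\<^sup>L P (\<phi> y) = m" for \<phi> :: "(nat \<Rightarrow> 'c) \<Rightarrow> (nat \<Rightarrow> nat \<Rightarrow> real) \<Rightarrow> real" and m
  proof -
    have "(\<integral>\<omega>. \<phi> (Ys \<omega>) (Xs \<omega>) \<partial>?U) = (\<integral>\<omega>. (indicator A \<omega> / M.prob A) *\<^sub>R \<phi> (Ys \<omega>) (Xs \<omega>) \<partial>M)"
      unfolding U using A_meas
      by (intro integral_density function_of_sample_measurable \<phi>(1)) auto
    also have "\<dots> = (\<integral>\<omega>. indicator A \<omega> *\<^sub>R \<phi> (Ys \<omega>) (Xs \<omega>) \<partial>M) / M.prob A"
      by simp
    also have "(\<integral>\<omega>. indicator A \<omega> *\<^sub>R \<phi> (Ys \<omega>) (Xs \<omega>) \<partial>M) = (\<Sum>y\<in>S. M.prob (label_event y) *\<^sub>R integral\<^sup>L P (\<phi> y))"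
      unfolding A by (rule integral_over_labels(2)[OF n SL \<phi>(2)])
    also have "\<dots> = M.prob A * m"
      unfolding PA sum_distrib_right by (intro sum.cong refl) (simp add: m)
    finally show ?thesis using PA0 by simp
  qed
  have lab: "labelled_sample K L n y" if "y \<in> S" for y
    using that K L c(1) by unfold_locales (auto simp: S_def labelings_def)
  note g = gCov_mean_and_variance_given_labels[OF lab]
  have 1: "(\<integral>\<omega>. gini \<omega> \<partial>?U) = 0"
    unfolding gini_eq
    by (rule mean[of "\<lambda>y x. gCov K L p n x y"]) (auto intro: gCov_measurable g)
  have 2: "(\<integral>\<omega>. (gini \<omega>)\<^sup>2 \<partial>?U) = sigma0_sq K n c (dcd_moment p F 2)"
    unfolding gini_eq
  proof (rule mean[of "\<lambda>y x. (gCov K L p n x y)\<^sup>2"])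
    show "(\<lambda>x. (gCov K L p n x y)\<^sup>2) \<in> borel_measurable P" for y
      using gCov_measurable[of y] by simp
    show "integrable P (\<lambda>x. (gCov K L p n x y)\<^sup>2)" if "y \<in> S" for y by (rule g(3)[OF that])
    show "(\<integral>x. (gCov K L p n x y)\<^sup>2 \<partial>P) = sigma0_sq K n c (dcd_moment p F 2)" if y: "y \<in> S" for y
    proof -
      have "class_size n y (L k) = c k" if "k \<in> {1..K}" for k using y that by (auto simp: S_def)
      then have "sigma0_sq K n (\<lambda>k. class_size n y (L k)) D = sigma0_sq K n c D" for D
        unfolding sigma0_sq_def by (intro arg_cong2[where f="(*)"] arg_cong2[where f="(-)"] sum.cong refl) (simp_all only:)
      then show ?thesis using g(4)[OF y] by simp
    qed
  qed
  show ?thesis using 1 2 unfolding A_def by simp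
qed

end

theorem theorem2p1:
  fixes K :: nat and L :: "nat \<Rightarrow> 'c" and pr :: "nat \<Rightarrow> real"
    and n p :: "nat \<Rightarrow> nat"
    and J :: "nat \<Rightarrow> ((nat \<Rightarrow> real) \<times> 'c) measure"
    and F :: "nat \<Rightarrow> (nat \<Rightarrow> real) measure"
    and M :: "nat \<Rightarrow> 'a measure"
    and X :: "nat \<Rightarrow> nat \<Rightarrow> 'a \<Rightarrow> (nat \<Rightarrow> real)"
    and Y :: "nat \<Rightarrow> nat \<Rightarrow> 'a \<Rightarrow> 'c"
  assumes K: "2 \<le> K"
    and L: "inj_on L {1..K}"
    and n_lim: "filterlim n at_top sequentially"
    and p_lim: "filterlim p at_top sequentially"
    and J_prob: "\<And>\<nu>. prob_space (J \<nu>)"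
    and J_sets: "\<And>\<nu>. sets (J \<nu>) = sets (Rvec (p \<nu>) \<Otimes>\<^sub>M count_space (L ` {1..K}))"
    and F: "\<And>\<nu>. F \<nu> = distr (J \<nu>) (Rvec (p \<nu>)) fst"
    and Y_law: "\<And>\<nu> k. k \<in> {1..K} \<Longrightarrow> measure (J \<nu>) {z \<in> space (J \<nu>). snd z = L k} = pr k"
    and pr_pos: "\<And>k. k \<in> {1..K} \<Longrightarrow> 0 < pr k"
    and indep: "\<And>\<nu>. indep_rvs (J \<nu>) (Rvec (p \<nu>)) fst (count_space (L ` {1..K})) snd"
    and M_prob: "\<And>\<nu>. prob_space (M \<nu>)"
    and sample: "\<And>\<nu>. iid_sample (M \<nu>) (J \<nu>) (n \<nu>) (\<lambda>i \<omega>. (X \<nu> i \<omega>, Y \<nu> i \<omega>))"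
    and class_lim: "\<And>C. (\<lambda>\<nu>. measure (M \<nu>) {\<omega> \<in> space (M \<nu>).
            C \<le> Min ((\<lambda>k. class_size (n \<nu>) (\<lambda>i. Y \<nu> i \<omega>) (L k)) ` {1..K})})
          \<longlonglongrightarrow> 1"
    and nondeg: "\<And>\<nu>. 0 < dcd_moment (p \<nu>) (F \<nu>) 2"
    and cond1: "\<And>\<nu>. integrable (F \<nu>) (\<lambda>x. enorm (p \<nu>) x ^ 4)"
    and cond2: "(\<lambda>\<nu>. dcd_moment (p \<nu>) (F \<nu>) 4 / (real (n \<nu>) * (dcd_moment (p \<nu>) (F \<nu>) 2)\<^sup>2))
          \<longlonglongrightarrow> 0"
    and cond3: "(\<lambda>\<nu>. dcd_cycle (p \<nu>) (F \<nu>) / (dcd_moment (p \<nu>) (F \<nu>) 2)\<^sup>2) \<longlonglongrightarrow> 0"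
  shows "weak_conv_m
      (\<lambda>\<nu>. distr (M \<nu>) borel (\<lambda>\<omega>.
         gCov K L (p \<nu>) (n \<nu>) (\<lambda>i. X \<nu> i \<omega>) (\<lambda>i. Y \<nu> i \<omega>)
           / sqrt (sigma0_sq K (n \<nu>) (\<lambda>k. class_size (n \<nu>) (\<lambda>i. Y \<nu> i \<omega>) (L k))
                     (dcd_moment (p \<nu>) (F \<nu>) 2))))
      std_normal_distribution
    \<and> (\<forall>\<nu> c. (\<forall>k\<in>{1..K}. 2 \<le> c k) \<and> (\<Sum>k=1..K. c k) = n \<nu> \<longrightarrow>
         prob_space.variance
           (uniform_measure (M \<nu>)
              {\<omega> \<in> space (M \<nu>). \<forall>k\<in>{1..K}. class_size (n \<nu>) (\<lambda>i. Y \<nu> i \<omega>) (L k) = c k})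
           (\<lambda>\<omega>. gCov K L (p \<nu>) (n \<nu>) (\<lambda>i. X \<nu> i \<omega>) (\<lambda>i. Y \<nu> i \<omega>))
         = sigma0_sq K (n \<nu>) c (dcd_moment (p \<nu>) (F \<nu>) 2))"
proof
  have model: "gini_model (M \<nu>) (J \<nu>) K L pr (n \<nu>) (p \<nu>) (F \<nu>) (X \<nu>) (Y \<nu>)" for \<nu>
    by (intro gini_model.intro labelled_model.intro labelled_model_axioms.intro gini_model_axioms.intro
          M_prob J_prob K L J_sets F Y_law pr_pos indep sample cond1 nondeg)
  let ?T = "\<lambda>\<nu> \<omega>. gCov K L (p \<nu>) (n \<nu>) (\<lambda>i. X \<nu> i \<omega>) (\<lambda>i. Y \<nu> i \<omega>)
           / sqrt (sigma0_sq K (n \<nu>) (\<lambda>k. class_size (n \<nu>) (\<lambda>i. Y \<nu> i \<omega>) (L k))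
                     (dcd_moment (p \<nu>) (F \<nu>) 2))"
  show "weak_conv_m (\<lambda>\<nu>. distr (M \<nu>) borel (?T \<nu>)) std_normal_distribution"
  proof (rule levy_continuity)
    show "real_distribution (distr (M \<nu>) borel (?T \<nu>))" for \<nu>
      by (intro prob_space.real_distribution_distr M_prob gini_model.standardized_measurable[OF model])
    show "real_distribution std_normal_distribution" by (rule real_dist_normal_dist)
    fix t :: real
    \<comment> \<open>Half of the smallest class probability, so that classes below this proportion are rare.\<close>
    define \<delta> where "\<delta> = Min (pr ` {1..K}) / 2"
    define \<beta> where "\<beta> = 4 / \<delta>"
    have ne: "pr ` {1..K} \<noteq> {}" using K by simp
    have \<delta>: "0 < \<delta>" "\<And>k. k \<in> {1..K} \<Longrightarrow> \<delta> \<le> pr k / 2"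
      using ne pr_pos by (auto simp: \<delta>_def)
    let ?e = "\<lambda>\<nu>. dcd_moment (p \<nu>) (F \<nu>) 4 / (real (n \<nu>) * (dcd_moment (p \<nu>) (F \<nu>) 2)\<^sup>2)"
    let ?c = "\<lambda>\<nu>. dcd_cycle (p \<nu>) (F \<nu>) / (dcd_moment (p \<nu>) (F \<nu>) 2)\<^sup>2"
    let ?err = "\<lambda>\<nu>. clt_error t (sqrt (3 * \<beta>\<^sup>2 * ?e \<nu>)) (sqrt (3 * \<beta>\<^sup>2 * ?e \<nu> + 6 * \<beta> ^ 4 * ?c \<nu>))
      + 2 * (\<Sum>k=1..K. exp (- (real (n \<nu>) * (pr k)\<^sup>2 / 2)))"
    have n_real: "filterlim (\<lambda>\<nu>. real (n \<nu>)) at_top sequentially"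
      by (rule filterlim_compose[OF filterlim_real_sequentially n_lim])
    have "\<forall>\<^sub>F \<nu> in sequentially. 2 / \<delta> \<le> real (n \<nu>)"
      using n_real by (simp add: filterlim_at_top)
    then have bound: "\<forall>\<^sub>F \<nu> in sequentially. cmod (char (distr (M \<nu>) borel (?T \<nu>)) t - exp (- (t\<^sup>2 / 2))) \<le> ?err \<nu>"
    proof eventually_elim
      case (elim \<nu>)
      then have "2 \<le> \<delta> * real (n \<nu>)" using \<delta>(1) by (simp add: field_simps)
      from gini_model.standardized_char_bound[OF model \<delta> this, of t]
      show ?case unfolding \<beta>_def .
    qed
    have tail: "(\<lambda>\<nu>. exp (- (real (n \<nu>) * (pr k)\<^sup>2 / 2))) \<longlonglongrightarrow> 0" if k: "k \<in> {1..K}" for k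
    proof -
      have "filterlim (\<lambda>\<nu>. ((pr k)\<^sup>2 / 2) * real (n \<nu>)) at_top sequentially"
        using pr_pos[OF k] by (intro filterlim_tendsto_pos_mult_at_top[OF tendsto_const _ n_real]) auto
      then have "filterlim (\<lambda>\<nu>. - (((pr k)\<^sup>2 / 2) * real (n \<nu>))) at_bot sequentially"
        by (simp add: filterlim_uminus_at_bot)
      then have "(\<lambda>\<nu>. exp (- (((pr k)\<^sup>2 / 2) * real (n \<nu>)))) \<longlonglongrightarrow> 0"
        by (rule filterlim_compose[OF exp_at_bot])
      then show ?thesis by (simp add: mult.commute)
    qed
    have "?err \<longlonglongrightarrow> clt_error t (sqrt (3 * \<beta>\<^sup>2 * 0)) (sqrt (3 * \<beta>\<^sup>2 * 0 + 6 * \<beta> ^ 4 * 0)) + 2 * (\<Sum>k=1..K. 0)"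
      unfolding clt_error_def by (intro tendsto_intros cond2 cond3 tail) auto
    then have err: "?err \<longlonglongrightarrow> 0" by (simp add: clt_error_def)
    have "(\<lambda>\<nu>. char (distr (M \<nu>) borel (?T \<nu>)) t - exp (- (t\<^sup>2 / 2))) \<longlonglongrightarrow> 0"
      by (rule Lim_null_comparison[OF bound err])
    then have "(\<lambda>\<nu>. char (distr (M \<nu>) borel (?T \<nu>)) t) \<longlonglongrightarrow> exp (- (t\<^sup>2 / 2))"
      by (rule LIM_zero_cancel)
    then show "(\<lambda>\<nu>. char (distr (M \<nu>) borel (?T \<nu>)) t) \<longlonglongrightarrow> char std_normal_distribution t"
      by (simp add: char_std_normal_distribution)
  qed
  show "\<forall>\<nu> c. (\<forall>k\<in>{1..K}. 2 \<le> c k) \<and> (\<Sum>k=1..K. c k) = n \<nu> \<longrightarrow>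
         prob_space.variance
           (uniform_measure (M \<nu>)
              {\<omega> \<in> space (M \<nu>). \<forall>k\<in>{1..K}. class_size (n \<nu>) (\<lambda>i. Y \<nu> i \<omega>) (L k) = c k})
           (\<lambda>\<omega>. gCov K L (p \<nu>) (n \<nu>) (\<lambda>i. X \<nu> i \<omega>) (\<lambda>i. Y \<nu> i \<omega>))
         = sigma0_sq K (n \<nu>) c (dcd_moment (p \<nu>) (F \<nu>) 2)"
    by (intro allI impI gini_model.variance_given_class_sizes[OF model]) auto
qed

end
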